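(* Let $\Delta$ be a complete simplicial multi-fan in a lattice $L$ of rank $n$ and $\mathcal V=\{v_i\}_{i\in\Sigma^{(1)}}$ a set of generating edge vectors. Let $N>1$ be an integer relatively prime to $|H_I|$ for every $I\in\Sigma^{(n)}$. If the first Chern class $c_1(\Delta,\mathcal V)$ is divisible by $N$, then the modified orbifold elliptic genus $\breve\varphi(\Delta,\mathcal V;\tau,\sigma)$ of level $N$ (where $\sigma=\frac kN$, $0<k<N$) vanishes identically.
   Context: Multi-fans. Let $L$ be a lattice of rank $n$, $L_{\mathbb R}=L\otimes\mathbb R$, $L^*=\mathrm{Hom}(L,\mathbb Z)$, and $\langle\cdot,\cdot\rangle$ the dual pairing. An $n$-dimensional simplicial multi-fan in $L$ is a triple $\Delta=(\Sigma,C,w^\pm)$, where: $\Sigma$ is a finite abstract simplicial complex with the empty simplex included; $\Sigma^{(k)}$ is the set of simplices with exactly $k$ elements (so $\Sigma^{(0)}=\{\emptyset\}$, and a vertex $i$ is identified with $\{i\}\in\Sigma^{(1)}$); $\Sigma=\bigsqcup_{k=0}^n\Sigma^{(k)}$, $\Sigma^{(n)}\neq\emptyset$, and every simplex is contained in an element of $\Sigma^{(n)}$; $C$ assigns to each $I\in\Sigma^{(k)}$ a $k$-dimensional strongly convex rational polyhedral cone $C(I)\subset L_{\mathbb R}$ such that $C(J)$ is a face of $C(I)$ whenever $J$ is a face of $I$ (so $C(I)$ is spanned by the rays $C(i)$, $i\in I$); and $w^\pm:\Sigma^{(n)}\to\mathbb Z_{\ge0}$ are functions, with $w=w^+-w^-$.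 A vector $v\in L_{\mathbb R}$ is generic if it lies on no linear subspace spanned by a cone $C(J)$ of dimension less than $n$. $\Delta$ is pre-complete if $d_v=\sum_{I\in\Sigma^{(n)},\,v\in C(I)}w(I)$ is independent of the generic vector $v$; this integer is $\deg(\Delta)$. For $K\in\Sigma$, let $\Sigma_K=\{J\in\Sigma: K\subset J\}$, let $L^K$ be the image of $L$ in $L_{\mathbb R}/\mathrm{span}\,C(K)$, let $C_K(J)$ be the projection of $C(J)$, and let $w_K^\pm$ be the restriction of $w^\pm$ to $\Sigma_K^{(n-|K|)}=\{I\in\Sigma^{(n)}:K\subset I\}$; then $\Delta_K=(\Sigma_K,C_K,w_K^\pm)$ is the projected multi-fan in $L^K$. $\Delta$ is complete if $\Delta_K$ is pre-complete for all $K\in\Sigma$. Edge vectors. $\mathcal V=\{v_i\}_{i\in\Sigma^{(1)}}$ with $v_i\in L$ generating the ray $C(i)$, not necessarily primitive (but if $\Delta$ is non-singular, i.e. the primitive generators of the rays $C(i)$, $i\in I$, form a basis of $L$ for every $I\in\Sigma^{(n)}$, the $v_i$ are assumed primitive). For $I\in\Sigma^{(n)}$, $L_{I,\mathcal V}$ is the sublattice of $L$ generated by $\{v_i\}_{i\in I}$, $H_I=L/L_{I,\mathcal V}$, and $\{u_i^I\}_{i\in I}\subset L_{\mathbb R}^*$ is the basis dual to $\{v_i\}_{i\in I}$. $L_{\mathcal V}=\bigcap_{I\in\Sigma^{(n)}}L_{I,\mathcal V}$. Chern class. $H_T^2(\Delta)$ is the free abelian group on symbols $x_i$, $i\in\Sigma^{(1)}$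 (degree-two part of the face ring of $\Sigma$), and $L^*=H^2(BT)$ is embedded in it by $u\mapsto\sum_i\langle u,v_i\rangle x_i$. $c_1^T(\Delta,\mathcal V)=\sum_{i\in\Sigma^{(1)}}x_i$, and $c_1(\Delta,\mathcal V)$ is its image in $H_T^2(\Delta)/L^*$. $c_1(\Delta,\mathcal V)$ is divisible by $N$ if $c_1^T(\Delta,\mathcal V)=Nx+u$ for some $x\in H_T^2(\Delta)$, $u\in L^*$. Modified orbifold elliptic genus. For $z,\sigma\in\mathbb C$ and $\tau$ in the upper half plane put $t=e^{2\pi\sqrt{-1}z}$, $q=e^{2\pi\sqrt{-1}\tau}$, $\zeta=e^{2\pi\sqrt{-1}\sigma}$ (with $\zeta^{a}=e^{2\pi\sqrt{-1}a\sigma}$ for $a\in\mathbb Q$) and $$\phi(z,\tau,\sigma)=\zeta^{-\frac12}\frac{1-\zeta t}{1-t}\prod_{m=1}^\infty\frac{(1-\zeta tq^m)(1-\zeta^{-1}t^{-1}q^m)}{(1-tq^m)(1-t^{-1}q^m)}.$$ For a rational number $f=\frac sr$ with $r$ relatively prime to $N$, let $\breve f=ds$ where $d$ is an integer with $dr\equiv1\bmod N$; $\breve f$ is an integer well defined modulo $N$. Assume $N$ is relatively prime to all $|H_I|$ and $\sigma=\frac kN$, $0<k<N$. For generic $v\in L_{\mathcal V}$, $$\breve\varphi^v(\Delta,\mathcal V;z,\tau,\sigma)=\sum_{I\in\Sigma^{(n)}}\frac{w(I)}{|H_I|}\sum_{(h_1,h_2)\in H_I\times H_I}\prod_{i\in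 I}\zeta^{\langle u_i^I,v(h_1)\rangle\breve{}}\,\phi(-\langle u_i^I,zv-\tau v(h_1)+v(h_2)\rangle,\tau,\sigma),$$ where $v(h)\in L$ denotes a representative of $h$ and $\langle u_i^I,v(h_1)\rangle\breve{}$ is $\breve f$ for $f=\langle u_i^I,v(h_1)\rangle$ (the result is independent of representatives). The modified orbifold elliptic genus $\breve\varphi(\Delta,\mathcal V;\tau,\sigma)$ of level $N$ is the formal power series in $q$ whose coefficients are (up to the factor $\zeta^{-n/2}$) finite linear combinations, with coefficients in $\mathbb Z[\zeta]$, of characters $t^u$, $u\in L^*$, of the torus $T=L_{\mathbb R}/L$, determined by $v^*(\breve\varphi(\Delta,\mathcal V))=\breve\varphi^v(\Delta,\mathcal V)$ for all generic $v\in L_{\mathcal V}$, where $v^*(t^u)=t^{\langle u,v\rangle}$. It vanishes identically if and only if $\breve\varphi^v(\Delta,\mathcal V;z,\tau,\sigma)\equiv0$ for all generic $v\in L_{\mathcal V}$. *)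

theory Defs
  imports
    "HOL-Analysis.Analysis"
    "HOL-Library.Poly_Mapping"
    "HOL-Computational_Algebra.Computational_Algebra"
    "HOL-Number_Theory.Cong"
begin

section \<open>Lattices\<close>

text \<open>A lattice of rank \<open>n\<close> is realised inside a Euclidean space, as the integral span of \<open>n\<close> linearly
  independent vectors; \<open>L\<^sub>\<real>\<close> is then \<^term>\<open>span L\<close> and the rank is \<^term>\<open>dim L\<close>.\<close>

definition int_span :: "'a::real_vector set \<Rightarrow> 'a set" where
  "int_span = module.span (\<lambda>(k::int) x. of_int k *\<^sub>R x)"

definition is_lattice :: "'a::euclidean_space set \<Rightarrow> bool" where
  "is_lattice L \<longleftrightarrow> (\<exists>B. independent B \<and> L = int_span B)"

definition primitive_in :: "'a::real_vector set \<Rightarrow> 'a \<Rightarrow> bool" where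
  "primitive_in L v \<longleftrightarrow>
     v \<in> L \<and> v \<noteq> 0 \<and> (\<forall>x\<in>L. \<forall>m::nat. v = of_nat m *\<^sub>R x \<longrightarrow> m = 1)"

text \<open>\<open>L\<^sup>* = Hom(L, \<int>)\<close>, as linear forms on the ambient space; this is used only when
  \<^term>\<open>span L = UNIV\<close>.\<close>

definition dual_lattice :: "'a::real_vector set \<Rightarrow> ('a \<Rightarrow> real) set" where
  "dual_lattice L = {u. linear u \<and> u ` L \<subseteq> \<int>}"

definition strongly_convex_rational_cone :: "'a::real_vector set \<Rightarrow> 'a set \<Rightarrow> bool" where
  "strongly_convex_rational_cone L S \<longleftrightarrow>
     (\<exists>T. finite T \<and> T \<subseteq> L \<and> S = convex_cone hull T) \<and> S \<inter> uminus ` S = {0}"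


section \<open>Simplicial multi-fans\<close>

record ('i, 'a) multifan =
  lattice_of :: "'a set"
  simplices :: "'i set set"
  cone_of :: "'i set \<Rightarrow> 'a set"
  wplus :: "'i set \<Rightarrow> nat"
  wminus :: "'i set \<Rightarrow> nat"

definition rank_of :: "('i, 'a::euclidean_space) multifan \<Rightarrow> nat" where
  "rank_of \<Delta> = dim (lattice_of \<Delta>)"

definition simplices_card :: "('i, 'a) multifan \<Rightarrow> nat \<Rightarrow> 'i set set" where
  "simplices_card \<Delta> k = {I \<in> simplices \<Delta>. card I = k}"

definition top_simplices :: "('i, 'a::euclidean_space) multifan \<Rightarrow> 'i set set" where
  "top_simplices \<Delta> = simplices_card \<Delta> (rank_of \<Delta>)"

definition vertices :: "('i, 'a) multifan \<Rightarrow> 'i set" where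
  "vertices \<Delta> = {i. {i} \<in> simplices_card \<Delta> 1}"

definition weight :: "('i, 'a) multifan \<Rightarrow> 'i set \<Rightarrow> int" where
  "weight \<Delta> I = int (wplus \<Delta> I) - int (wminus \<Delta> I)"

text \<open>That \<open>C(I)\<close> is spanned by its rays \<open>C(i)\<close>, \<open>i \<in> I\<close>, is part of being simplicial. It is listed
  separately because the face condition alone would admit degenerate assignments such as
  \<open>C(i) = C(j)\<close> for an edge \<open>{i, j}\<close>.\<close>

definition is_multifan :: "('i, 'a::euclidean_space) multifan \<Rightarrow> bool" where
  "is_multifan \<Delta> \<longleftrightarrow>
     is_lattice (lattice_of \<Delta>) \<and>
     finite (simplices \<Delta>) \<and> {} \<in> simplices \<Delta> \<and>
     (\<forall>I\<in>simplices \<Delta>. finite I \<and> card I \<le> rank_of \<Delta> \<and> (\<forall>J\<subseteq>I. J \<in> simplices \<Delta>)) \<and>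
     top_simplices \<Delta> \<noteq> {} \<and>
     (\<forall>J\<in>simplices \<Delta>. \<exists>I\<in>top_simplices \<Delta>. J \<subseteq> I) \<and>
     (\<forall>I\<in>simplices \<Delta>.
        strongly_convex_rational_cone (lattice_of \<Delta>) (cone_of \<Delta> I) \<and>
        dim (cone_of \<Delta> I) = card I \<and>
        cone_of \<Delta> I = convex_cone hull (\<Union>i\<in>I. cone_of \<Delta> {i}) \<and>
        (\<forall>J\<subseteq>I. cone_of \<Delta> J face_of cone_of \<Delta> I))"

definition generic :: "('i, 'a::euclidean_space) multifan \<Rightarrow> 'a \<Rightarrow> bool" where
  "generic \<Delta> v \<longleftrightarrow>
     v \<in> span (lattice_of \<Delta>) \<and>
     (\<forall>J\<in>simplices \<Delta>. dim (cone_of \<Delta> J) < rank_of \<Delta> \<longrightarrow> v \<notin> span (cone_of \<Delta> J))"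

definition degree_at :: "('i, 'a::euclidean_space) multifan \<Rightarrow> 'a \<Rightarrow> int" where
  "degree_at \<Delta> v = (\<Sum>I | I \<in> top_simplices \<Delta> \<and> v \<in> cone_of \<Delta> I. weight \<Delta> I)"

definition pre_complete :: "('i, 'a::euclidean_space) multifan \<Rightarrow> bool" where
  "pre_complete \<Delta> \<longleftrightarrow> (\<exists>d. \<forall>v. generic \<Delta> v \<longrightarrow> degree_at \<Delta> v = d)"

text \<open>The quotient of the ambient space by a subspace \<open>W\<close> is realised as the orthogonal complement
  of \<open>W\<close>, the quotient map being the orthogonal projection.\<close>

definition quot_map :: "'a::euclidean_space set \<Rightarrow> 'a \<Rightarrow> 'a" where
  "quot_map W x = (THE y. y \<in> orthogonal_comp W \<and> x - y \<in> W)"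

text \<open>In the projected multi-fan a simplex \<open>J \<supseteq> K\<close> counts as having \<open>|J| - |K|\<close> elements; accordingly
  it is labelled by \<open>J - K\<close>.\<close>

definition projected :: "('i, 'a::euclidean_space) multifan \<Rightarrow> 'i set \<Rightarrow> ('i, 'a) multifan" where
  "projected \<Delta> K =
     (let \<pi> = quot_map (span (cone_of \<Delta> K)) in
      \<lparr> lattice_of = \<pi> ` lattice_of \<Delta>,
        simplices = {J - K | J. J \<in> simplices \<Delta> \<and> K \<subseteq> J},
        cone_of = (\<lambda>J. \<pi> ` cone_of \<Delta> (J \<union> K)),
        wplus = (\<lambda>J. wplus \<Delta> (J \<union> K)),
        wminus = (\<lambda>J. wminus \<Delta> (J \<union> K)) \<rparr>)"

definition complete_multifan :: "('i, 'a::euclidean_space) multifan \<Rightarrow> bool" where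
  "complete_multifan \<Delta> \<longleftrightarrow> (\<forall>K\<in>simplices \<Delta>. pre_complete (projected \<Delta> K))"


section \<open>Edge vectors\<close>

definition nonsingular :: "('i, 'a::euclidean_space) multifan \<Rightarrow> bool" where
  "nonsingular \<Delta> \<longleftrightarrow>
     (\<exists>p. (\<forall>i\<in>vertices \<Delta>. p i \<in> cone_of \<Delta> {i} \<and> primitive_in (lattice_of \<Delta>) (p i)) \<and>
          (\<forall>I\<in>top_simplices \<Delta>.
             inj_on p I \<and> independent (p ` I) \<and> int_span (p ` I) = lattice_of \<Delta>))"

definition edge_vectors :: "('i, 'a::euclidean_space) multifan \<Rightarrow> ('i \<Rightarrow> 'a) \<Rightarrow> bool" where
  "edge_vectors \<Delta> V \<longleftrightarrow>
     (\<forall>i\<in>vertices \<Delta>.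
        V i \<in> lattice_of \<Delta> \<and> V i \<noteq> 0 \<and> cone_of \<Delta> {i} = convex_cone hull {V i}) \<and>
     (nonsingular \<Delta> \<longrightarrow> (\<forall>i\<in>vertices \<Delta>. primitive_in (lattice_of \<Delta>) (V i)))"

definition edge_lattice :: "('i \<Rightarrow> 'a::real_vector) \<Rightarrow> 'i set \<Rightarrow> 'a set" where
  "edge_lattice V I = int_span (V ` I)"

definition common_edge_lattice ::
  "('i, 'a::euclidean_space) multifan \<Rightarrow> ('i \<Rightarrow> 'a) \<Rightarrow> 'a set" where
  "common_edge_lattice \<Delta> V = (\<Inter>I\<in>top_simplices \<Delta>. edge_lattice V I)"

text \<open>\<open>H\<^sub>I = L / L\<^sub>I\<close>, as a set of cosets.\<close>

definition local_group ::
  "('i, 'a::euclidean_space) multifan \<Rightarrow> ('i \<Rightarrow> 'a) \<Rightarrow> 'i set \<Rightarrow> 'a set set" where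
  "local_group \<Delta> V I =
     lattice_of \<Delta> //
       {(x, y). x \<in> lattice_of \<Delta> \<and> y \<in> lattice_of \<Delta> \<and> x - y \<in> edge_lattice V I}"

definition coset_rep :: "'a set \<Rightarrow> 'a" where
  "coset_rep h = (SOME x. x \<in> h)"

definition dual_vector :: "('i \<Rightarrow> 'a::real_vector) \<Rightarrow> 'i set \<Rightarrow> 'i \<Rightarrow> 'a \<Rightarrow> real" where
  "dual_vector V I i = (THE u. linear u \<and> (\<forall>j\<in>I. u (V j) = (if j = i then 1 else 0)))"


section \<open>First Chern class\<close>

text \<open>The degree-two part of the face ring is the free abelian group on the vertices, i.e. the
  elements of \<open>'i \<Rightarrow>\<^sub>0 int\<close> supported on the vertices; the generator \<open>x\<^sub>i\<close> is \<^term>\<open>frag_of i\<close>.\<close>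

definition face_ring_deg2 :: "('i, 'a) multifan \<Rightarrow> ('i \<Rightarrow>\<^sub>0 int) set" where
  "face_ring_deg2 \<Delta> = {x. Poly_Mapping.keys x \<subseteq> vertices \<Delta>}"

text \<open>The floor only converts the integral real number \<open>\<langle>u, v\<^sub>i\<rangle>\<close> to type \<^typ>\<open>int\<close>.\<close>

definition dual_embedding ::
  "('i, 'a) multifan \<Rightarrow> ('i \<Rightarrow> 'a) \<Rightarrow> ('a \<Rightarrow> real) \<Rightarrow> ('i \<Rightarrow>\<^sub>0 int)" where
  "dual_embedding \<Delta> V u = (\<Sum>i\<in>vertices \<Delta>. frag_cmul \<lfloor>u (V i)\<rfloor> (frag_of i))"

definition equivariant_c1 :: "('i, 'a) multifan \<Rightarrow> ('i \<Rightarrow>\<^sub>0 int)" where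
  "equivariant_c1 \<Delta> = (\<Sum>i\<in>vertices \<Delta>. frag_of i)"

definition c1_divisible ::
  "('i, 'a::real_vector) multifan \<Rightarrow> ('i \<Rightarrow> 'a) \<Rightarrow> nat \<Rightarrow> bool" where
  "c1_divisible \<Delta> V N \<longleftrightarrow>
     (\<exists>x\<in>face_ring_deg2 \<Delta>. \<exists>u\<in>dual_lattice (lattice_of \<Delta>).
        equivariant_c1 \<Delta> = frag_cmul (int N) x + dual_embedding \<Delta> V u)"


section \<open>The modified orbifold elliptic genus\<close>

definition e2pi :: "complex \<Rightarrow> complex" where
  "e2pi x = exp (2 * of_real pi * \<i> * x)"

text \<open>The infinite product starts at \<open>m = 1\<close>, hence the exponents \<^term>\<open>Suc m\<close>.\<close>

definition phi :: "complex \<Rightarrow> complex \<Rightarrow> complex \<Rightarrow> complex" where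
  "phi z \<tau> \<sigma> =
     (let t = e2pi z; q = e2pi \<tau>; \<zeta> = e2pi \<sigma> in
      e2pi (- \<sigma> / 2) * ((1 - \<zeta> * t) / (1 - t)) *
      prodinf (\<lambda>m. (1 - \<zeta> * t * q ^ Suc m) * (1 - inverse \<zeta> * inverse t * q ^ Suc m) /
                  ((1 - t * q ^ Suc m) * (1 - inverse t * q ^ Suc m))))"

text \<open>The integer \<open>d s\<close> attached to \<open>f = s / r\<close> is well defined only modulo \<open>N\<close>; it is used only as
  an exponent of an \<open>N\<close>-th root of unity.\<close>

definition breve :: "nat \<Rightarrow> real \<Rightarrow> int" where
  "breve N f =
     (SOME m. \<exists>s r d :: int. r \<noteq> 0 \<and> coprime r (int N) \<and> f = of_int s / of_int r \<and>
                [d * r = 1] (mod int N) \<and> m = d * s)"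

text \<open>\<open>-\<langle>u\<^sub>i\<^sup>I, z v - \<tau> v(h\<^sub>1) + v(h\<^sub>2)\<rangle>\<close>, with the pairing extended complex linearly.\<close>

definition phi_arg ::
  "('i \<Rightarrow> 'a::real_vector) \<Rightarrow> 'a \<Rightarrow> complex \<Rightarrow> complex \<Rightarrow> 'i set \<Rightarrow> 'a set \<Rightarrow> 'a set \<Rightarrow> 'i \<Rightarrow> complex" where
  "phi_arg V v z \<tau> I h1 h2 i =
     (let u = dual_vector V I i in
      - (z * of_real (u v) - \<tau> * of_real (u (coset_rep h1)) + of_real (u (coset_rep h2))))"

definition genus_at ::
  "('i, 'a::euclidean_space) multifan \<Rightarrow> ('i \<Rightarrow> 'a) \<Rightarrow> nat \<Rightarrow> nat \<Rightarrow> 'a \<Rightarrow> complex \<Rightarrow> complex \<Rightarrow> complex" where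
  "genus_at \<Delta> V N k v z \<tau> =
     (let \<sigma> = of_nat k / of_nat N; \<zeta> = e2pi \<sigma> in
      \<Sum>I\<in>top_simplices \<Delta>.
        of_int (weight \<Delta> I) / of_nat (card (local_group \<Delta> V I)) *
        (\<Sum>(h1, h2) \<in> local_group \<Delta> V I \<times> local_group \<Delta> V I.
           \<Prod>i\<in>I. \<zeta> powi breve N (dual_vector V I i (coset_rep h1)) *
                  phi (phi_arg V v z \<tau> I h1 h2 i) \<tau> \<sigma>))"

text \<open>\<^term>\<open>phi z \<tau> \<sigma>\<close> is meromorphic in \<open>z\<close> with poles contained in \<open>\<int> + \<int>\<tau>\<close>, where division by zero
  makes its value meaningless. Hence \<^term>\<open>genus_at\<close> represents the meromorphic function
  only away from the points excluded here.\<close>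

definition regular_point ::
  "('i, 'a::euclidean_space) multifan \<Rightarrow> ('i \<Rightarrow> 'a) \<Rightarrow> 'a \<Rightarrow> complex \<Rightarrow> complex \<Rightarrow> bool" where
  "regular_point \<Delta> V v z \<tau> \<longleftrightarrow>
     (\<forall>I\<in>top_simplices \<Delta>. \<forall>h1\<in>local_group \<Delta> V I. \<forall>h2\<in>local_group \<Delta> V I. \<forall>i\<in>I.
        \<forall>a b :: int. phi_arg V v z \<tau> I h1 h2 i \<noteq> of_int a + of_int b * \<tau>)"

text \<open>A finite linear combination of characters \<open>t\<^sup>u\<close> is an element of \<open>('a \<Rightarrow> real) \<Rightarrow>\<^sub>0 complex\<close>, and
  \<open>v\<^sup>*(t\<^sup>u) = t\<^bsup>\<langle>u, v\<rangle>\<^esup>\<close> with \<open>t = e\<^bsup>2\<pi>iz\<^esup>\<close>.\<close>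

definition char_pullback :: "'a \<Rightarrow> (('a \<Rightarrow> real) \<Rightarrow>\<^sub>0 complex) \<Rightarrow> complex \<Rightarrow> complex" where
  "char_pullback v c z =
     (\<Sum>u\<in>Poly_Mapping.keys c. Poly_Mapping.lookup c u * e2pi (of_real (u v) * z))"

text \<open>\<open>P\<close> is the genus as a formal power series in \<open>q\<close>: its coefficients lie in
  \<open>\<zeta>\<^bsup>-n/2\<^esup> \<int>[\<zeta>][L\<^sup>*]\<close>, and \<open>v\<^sup>*P\<close> is the \<open>q\<close>-expansion of \<^term>\<open>genus_at\<close>, which at a given \<open>z\<close> converges once
  \<open>q\<close> is small.\<close>

definition is_modified_genus ::
  "('i, 'a::euclidean_space) multifan \<Rightarrow> ('i \<Rightarrow> 'a) \<Rightarrow> nat \<Rightarrow> nat \<Rightarrow>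
     (('a \<Rightarrow> real) \<Rightarrow>\<^sub>0 complex) fps \<Rightarrow> bool" where
  "is_modified_genus \<Delta> V N k P \<longleftrightarrow>
     (let \<sigma> = of_nat k / of_nat N; \<zeta> = e2pi \<sigma> in
      (\<forall>m. Poly_Mapping.keys (fps_nth P m) \<subseteq> dual_lattice (lattice_of \<Delta>) \<and>
           (\<forall>u. \<exists>p :: int poly. Poly_Mapping.lookup (fps_nth P m) u =
                  e2pi (- of_nat (rank_of \<Delta>) * \<sigma> / 2) * poly (map_poly of_int p) \<zeta>)) \<and>
      (\<forall>v \<in> common_edge_lattice \<Delta> V. generic \<Delta> v \<longrightarrow>
         (\<forall>z. \<exists>B>0. \<forall>\<tau>. Im \<tau> > B \<longrightarrow> regular_point \<Delta> V v z \<tau> \<longrightarrow>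
            (\<lambda>m. char_pullback v (fps_nth P m) z * e2pi \<tau> ^ m) sums genus_at \<Delta> V N k v z \<tau>)))"

end

theory Submission
  imports Defs "HOL-Complex_Analysis.Complex_Analysis"
begin

text \<open>If \<open>c\<^sub>1\<^sup>T = N x + u\<close>, then \<open>\<langle>u, v\<^sub>i\<rangle> \<equiv> 1\<close> modulo \<open>N\<close> for every \<open>i\<close>. Extend the genus to a function \<open>F\<close> on
  the complexification of \<open>L\<^sub>\<real>\<close> by replacing \<open>z v\<close> with an arbitrary vector \<open>w\<close>. For \<open>v\<close> in the common
  edge lattice, \<open>F(w + v) = F(w)\<close> and \<open>F(w + \<tau> v) = \<zeta>\<^bsup>\<langle>u, v\<rangle>\<^esup> F(w)\<close>, and some \<open>v\<close> has \<open>\<zeta>\<^bsup>\<langle>u, v\<rangle>\<^esup> \<noteq> 1\<close>. Restrict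
  \<open>F\<close> to the line \<open>w + z v\<close>. If \<open>w\<close> is generic, all poles are simple and lie on hyperplanes spanned by
  ridges, and the residues along one ridge cancel by completeness. Hence the restriction is an entire
  function with two periods up to multipliers of modulus one, so it is constant, and the nontrivial
  multiplier forces it to vanish. Letting \<open>w\<close> tend to \<open>z v\<^sub>0\<close> gives the vanishing at \<open>v\<^sub>0\<close>, even if
  \<open>\<zeta>\<^bsup>\<langle>u, v\<^sub>0\<rangle>\<^esup> = 1\<close>.\<close>

section \<open>Quasi-periodic functions\<close>

text \<open>On the line z v through the origin the residue argument breaks down: for trivial h1 and
  h2 all n factors of a summand become singular together at z = 0, and poles of order up to n say
  little through their residues. Freeing the base point w separates the hyperplanes on which the
  factors are singular. The obstructions to separation lie in Q + Q \<tau>, hence are countable, and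
  a suitable w avoids them. Residues belonging to different I through one ridge can be compared only
  if the twist is a single function on L, although its definition by \<open>breve\<close> and the
  dual vectors refers to I. The congruence of u(v_i) with 1, the same at every vertex, is what
  produces one linear form for all I. The conclusion also concerns formal series. Their
  q-coefficients are isolated by letting q tend to 0, and the finitely many characters in a
  coefficient by a direction v on which they take distinct values: along the imaginary z-axis they
  then have different rates of growth.\<close>

lemma lattice_point_reduce:
  fixes \<tau> z :: complex
  assumes "Im \<tau> > 0"
  obtains a b :: int and x y :: real
  where "z = of_real x + of_real y * \<tau> + of_int a + of_int b * \<tau>"
    "x \<in> {0..1}" "y \<in> {0..1}"
proof -
  define y where "y = Im z / Im \<tau>"
  define x where "x = Re z - y * Re \<tau>"
  have "z = of_real x + of_real y * \<tau>"
    using assms by (simp add: complex_eq_iff x_def y_def)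
  also have "\<dots> = of_real (frac x) + of_real (frac y) * \<tau> + of_int \<lfloor>x\<rfloor> + of_int \<lfloor>y\<rfloor> * \<tau>"
    by (simp add: frac_def algebra_simps)
  finally show ?thesis
    using that[of "frac x" "frac y" "\<lfloor>x\<rfloor>" "\<lfloor>y\<rfloor>"] frac_lt_1[of x] frac_ge_0[of x] frac_lt_1[of y] frac_ge_0[of y]
    by (simp add: less_imp_le)
qed

lemma int_shift_multiplier:
  fixes f :: "complex \<Rightarrow> complex"
  assumes "\<And>z. f (z + p) = c * f z" "c \<noteq> 0"
  shows "f (z + of_int m * p) = c powi m * f z"
proof (induction m rule: int_induct[where k = 0])
  case base
  then show ?case by simp
next
  case (step1 i)
  have "f (z + of_int (i + 1) * p) = f ((z + of_int i * p) + p)"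
    by (simp add: algebra_simps)
  also have "\<dots> = c * (c powi i * f z)"
    by (simp only: assms step1.IH)
  finally show ?case
    using assms(2) by (simp add: power_int_add)
next
  case (step2 i)
  have "c powi i * f z = f (z + of_int i * p)"
    by (simp only: step2.IH)
  also have "\<dots> = f ((z + of_int (i - 1) * p) + p)"
    by (simp add: algebra_simps)
  also have "\<dots> = c * f (z + of_int (i - 1) * p)"
    by (simp only: assms)
  finally show ?case
    using assms(2) by (simp add: power_int_diff field_simps)
qed

lemma entire_quasi_periodic_zero:
  fixes f :: "complex \<Rightarrow> complex" and \<tau> c :: complex
  assumes "Im \<tau> > 0" "f holomorphic_on UNIV"
    and per: "\<And>z. f (z + 1) = f z" "\<And>z. f (z + \<tau>) = c * f z"
    and c: "c \<noteq> 1" "norm c = 1"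
  shows "f z = 0"
proof -
  have c0: "c \<noteq> 0" using c by auto
  have shift: "f (z + of_int a + of_int b * \<tau>) = c powi b * f z" for z a b
    using int_shift_multiplier[of f \<tau> c] int_shift_multiplier[of f 1 1] per c0 by simp
  define K where "K = (\<lambda>(x, y). complex_of_real x + of_real y * \<tau>) ` ({0..1} \<times> {0..1})"
  have "compact K"
    unfolding K_def by (intro compact_continuous_image compact_Times)
      (auto intro!: continuous_intros simp: case_prod_unfold)
  hence "bounded (f ` K)"
    using assms(2) by (intro compact_imp_bounded compact_continuous_image)
      (auto intro: holomorphic_on_imp_continuous_on continuous_on_subset)
  then obtain B where B: "\<And>z. z \<in> K \<Longrightarrow> norm (f z) \<le> B"
    by (auto simp: bounded_iff)
  \<comment> \<open>Modulus one of c keeps the bound on one period parallelogram valid after any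
    number of translations by \<tau>.\<close>
  have "norm (f z) \<le> B" for z
  proof -
    obtain a b x y where z: "z = of_real x + of_real y * \<tau> + of_int a + of_int b * \<tau>"
      "x \<in> {0..1}" "y \<in> {0..1}"
      using lattice_point_reduce[OF assms(1)] by metis
    have "norm (f z) = norm (f (of_real x + of_real y * \<tau>))"
      by (simp add: z shift norm_mult norm_power_int c)
    also have "of_real x + of_real y * \<tau> \<in> K"
      using z by (auto simp: K_def)
    ultimately show ?thesis using B by metis
  qed
  hence "bounded (range f)"
    by (auto simp: bounded_iff)
  then obtain d where d: "\<And>z. f z = d"
    using Liouville_theorem[OF assms(2)] by (auto simp: constant_on_def)
  with per(2)[of 0] c(1) show ?thesis by simp
qed

lemma filtermap_at_add: "filtermap (\<lambda>z. z + p) (at (z0::complex)) = at (z0 + p)"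
  using filtermap_at_shift[of "-p" z0] by simp

lemma remove_sings_shift: "remove_sings f (z + p) = remove_sings (\<lambda>z. f (z + p)) z"
  using remove_sings_compose[OF filtermap_at_add[of p z], of f] by (simp add: o_def)

text \<open>\<open>lim\<close> is Riemann's criterion, so every singularity is removable. The value
  of f at a singularity may be a mere convention for division by zero; hence the quasi-periods are
  transferred to \<open>remove_sings f\<close>, and continuity at a leads back to f.\<close>

lemma meromorphic_quasi_periodic_zero:
  fixes f :: "complex \<Rightarrow> complex" and \<tau> c :: complex
  assumes "Im \<tau> > 0" "f meromorphic_on UNIV"
    and lim: "\<And>a. ((\<lambda>z. (z - a) * f z) \<longlongrightarrow> 0) (at a)"
    and per: "\<And>z. f (z + 1) = f z" "\<And>z. f (z + \<tau>) = c * f z"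
    and c: "c \<noteq> 1" "norm c = 1"
    and "isCont f a"
  shows "f a = 0"
proof -
  have c0: "c \<noteq> 0" using c by auto
  have iso: "isolated_singularity_at f a" for a
    using assms(2) by (auto simp: meromorphic_on_altdef)
  have "\<exists>l. f \<midarrow>a\<rightarrow> l" for a
  proof -
    obtain A where A: "open A" "a \<in> A" "f holomorphic_on A - {a}"
      using iso[of a] analytic_imp_holomorphic isolated_singularity_at_iff_analytic_nhd by auto
    then obtain h where h: "h holomorphic_on A" "\<And>z. z \<in> A - {a} \<Longrightarrow> h z = f z"
      using holomorphic_on_extend_lim[OF A(3)] lim[of a] by (auto simp: interior_open)
    have "h \<midarrow>a\<rightarrow> h a"
      using A h(1) by (meson holomorphic_on_imp_continuous_on continuous_on_eq_continuous_at isCont_def)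
    moreover have "eventually (\<lambda>z. h z = f z) (at a)"
      using eventually_at_in_open[OF A(1,2)] by eventually_elim (rule h(2))
    ultimately show ?thesis
      using Lim_transform_eventually by blast
  qed
  hence "remove_sings f analytic_on {a}" for a
    using remove_sings_analytic_at[OF iso] by blast
  hence "remove_sings f holomorphic_on UNIV"
    by (meson analytic_imp_holomorphic analytic_on_analytic_at)
  moreover have "remove_sings f (z + 1) = remove_sings f z" for z
    by (simp add: remove_sings_shift per)
  moreover have "remove_sings f (z + \<tau>) = c * remove_sings f z" for z
  proof -
    obtain l where l: "f \<midarrow>z\<rightarrow> l" using \<open>\<And>a. \<exists>l. f \<midarrow>a\<rightarrow> l\<close> by blast
    have "(\<lambda>z. c * f z) \<midarrow>z\<rightarrow> c * l" by (intro tendsto_intros l)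
    thus ?thesis using l by (simp add: remove_sings_shift per remove_sings_eqI)
  qed
  ultimately have "remove_sings f a = 0"
    using entire_quasi_periodic_zero[OF assms(1) _ _ _ c] by blast
  moreover have "remove_sings f a = f a"
    using assms(8) by (intro remove_sings_eqI) (simp add: isCont_def)
  ultimately show ?thesis by simp
qed

section \<open>The theta quotient\<close>

lemma e2pi_add: "e2pi (x + y) = e2pi x * e2pi y"
  by (simp add: e2pi_def exp_add algebra_simps)

lemma e2pi_minus: "e2pi (- x) = inverse (e2pi x)"
  by (simp add: e2pi_def exp_minus)

lemma e2pi_nonzero [simp]: "e2pi x \<noteq> 0"
  by (simp add: e2pi_def)

lemma e2pi_0 [simp]: "e2pi 0 = 1"
  by (simp add: e2pi_def)

lemma e2pi_eq_1_iff: "e2pi x = 1 \<longleftrightarrow> x \<in> \<int>"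
proof -
  have "e2pi x = 1 \<longleftrightarrow> Im x = 0 \<and> (\<exists>n::int. Re x = of_int n)"
    unfolding e2pi_def exp_eq_1 by (auto simp: mult.assoc)
  thus ?thesis by (auto simp: complex_eq_iff Ints_def)
qed

lemma e2pi_of_int [simp]: "e2pi (of_int m) = 1"
  by (simp add: e2pi_eq_1_iff)

lemma e2pi_1 [simp]: "e2pi 1 = 1"
  using e2pi_of_int[of 1] by simp

lemma e2pi_eq_iff: "e2pi x = e2pi y \<longleftrightarrow> x - y \<in> \<int>"
proof -
  have "e2pi x = e2pi y \<longleftrightarrow> e2pi (x - y) = 1"
    using e2pi_add[of "x - y" y] by auto
  thus ?thesis by (simp add: e2pi_eq_1_iff)
qed

lemma e2pi_sum: "e2pi (\<Sum>i\<in>A. f i) = (\<Prod>i\<in>A. e2pi (f i))"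
  by (induction A rule: infinite_finite_induct) (simp_all add: e2pi_add)

lemma e2pi_power: "e2pi x ^ n = e2pi (of_nat n * x)"
  by (simp add: e2pi_def exp_of_nat_mult[symmetric] algebra_simps)

lemma e2pi_powi: "e2pi x powi m = e2pi (of_int m * x)"
  by (cases m rule: int_cases2) (simp_all add: power_int_minus e2pi_power e2pi_minus)

lemma norm_e2pi: "norm (e2pi x) = exp (- 2 * pi * Im x)"
  by (simp add: e2pi_def)

lemma holomorphic_e2pi [holomorphic_intros]: "f holomorphic_on A \<Longrightarrow> (\<lambda>z. e2pi (f z)) holomorphic_on A"
  unfolding e2pi_def by (intro holomorphic_intros)

text \<open>The Pochhammer symbol (x q; q)_\<infinity>.\<close>

definition qprod :: "complex \<Rightarrow> complex \<Rightarrow> complex" where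
  "qprod q x = prodinf (\<lambda>m. 1 - x * q ^ Suc m)"

text \<open>By the triple product this is Jacobi's odd theta function up to t^(1/2) and a factor
  depending on q only. Without the half-integral power it is single-valued in t.\<close>

definition qtheta :: "complex \<Rightarrow> complex \<Rightarrow> complex" where
  "qtheta q t = (1 - t) * qprod q t * qprod q (inverse t)"

context
  fixes q :: complex
  assumes q: "norm q < 1"
begin

lemma summable_qpow: "summable (\<lambda>m. norm (x * q ^ Suc m))"
  using summable_mult[OF summable_geometric[of "norm q"], of "norm x * norm q"] q
  by (simp add: norm_mult norm_power mult_ac)

lemma convergent_qprod: "convergent_prod (\<lambda>m. 1 - x * q ^ Suc m)"
  using summable_qpow[of x] abs_convergent_prod_conv_summable[of "\<lambda>m. 1 - x * q ^ Suc m"]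
  by (simp add: abs_convergent_prod_imp_convergent_prod)

lemma has_prod_qprod: "(\<lambda>m. 1 - x * q ^ Suc m) has_prod qprod q x"
  unfolding qprod_def using convergent_qprod convergent_prod_has_prod by blast

lemma qprod_eq_0_iff: "qprod q x = 0 \<longleftrightarrow> (\<exists>m. x * q ^ Suc m = 1)"
proof -
  have "qprod q x = 0 \<longleftrightarrow> (\<exists>m. 0 = 1 - x * q ^ Suc m)"
    using has_prod_eq_0_iff[OF has_prod_qprod[of x]] unfolding image_iff by blast
  moreover have "0 = 1 - x * q ^ Suc m \<longleftrightarrow> x * q ^ Suc m = 1" for m
    by (simp only: eq_diff_eq add_0_left)
  ultimately show ?thesis by blast
qed

lemma qprod_shift: "qprod q x = (1 - x * q) * qprod q (x * q)"
proof -
  have "(\<lambda>m. 1 - x * q ^ Suc m) has_prod ((\<Prod>k<1. 1 - x * q ^ Suc k) * prodinf (\<lambda>k. 1 - x * q ^ Suc (k + 1)))"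
    by (rule has_prod_ignore_initial_segment'[OF convergent_qprod])
  also have "prodinf (\<lambda>k. 1 - x * q ^ Suc (k + 1)) = qprod q (x * q)"
    by (simp add: qprod_def mult_ac)
  finally show ?thesis
    using has_prod_unique2[OF _ has_prod_qprod[of x]] by simp
qed

text \<open>The shift removes the first factor of one product and prepends 1 - 1/t to the other; 1 -
  1/t = - (1/t) (1 - t) restores the prefactor.\<close>

lemma qtheta_shift: "t \<noteq> 0 \<Longrightarrow> q \<noteq> 0 \<Longrightarrow> qtheta q (t * q) = - inverse t * qtheta q t"
proof -
  assume nz: "t \<noteq> 0" "q \<noteq> 0"
  have "qprod q (inverse (t * q)) = (1 - inverse t) * qprod q (inverse t)"
    using qprod_shift[of "inverse (t * q)"] nz by (simp add: field_simps)
  hence "qtheta q (t * q) = (1 - t * q) * qprod q (t * q) * (1 - inverse t) * qprod q (inverse t)"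
    by (simp add: qtheta_def)
  also have "\<dots> = qprod q t * (1 - inverse t) * qprod q (inverse t)"
    using qprod_shift[of t] by simp
  also have "\<dots> = - inverse t * qtheta q t"
    using nz by (simp add: qtheta_def field_simps)
  finally show ?thesis .
qed

lemma holomorphic_qprod: "qprod q holomorphic_on UNIV"
proof (rule holomorphic_uniform_sequence[where f = "\<lambda>n x. \<Prod>m<n. 1 - x * q ^ Suc m"])
  fix x :: complex
  have "uniformly_convergent_on (cball x 1) (\<lambda>n x. \<Prod>m<n. 1 - x * q ^ Suc m)"
  proof (rule uniformly_convergent_on_prod')
    show "uniformly_convergent_on (cball x 1) (\<lambda>N x. \<Sum>n<N. norm (1 - x * q ^ Suc n - 1))"
    proof (rule Weierstrass_m_test')
      show "summable (\<lambda>n. (norm x + 1) * norm (1 * q ^ Suc n))"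
        by (intro summable_mult summable_qpow)
      show "norm (norm (1 - y * q ^ Suc n - 1)) \<le> (norm x + 1) * norm (1 * q ^ Suc n)"
        if "y \<in> cball x 1" for n y
      proof -
        have "norm y \<le> norm x + 1"
          using that norm_triangle_sub[of y x] by (simp add: dist_norm norm_minus_commute)
        thus ?thesis by (simp add: norm_mult mult_right_mono)
      qed
    qed
  qed (auto intro!: continuous_intros)
  then obtain g where g: "uniform_limit (cball x 1) (\<lambda>n x. \<Prod>m<n. 1 - x * q ^ Suc m) g sequentially"
    by (auto simp: uniformly_convergent_on_def)
  have "g y = qprod q y" if "y \<in> cball x 1" for y
  proof -
    have "(\<lambda>n. \<Prod>m<n. 1 - y * q ^ Suc m) \<longlonglongrightarrow> qprod q y"
      using convergent_prod_LIMSEQ[OF convergent_qprod[of y]] 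
      by (subst (asm) LIMSEQ_lessThan_iff_atMost[symmetric]) (simp add: qprod_def)
    thus ?thesis
      using tendsto_uniform_limitI[OF g that] LIMSEQ_unique by blast
  qed
  hence "uniform_limit (cball x 1) (\<lambda>n x. \<Prod>m<n. 1 - x * q ^ Suc m) (qprod q) sequentially"
    using g by (auto elim!: uniform_limit_cong'[THEN iffD1, rotated 2])
  thus "\<exists>d>0. cball x d \<subseteq> UNIV \<and> uniform_limit (cball x d) (\<lambda>n x. \<Prod>m<n. 1 - x * q ^ Suc m) (qprod q) sequentially"
    by (intro exI[of _ 1]) auto
qed (auto intro!: holomorphic_intros)

text \<open>A convergent product vanishes only through one of its factors. The prefactor accounts
  for the exponent 0, the two products for the negative and the positive exponents.\<close>

lemma qtheta_eq_0_iff: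
  assumes "t \<noteq> 0" "q \<noteq> 0"
  shows "qtheta q t = 0 \<longleftrightarrow> (\<exists>m. t = q powi m)"
proof
  assume "qtheta q t = 0"
  then consider "t = 1" | m where "t * q ^ Suc m = 1" | m where "inverse t * q ^ Suc m = 1"
    unfolding qtheta_def mult_eq_0_iff qprod_eq_0_iff by auto
  thus "\<exists>m. t = q powi m"
  proof cases
    case 1
    thus ?thesis by (intro exI[of _ 0]) auto
  next
    case (2 m)
    hence "t = q powi (- int (Suc m))"
      using assms unfolding power_int_minus power_int_of_nat by (simp add: field_simps)
    thus ?thesis by blast
  next
    case (3 m)
    hence "t = q powi int (Suc m)"
      using assms unfolding power_int_of_nat by (simp add: field_simps)
    thus ?thesis by blast
  qed
next
  assume "\<exists>m. t = q powi m"
  then obtain m where m: "t = q powi m" by blast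
  consider "m = 0" | n where "m = int (Suc n)" | n where "m = - int (Suc n)"
    by (metis int_cases3 gr0_implies_Suc)
  thus "qtheta q t = 0"
  proof cases
    case 1
    thus ?thesis by (simp add: m qtheta_def)
  next
    case (2 n)
    hence "t = q ^ Suc n"
      by (simp only: m power_int_of_nat)
    hence "inverse t * q ^ Suc n = 1"
      using assms by (simp del: power_Suc)
    thus ?thesis unfolding qtheta_def mult_eq_0_iff qprod_eq_0_iff by blast
  next
    case (3 n)
    hence "t = inverse (q ^ Suc n)"
      by (simp only: m power_int_minus power_int_of_nat)
    hence "t * q ^ Suc n = 1"
      using assms by (simp del: power_Suc)
    thus ?thesis unfolding qtheta_def mult_eq_0_iff qprod_eq_0_iff by blast
  qed
qed

end

text \<open>Off the period lattice this is \<open>phi\<close>, rewritten as a quotient of two entire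
  functions of z, which separates zeros from poles.\<close>

definition theta_quot :: "complex \<Rightarrow> complex \<Rightarrow> complex \<Rightarrow> complex" where
  "theta_quot \<tau> \<sigma> z =
     e2pi (- \<sigma> / 2) * qtheta (e2pi \<tau>) (e2pi \<sigma> * e2pi z) / qtheta (e2pi \<tau>) (e2pi z)"

definition period_lattice :: "complex \<Rightarrow> complex set" where
  "period_lattice \<tau> = {of_int a + of_int b * \<tau> | a b. True}"

lemma period_lattice_uminus: "- x \<in> period_lattice \<tau> \<longleftrightarrow> x \<in> period_lattice \<tau>"
proof -
  have "- x \<in> period_lattice \<tau>" if x: "x \<in> period_lattice \<tau>" for x
  proof -
    obtain a b where "x = of_int a + of_int b * \<tau>" using x by (auto simp: period_lattice_def)
    hence "- x = of_int (- a) + of_int (- b) * \<tau>" by simp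
    thus ?thesis unfolding period_lattice_def by blast
  qed
  from this[of x] this[of "- x"] show ?thesis by auto
qed

context
  fixes \<tau> :: complex
  assumes \<tau>: "Im \<tau> > 0"
begin

lemma norm_nome: "norm (e2pi \<tau>) < 1"
  using \<tau> by (simp add: norm_e2pi)

lemma qtheta_e2pi_eq_0_iff: "qtheta (e2pi \<tau>) (e2pi z) = 0 \<longleftrightarrow> z \<in> period_lattice \<tau>"
proof -
  have "qtheta (e2pi \<tau>) (e2pi z) = 0 \<longleftrightarrow> (\<exists>m. z - of_int m * \<tau> \<in> \<int>)"
    by (simp add: qtheta_eq_0_iff norm_nome e2pi_powi e2pi_eq_iff)
  also have "\<dots> \<longleftrightarrow> z \<in> period_lattice \<tau>"
    unfolding period_lattice_def Ints_def image_def mem_Collect_eq diff_eq_eq by (metis UNIV_I)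
  finally show ?thesis .
qed

lemma phi_eq_theta_quot:
  assumes "z \<notin> period_lattice \<tau>"
  shows "phi z \<tau> \<sigma> = theta_quot \<tau> \<sigma> z"
proof -
  define q t \<zeta> where "q = e2pi \<tau>" and "t = e2pi z" and "\<zeta> = e2pi \<sigma>"
  have q: "norm q < 1" using norm_nome by (simp add: q_def)
  have [simp]: "t \<noteq> 0" "\<zeta> \<noteq> 0" by (auto simp: t_def \<zeta>_def)
  have "qtheta q t \<noteq> 0"
    using assms qtheta_e2pi_eq_0_iff by (simp add: q_def t_def)
  hence nz: "1 - t * q ^ Suc m \<noteq> 0" "1 - inverse t * q ^ Suc m \<noteq> 0" for m
    using qprod_eq_0_iff[OF q] unfolding qtheta_def by auto
  have "(\<lambda>m. (1 - \<zeta> * t * q ^ Suc m) * (1 - inverse (\<zeta> * t) * q ^ Suc m) /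
                  ((1 - t * q ^ Suc m) * (1 - inverse t * q ^ Suc m)))
     has_prod (qprod q (\<zeta> * t) * qprod q (inverse (\<zeta> * t)) / (qprod q t * qprod q (inverse t)))"
    by (intro has_prod_divide has_prod_mult has_prod_qprod q)
  hence "prodinf (\<lambda>m. (1 - \<zeta> * t * q ^ Suc m) * (1 - inverse \<zeta> * inverse t * q ^ Suc m) /
                  ((1 - t * q ^ Suc m) * (1 - inverse t * q ^ Suc m)))
     = qprod q (\<zeta> * t) * qprod q (inverse (\<zeta> * t)) / (qprod q t * qprod q (inverse t))"
    by (simp add: has_prod_iff)
  thus ?thesis
    unfolding phi_def Let_def theta_quot_def qtheta_def q_def[symmetric] t_def[symmetric] \<zeta>_def[symmetric]
    by (simp add: mult.assoc)
qed

lemma theta_quot_add_1: "theta_quot \<tau> \<sigma> (z + 1) = theta_quot \<tau> \<sigma> z"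
  by (simp add: theta_quot_def e2pi_add)

text \<open>The multipliers of numerator and denominator, -1/(\<zeta> t) and -1/t, both depend on t,
  but their quotient is the constant 1/\<zeta>. For real \<sigma> it has modulus one.\<close>

lemma theta_quot_add_period: "theta_quot \<tau> \<sigma> (z + \<tau>) = inverse (e2pi \<sigma>) * theta_quot \<tau> \<sigma> z"
  using qtheta_shift[OF norm_nome, of "e2pi \<sigma> * e2pi z"] qtheta_shift[OF norm_nome, of "e2pi z"]
  by (simp add: theta_quot_def e2pi_add mult.assoc)

text \<open>No condition on z appears: at a point of the period lattice the denominators vanish and
  both sides are 0.\<close>

lemma theta_quot_shift:
  "theta_quot \<tau> \<sigma> (z + of_int a + of_int b * \<tau>) = e2pi \<sigma> powi (- b) * theta_quot \<tau> \<sigma> z"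
  using int_shift_multiplier[of "theta_quot \<tau> \<sigma>" \<tau> "inverse (e2pi \<sigma>)" "z + of_int a" b]
    int_shift_multiplier[of "theta_quot \<tau> \<sigma>" 1 1 z a]
  by (simp add: theta_quot_add_1 theta_quot_add_period power_int_inverse power_int_minus)

lemma holomorphic_qtheta: "(\<lambda>z. qtheta (e2pi \<tau>) (\<zeta> * e2pi z)) holomorphic_on UNIV"
proof (cases "\<zeta> = 0")
  case False
  have h: "(\<lambda>z. qprod (e2pi \<tau>) (f z)) holomorphic_on UNIV" if "f holomorphic_on UNIV" for f
    using holomorphic_on_compose_gen[OF that holomorphic_qprod[OF norm_nome]] by (simp add: o_def)
  thus ?thesis
    unfolding qtheta_def using False by (intro holomorphic_intros h) auto
qed auto

lemma theta_quot_analytic: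
  assumes "z \<notin> period_lattice \<tau>"
  shows "theta_quot \<tau> \<sigma> analytic_on {z}"
proof -
  have "(\<lambda>z. qtheta (e2pi \<tau>) (\<zeta> * e2pi z)) analytic_on {z}" for \<zeta>
    using holomorphic_qtheta by (metis analytic_on_open analytic_on_subset open_UNIV subset_UNIV)
  note this[of "e2pi \<sigma>"] this[of 1]
  thus ?thesis
    unfolding theta_quot_def using assms
    by (intro analytic_intros) (auto simp: qtheta_e2pi_eq_0_iff)
qed

lemma theta_quot_isCont: "z \<notin> period_lattice \<tau> \<Longrightarrow> isCont (theta_quot \<tau> \<sigma>) z"
  using theta_quot_analytic analytic_at_imp_isCont by blast

lemma theta_quot_meromorphic: "theta_quot \<tau> \<sigma> meromorphic_on UNIV"
proof -
  have "(\<lambda>z. qtheta (e2pi \<tau>) (\<zeta> * e2pi z)) meromorphic_on UNIV" for \<zeta>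
    using holomorphic_qtheta analytic_on_open open_UNIV analytic_on_imp_meromorphic_on by blast
  note this[of "e2pi \<sigma>"] this[of 1]
  thus ?thesis
    unfolding theta_quot_def by (intro meromorphic_intros) auto
qed

text \<open>The denominator vanishes at 0 only through its factor 1 - t, and (1 - t)/z tends to -2
  pi i, while the remaining product D is continuous and nonzero there. The value of the limit may
  stay implicit, since it enters all residues as the same factor.\<close>

lemma theta_quot_residue: "\<exists>\<rho>. ((\<lambda>z. z * theta_quot \<tau> \<sigma> z) \<longlongrightarrow> \<rho>) (at 0)"
proof -
  define D where "D = (\<lambda>z. qprod (e2pi \<tau>) (e2pi z) * qprod (e2pi \<tau>) (inverse (e2pi z)))"
  have D0: "D 0 \<noteq> 0"
  proof -
    have "e2pi \<tau> ^ Suc m \<noteq> 1" for m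
    proof
      assume "e2pi \<tau> ^ Suc m = 1"
      hence "norm (e2pi \<tau>) ^ Suc m = 1" by (metis norm_one norm_power)
      thus False using norm_nome power_Suc_less_one[of "norm (e2pi \<tau>)" m] by simp
    qed
    thus ?thesis by (simp add: D_def qprod_eq_0_iff[OF norm_nome] del: power_Suc)
  qed
  have isC: "isCont (\<lambda>z. qprod (e2pi \<tau>) (f z)) 0" if "isCont f 0" for f :: "complex \<Rightarrow> complex"
  proof -
    have "isCont (qprod (e2pi \<tau>)) (f 0)"
      using holomorphic_qprod[OF norm_nome] holomorphic_on_imp_continuous_on 
        continuous_on_eq_continuous_at open_UNIV by blast
    thus ?thesis using that isCont_o2 by blast
  qed
  have "isCont e2pi 0"
    unfolding e2pi_def by (intro continuous_intros)
  hence "isCont D 0"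
    unfolding D_def by (intro continuous_intros isC) auto
  hence D: "D \<midarrow>0\<rightarrow> D 0" by (simp add: isCont_def)
  define E where "E = (\<lambda>z. e2pi (- \<sigma> / 2) * qtheta (e2pi \<tau>) (e2pi \<sigma> * e2pi z))"
  have "isCont E 0"
    unfolding E_def using holomorphic_qtheta[of "e2pi \<sigma>"]
    by (intro continuous_intros) 
      (metis holomorphic_on_imp_continuous_on continuous_on_eq_continuous_at open_UNIV UNIV_I)
  hence E: "E \<midarrow>0\<rightarrow> E 0" by (simp add: isCont_def)
  have "(e2pi has_field_derivative (2 * of_real pi * \<i>)) (at 0)"
    unfolding e2pi_def by (auto intro!: derivative_eq_intros)
  hence "(\<lambda>z. (e2pi z - 1) / z) \<midarrow>0\<rightarrow> 2 * of_real pi * \<i>"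
    by (simp add: has_field_derivative_iff)
  hence "(\<lambda>z. E z / (- ((e2pi z - 1) / z) * D z)) \<midarrow>0\<rightarrow> E 0 / (- (2 * of_real pi * \<i>) * D 0)"
    using D0 by (intro tendsto_intros E D) auto
  moreover have "E z / (- ((e2pi z - 1) / z) * D z) = z * theta_quot \<tau> \<sigma> z" for z
  proof -
    have "qtheta (e2pi \<tau>) (e2pi z) = (1 - e2pi z) * D z"
      by (simp add: qtheta_def D_def)
    moreover have "- ((e2pi z - 1) / z) * D z = (1 - e2pi z) * D z / z"
      by (simp add: minus_divide_left)
    ultimately show ?thesis by (simp add: theta_quot_def E_def)
  qed
  ultimately show ?thesis by auto
qed

end

section \<open>Lattices and dual bases\<close>

interpretation int_module: module "\<lambda>(k::int) (x::'a::real_vector). of_int k *\<^sub>R x"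
  by unfold_locales (simp_all add: algebra_simps)

definition add_subgroup :: "'a::real_vector set \<Rightarrow> bool" where
  "add_subgroup G \<longleftrightarrow> 0 \<in> G \<and> (\<forall>x\<in>G. \<forall>y\<in>G. x - y \<in> G)"

lemma add_subgroup_zero: "add_subgroup G \<Longrightarrow> 0 \<in> G"
  by (simp add: add_subgroup_def)

lemma add_subgroup_diff: "add_subgroup G \<Longrightarrow> x \<in> G \<Longrightarrow> y \<in> G \<Longrightarrow> x - y \<in> G"
  by (simp add: add_subgroup_def)

lemma add_subgroup_uminus: "add_subgroup G \<Longrightarrow> x \<in> G \<Longrightarrow> - x \<in> G"
  using add_subgroup_diff[of G 0 x] add_subgroup_zero[of G] by simp

lemma add_subgroup_add: "add_subgroup G \<Longrightarrow> x \<in> G \<Longrightarrow> y \<in> G \<Longrightarrow> x + y \<in> G"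
  using add_subgroup_diff[of G x "- y"] add_subgroup_uminus[of G y] by simp

lemma add_subgroup_int_scale:
  assumes "add_subgroup G" "x \<in> G"
  shows "of_int m *\<^sub>R x \<in> G"
proof (induction m rule: int_induct[where k = 0])
  case base
  then show ?case using assms add_subgroup_zero by simp
next
  case (step1 i)
  then show ?case using assms add_subgroup_add[of G] by (simp add: algebra_simps)
next
  case (step2 i)
  then show ?case using assms add_subgroup_diff[of G] by (simp add: algebra_simps)
qed

lemma add_subgroup_nat_scale: "add_subgroup G \<Longrightarrow> x \<in> G \<Longrightarrow> of_nat m *\<^sub>R x \<in> G"
  using add_subgroup_int_scale[of G x "int m"] by simp

lemma add_subgroup_int_span: "add_subgroup (int_span B)"
  unfolding add_subgroup_def int_span_def
  using int_module.span_zero int_module.span_diff by blast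

lemma is_lattice_add_subgroup: "is_lattice L \<Longrightarrow> add_subgroup L"
  using add_subgroup_int_span by (auto simp: is_lattice_def)

lemma int_span_subset:
  assumes "add_subgroup G" "B \<subseteq> G"
  shows "int_span B \<subseteq> G"
  unfolding int_span_def
proof (rule int_module.span_minimal[OF assms(2)])
  show "int_module.subspace G"
    unfolding int_module.subspace_def
    using assms(1) add_subgroup_zero add_subgroup_add add_subgroup_int_scale by blast
qed

locale basis_family =
  fixes V :: "'i \<Rightarrow> 'a::euclidean_space" and I :: "'i set"
  assumes fin: "finite I" and inj: "inj_on V I"
    and indep: "independent (V ` I)" and spanning: "span (V ` I) = UNIV"
begin

abbreviation dual :: "'i \<Rightarrow> 'a \<Rightarrow> real" where
  "dual \<equiv> dual_vector V I"

lemma dual_vector_spec: "linear (dual i) \<and> (\<forall>j\<in>I. dual i (V j) = (if j = i then 1 else 0))"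
proof -
  define f where "f = (\<lambda>x. if inv_into I V x = i then 1 else 0 :: real)"
  obtain u where u: "linear u" "\<And>x. x \<in> V ` I \<Longrightarrow> u x = f x"
    using linear_independent_extend[OF indep, of f] by auto
  have "\<exists>!u. linear u \<and> (\<forall>j\<in>I. u (V j) = (if j = i then 1 else 0 :: real))"
  proof (rule ex1I[of _ u])
    show "linear u \<and> (\<forall>j\<in>I. u (V j) = (if j = i then 1 else 0))"
      using u by (simp add: f_def inj)
    fix w assume w: "linear w \<and> (\<forall>j\<in>I. w (V j) = (if j = i then 1 else 0 :: real))"
    show "w = u"
    proof
      fix x
      show "w x = u x"
        by (rule linear_eq_on[of w u x "V ` I"]) (use w u spanning in \<open>auto simp: f_def inj\<close>)
    qed
  qed
  from theI'[OF this] show ?thesis unfolding dual_vector_def .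
qed

lemma linear_dual: "linear (dual i)"
  using dual_vector_spec by blast

lemma dual_basis: "j \<in> I \<Longrightarrow> dual i (V j) = (if j = i then 1 else 0)"
  using dual_vector_spec by blast

lemma dual_expansion: "(\<Sum>i\<in>I. dual i x *\<^sub>R V i) = x"
proof (rule linear_eq_on[of "\<lambda>x. \<Sum>i\<in>I. dual i x *\<^sub>R V i" "\<lambda>x. x" x "V ` I"])
  show "linear (\<lambda>x. \<Sum>i\<in>I. dual i x *\<^sub>R V i)"
    using linear_dual by (intro linear_compose_sum) (auto intro!: linearI simp: linear_add linear_scale algebra_simps)
  show "(\<Sum>i\<in>I. dual i b *\<^sub>R V i) = b" if b: "b \<in> V ` I" for b
  proof -
    obtain j where j: "j \<in> I" "b = V j" using b by auto
    have "(\<Sum>i\<in>I. dual i b *\<^sub>R V i) = (\<Sum>i\<in>I. if i = j then V i else 0)"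
      using j by (intro sum.cong) (auto simp: dual_basis)
    thus ?thesis using j fin by simp
  qed
qed (use spanning in \<open>auto simp: linear_id[unfolded id_def]\<close>)

lemma linear_dual_expansion:
  assumes "linear f"
  shows "f x = (\<Sum>i\<in>I. dual i x * f (V i) :: real)"
proof -
  have "f x = f (\<Sum>i\<in>I. dual i x *\<^sub>R V i)" by (simp add: dual_expansion)
  thus ?thesis using assms by (simp add: linear_sum linear_scale)
qed

lemma edge_lattice_iff: "x \<in> edge_lattice V I \<longleftrightarrow> (\<forall>i\<in>I. dual i x \<in> \<int>)"
proof
  assume "x \<in> edge_lattice V I"
  moreover have "edge_lattice V I \<subseteq> {x. \<forall>i\<in>I. dual i x \<in> \<int>}"
    unfolding edge_lattice_def
    by (intro int_span_subset)
      (auto simp: add_subgroup_def linear_diff[OF linear_dual] linear_0[OF linear_dual] dual_basis)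
  ultimately show "\<forall>i\<in>I. dual i x \<in> \<int>" by blast
next
  assume *: "\<forall>i\<in>I. dual i x \<in> \<int>"
  have "(\<Sum>i\<in>I. dual i x *\<^sub>R V i) \<in> int_span (V ` I)"
    unfolding int_span_def
  proof (rule int_module.span_sum)
    fix i assume "i \<in> I"
    then obtain m where "dual i x = of_int m" using * by (auto elim: Ints_cases)
    thus "dual i x *\<^sub>R V i \<in> int_module.span (V ` I)"
      using int_module.span_scale[OF int_module.span_base[of "V i" "V ` I"], of m] \<open>i \<in> I\<close> by simp
  qed
  thus "x \<in> edge_lattice V I" by (simp add: dual_expansion edge_lattice_def)
qed

lemma edge_lattice_subgroup: "add_subgroup (edge_lattice V I)"
  by (simp add: edge_lattice_def add_subgroup_int_span)

lemma edge_in_edge_lattice: "i \<in> I \<Longrightarrow> V i \<in> edge_lattice V I"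
  by (simp add: edge_lattice_iff dual_basis)

text \<open>Through this lemma a functional attached to a ridge is recognised, in every simplex I
  containing the ridge, as a multiple of the dual vector of the remaining vertex.\<close>

lemma dual_remove_unique:
  assumes "linear e" "\<And>j. j \<in> I - {i} \<Longrightarrow> e (V j) = 0" "i \<in> I"
  shows "e x = e (V i) * dual i x"
proof -
  have "e x = (\<Sum>j\<in>I. if j = i then dual j x * e (V j) else 0)"
    unfolding linear_dual_expansion[OF assms(1), of x]
    using assms(2) by (intro sum.cong) auto
  thus ?thesis using fin assms(3) by simp
qed

end

text \<open>The kernel of the i-th dual vector is spanned by the ridge, whose vectors belong to both
  bases; on it both dual vectors read off the same coordinate.\<close>

lemma dual_vector_eq_on_kernel:
  assumes "basis_family V I" "basis_family V I'" "i \<in> I" "i' \<in> I'" "I - {i} = I' - {i'}" "j \<in> I - {i}"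
    and "dual_vector V I i x = 0"
  shows "dual_vector V I' j x = dual_vector V I j x"
proof -
  interpret A: basis_family V I by fact
  interpret B: basis_family V I' by fact
  have "B.dual j x = (\<Sum>m\<in>I. A.dual m x * B.dual j (V m))"
    by (rule A.linear_dual_expansion[OF B.linear_dual])
  also have "\<dots> = (\<Sum>m\<in>I. if m = j then A.dual m x else 0)"
  proof (rule sum.cong)
    fix m assume m: "m \<in> I"
    show "A.dual m x * B.dual j (V m) = (if m = j then A.dual m x else 0)"
    proof (cases "m = i")
      case False
      hence "m \<in> I'" using m assms(5) by blast
      thus ?thesis by (simp add: B.dual_basis)
    qed (use assms(6,7) in auto)
  qed simp
  also have "\<dots> = A.dual j x" using A.fin assms(6) by simp
  finally show ?thesis .
qed

section \<open>Cosets\<close>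

text \<open>A is an arbitrary set because the definition is also applied to slices of L, which are
  neither subgroups nor unions of cosets of \<Lambda>.\<close>

definition cosets :: "'a::real_vector set \<Rightarrow> 'a set \<Rightarrow> 'a set set" where
  "cosets A \<Lambda> = A // {(x, y). x \<in> A \<and> y \<in> A \<and> x - y \<in> \<Lambda>}"

definition coset_of :: "'a::real_vector set \<Rightarrow> 'a set \<Rightarrow> 'a \<Rightarrow> 'a set" where
  "coset_of A \<Lambda> x = {y \<in> A. x - y \<in> \<Lambda>}"

lemma local_group_eq: "local_group \<Delta> V I = cosets (lattice_of \<Delta>) (edge_lattice V I)"
  by (simp add: local_group_def cosets_def)

lemma cosets_eq: "cosets A \<Lambda> = coset_of A \<Lambda> ` A"
  by (auto simp: cosets_def coset_of_def quotient_def)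

context
  fixes \<Lambda> :: "'a::real_vector set"
  assumes \<Lambda>: "add_subgroup \<Lambda>"
begin

lemma diff_mem_commute: "x - y \<in> \<Lambda> \<longleftrightarrow> y - x \<in> \<Lambda>"
  using add_subgroup_uminus[OF \<Lambda>, of "x - y"] add_subgroup_uminus[OF \<Lambda>, of "y - x"] by auto

lemma diff_mem_trans: "x - y \<in> \<Lambda> \<Longrightarrow> y - z \<in> \<Lambda> \<Longrightarrow> x - z \<in> \<Lambda>"
  using add_subgroup_add[OF \<Lambda>, of "x - y" "y - z"] by simp

lemma coset_of_self: "x \<in> A \<Longrightarrow> x \<in> coset_of A \<Lambda> x"
  using add_subgroup_zero[OF \<Lambda>] by (simp add: coset_of_def)

lemma coset_of_eq_iff: "x \<in> A \<Longrightarrow> y \<in> A \<Longrightarrow> coset_of A \<Lambda> x = coset_of A \<Lambda> y \<longleftrightarrow> x - y \<in> \<Lambda>"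
proof
  assume "x \<in> A" "y \<in> A" "coset_of A \<Lambda> x = coset_of A \<Lambda> y"
  hence "y \<in> coset_of A \<Lambda> x" using coset_of_self[of y A] by simp
  thus "x - y \<in> \<Lambda>" by (simp add: coset_of_def)
next
  assume "x - y \<in> \<Lambda>"
  thus "coset_of A \<Lambda> x = coset_of A \<Lambda> y"
    unfolding coset_of_def using diff_mem_trans diff_mem_commute by blast
qed

lemma coset_eq_coset_of: "h \<in> cosets A \<Lambda> \<Longrightarrow> x \<in> h \<Longrightarrow> x \<in> A \<and> h = coset_of A \<Lambda> x"
proof -
  assume h: "h \<in> cosets A \<Lambda>" "x \<in> h"
  then obtain y where y: "y \<in> A" "h = coset_of A \<Lambda> y" by (auto simp: cosets_eq)
  with h have "x \<in> A" "y - x \<in> \<Lambda>" by (auto simp: coset_of_def)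
  thus ?thesis using y coset_of_eq_iff by blast
qed

lemma coset_diff: "h \<in> cosets A \<Lambda> \<Longrightarrow> x \<in> h \<Longrightarrow> y \<in> h \<Longrightarrow> x - y \<in> \<Lambda>"
  using coset_eq_coset_of[of h A x] by (simp add: coset_of_def)

lemma coset_rep_in: "h \<in> cosets A \<Lambda> \<Longrightarrow> coset_rep h \<in> h"
  unfolding coset_rep_def cosets_eq using coset_of_self by (metis imageE someI)

lemma coset_rep_in_carrier: "h \<in> cosets A \<Lambda> \<Longrightarrow> coset_rep h \<in> A"
  using coset_rep_in coset_eq_coset_of by blast

lemma coset_rep_diff: "h \<in> cosets A \<Lambda> \<Longrightarrow> x \<in> h \<Longrightarrow> x - coset_rep h \<in> \<Lambda>"
  using coset_rep_in[of h A] coset_diff by blast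

text \<open>Lagrange's theorem by the abelian argument: translation by x permutes the cosets, so the
  representatives have the same sum before and after it, and the discrepancies coset by coset lie in
  \<Lambda>.\<close>

lemma card_cosets_scale_mem:
  assumes A: "add_subgroup A" and fin: "finite (cosets A \<Lambda>)" and x: "x \<in> A"
  shows "of_nat (card (cosets A \<Lambda>)) *\<^sub>R x \<in> \<Lambda>"
proof -
  define H where "H = cosets A \<Lambda>"
  define T where "T = (\<lambda>h. coset_of A \<Lambda> (coset_rep h + x))"
  have repA: "coset_rep h + x \<in> A" if "h \<in> H" for h
    using that add_subgroup_add[OF A _ x] coset_rep_in_carrier by (auto simp: H_def)
  have TH: "T ` H \<subseteq> H"
    using repA by (auto simp: T_def H_def cosets_eq)
  moreover have "inj_on T H"
  proof
    fix h h' assume h: "h \<in> H" "h' \<in> H" "T h = T h'"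
    hence "(coset_rep h + x) - (coset_rep h' + x) \<in> \<Lambda>"
      using coset_of_eq_iff repA unfolding T_def by blast
    hence "coset_rep h - coset_rep h' \<in> \<Lambda>" by simp
    thus "h = h'"
      using h coset_of_eq_iff coset_eq_coset_of coset_rep_in unfolding H_def by metis
  qed
  ultimately have "bij_betw T H H"
    using fin unfolding H_def bij_betw_def by (simp add: endo_inj_surj)
  hence "(\<Sum>h\<in>H. coset_rep h) = (\<Sum>h\<in>H. coset_rep (T h))"
    by (simp add: sum.reindex_bij_betw)
  hence "of_nat (card H) *\<^sub>R x = (\<Sum>h\<in>H. coset_rep h + x - coset_rep (T h))"
    by (simp add: sum.distrib sum_subtractf scaleR_conv_of_real)
       (simp add: sum_constant_scaleR)
  also have "\<dots> \<in> \<Lambda>"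
  proof -
    have "coset_rep h + x - coset_rep (T h) \<in> \<Lambda>" if "h \<in> H" for h
      using coset_rep_diff[of "T h" A "coset_rep h + x"] TH that coset_of_self[OF repA[OF that]]
      by (auto simp: H_def T_def)
    thus ?thesis
      by (induction H rule: infinite_finite_induct)
        (auto intro: add_subgroup_add[OF \<Lambda>] add_subgroup_zero[OF \<Lambda>])
  qed
  finally show ?thesis by (simp add: H_def)
qed

end

section \<open>Counting cosets along the level sets of an integral functional\<close>

locale lattice_slices =
  fixes L \<Lambda> :: "'a::real_vector set" and e :: "'a \<Rightarrow> real" and a :: int
  assumes L: "add_subgroup L" and \<Lambda>: "add_subgroup \<Lambda>" and sub: "\<Lambda> \<subseteq> L" and lin: "linear e"
    and eL: "e ` L = \<int>" and e\<Lambda>: "e ` \<Lambda> = {of_int (a * k) | k. True}" and a: "a \<noteq> 0"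
    and fin: "finite (cosets L \<Lambda>)"
begin

definition slice :: "int \<Rightarrow> 'a set" where
  "slice p = {x \<in> L. e x = of_int p}"

lemma slice_sub: "slice p \<subseteq> L"
  by (auto simp: slice_def)

text \<open>On a coset e takes exactly the values of one residue class modulo a, because
  e(\<Lambda>) is the whole of a Z.\<close>

lemma meets_slice_iff:
  assumes "h \<in> cosets L \<Lambda>" "x \<in> h"
  shows "h \<inter> slice p \<noteq> {} \<longleftrightarrow> (\<exists>k. e x = of_int (p + a * k))"
proof
  assume "h \<inter> slice p \<noteq> {}"
  then obtain y where y: "y \<in> h" "e y = of_int p" by (auto simp: slice_def)
  have "x - y \<in> \<Lambda>"
    by (rule coset_diff[OF \<Lambda> assms y(1)])
  then obtain k where "e (x - y) = of_int (a * k)" using e\<Lambda> by blast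
  thus "\<exists>k. e x = of_int (p + a * k)"
    using y(2) lin by (intro exI[of _ k]) (simp add: linear_diff)
next
  assume "\<exists>k. e x = of_int (p + a * k)"
  then obtain k where k: "e x = of_int (p + a * k)" by blast
  have "of_int (a * k) \<in> e ` \<Lambda>" unfolding e\<Lambda> by blast
  then obtain y where y: "y \<in> \<Lambda>" "e y = of_int (a * k)" by force
  have "x \<in> L" and h: "h = coset_of L \<Lambda> x"
    using coset_eq_coset_of[OF \<Lambda> assms] by auto
  hence "x - y \<in> L" using y sub add_subgroup_diff[OF L] by blast
  moreover have "e (x - y) = of_int p" using k y lin by (simp add: linear_diff)
  ultimately have "x - y \<in> h \<inter> slice p" using y by (simp add: h coset_of_def slice_def)
  thus "h \<inter> slice p \<noteq> {}" by blast
qed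

lemma slice_inter_bij:
  "bij_betw (\<lambda>h. h \<inter> slice p) {h \<in> cosets L \<Lambda>. h \<inter> slice p \<noteq> {}} (cosets (slice p) \<Lambda>)"
proof -
  have eq: "h \<inter> slice p = coset_of (slice p) \<Lambda> x" if "h \<in> cosets L \<Lambda>" "x \<in> h" for h x
    using coset_eq_coset_of[OF \<Lambda> that] slice_sub by (auto simp: coset_of_def)
  show ?thesis
    unfolding bij_betw_def
  proof
    show "inj_on (\<lambda>h. h \<inter> slice p) {h \<in> cosets L \<Lambda>. h \<inter> slice p \<noteq> {}}"
    proof
      fix h h' assume h: "h \<in> {h \<in> cosets L \<Lambda>. h \<inter> slice p \<noteq> {}}" "h' \<in> {h \<in> cosets L \<Lambda>. h \<inter> slice p \<noteq> {}}"
        "h \<inter> slice p = h' \<inter> slice p"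
      then obtain x where "x \<in> h" "x \<in> h'" by blast
      thus "h = h'" using h coset_eq_coset_of[OF \<Lambda>] by blast
    qed
    show "(\<lambda>h. h \<inter> slice p) ` {h \<in> cosets L \<Lambda>. h \<inter> slice p \<noteq> {}} = cosets (slice p) \<Lambda>"
    proof (intro equalityI subsetI)
      fix c assume "c \<in> (\<lambda>h. h \<inter> slice p) ` {h \<in> cosets L \<Lambda>. h \<inter> slice p \<noteq> {}}"
      then obtain h x where "h \<in> cosets L \<Lambda>" "x \<in> h" "x \<in> slice p" "c = h \<inter> slice p" by blast
      thus "c \<in> cosets (slice p) \<Lambda>" using eq by (auto simp: cosets_eq)
    next
      fix c assume "c \<in> cosets (slice p) \<Lambda>"
      then obtain x where x: "x \<in> slice p" "c = coset_of (slice p) \<Lambda> x" by (auto simp: cosets_eq)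
      hence xL: "x \<in> L" using slice_sub by blast
      define h where "h = coset_of L \<Lambda> x"
      have "h \<in> cosets L \<Lambda>" "x \<in> h"
        using xL coset_of_self[OF \<Lambda> xL] by (auto simp: h_def cosets_eq)
      thus "c \<in> (\<lambda>h. h \<inter> slice p) ` {h \<in> cosets L \<Lambda>. h \<inter> slice p \<noteq> {}}"
        using eq x by blast
    qed
  qed
qed

text \<open>As e maps L onto Z, some l in L has e(l) = p, and translation by l carries the zero
  slice to the slice at p.\<close>

lemma card_cosets_slice: "card (cosets (slice p) \<Lambda>) = card (cosets (slice 0) \<Lambda>)"
proof -
  obtain l where l: "l \<in> L" "e l = of_int p" using eL by (metis Ints_of_int imageE)
  have "slice p = (+) l ` slice 0"
  proof (intro equalityI subsetI)
    fix x assume "x \<in> slice p"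
    hence "x - l \<in> slice 0"
      using l lin add_subgroup_diff[OF L] by (auto simp: slice_def linear_diff)
    thus "x \<in> (+) l ` slice 0" by force
  qed (use l lin add_subgroup_add[OF L] in \<open>auto simp: slice_def linear_add\<close>)
  moreover have "coset_of ((+) l ` slice 0) \<Lambda> (l + x) = (+) l ` coset_of (slice 0) \<Lambda> x" for x
    by (auto simp: coset_of_def)
  ultimately have "cosets (slice p) \<Lambda> = image ((+) l) ` cosets (slice 0) \<Lambda>"
    by (simp add: cosets_eq image_image)
  moreover have "inj_on (image ((+) l)) (cosets (slice 0) \<Lambda>)"
    by (simp add: inj_on_def inj_image_eq_iff)
  ultimately show ?thesis by (simp add: card_image)
qed

text \<open>The functional induces a surjection from L/\<Lambda> to Z/aZ. Its fibres consist of the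
  cosets meeting a given slice and all have the same size.\<close>

lemma card_cosets: "card (cosets L \<Lambda>) = nat \<bar>a\<bar> * card (cosets (slice 0) \<Lambda>)"
proof -
  define S where "S = (\<lambda>p. {h \<in> cosets L \<Lambda>. h \<inter> slice p \<noteq> {}})"
  have "cosets L \<Lambda> = (\<Union>p\<in>{0..<\<bar>a\<bar>}. S p)"
  proof (intro equalityI subsetI)
    fix h assume h: "h \<in> cosets L \<Lambda>"
    define x where "x = coset_rep h"
    have x: "x \<in> h" "x \<in> L" 
      using coset_rep_in[OF \<Lambda> h] coset_rep_in_carrier[OF \<Lambda> h] by (auto simp: x_def)
    then obtain m where m: "e x = of_int m" using eL by (metis Ints_cases imageI)
    \<comment> \<open>The sign of a is arbitrary, so the quotient by the absolute value is corrected
      by \<open>sgn a\<close> to give a multiple of a itself.\<close>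
    have "m = m mod \<bar>a\<bar> + a * (sgn a * (m div \<bar>a\<bar>))"
    proof -
      have "a * sgn a = \<bar>a\<bar>" by (simp add: abs_sgn)
      thus ?thesis using mod_mult_div_eq[of m "\<bar>a\<bar>"] by (simp add: mult.assoc[symmetric])
    qed
    hence "\<exists>k. e x = of_int (m mod \<bar>a\<bar> + a * k)"
      unfolding m by metis
    hence "h \<in> S (m mod \<bar>a\<bar>)"
      using h meets_slice_iff[OF h x(1)] by (auto simp: S_def)
    moreover have "m mod \<bar>a\<bar> \<in> {0..<\<bar>a\<bar>}" using a by simp
    ultimately show "h \<in> (\<Union>p\<in>{0..<\<bar>a\<bar>}. S p)" by blast
  qed (auto simp: S_def)
  hence "card (cosets L \<Lambda>) = card (\<Union>p\<in>{0..<\<bar>a\<bar>}. S p)" by simp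
  also have "\<dots> = (\<Sum>p\<in>{0..<\<bar>a\<bar>}. card (S p))"
  proof (rule card_UN_disjoint)
    show "\<forall>i\<in>{0..<\<bar>a\<bar>}. finite (S i)" using fin by (simp add: S_def)
    show "\<forall>i\<in>{0..<\<bar>a\<bar>}. \<forall>j\<in>{0..<\<bar>a\<bar>}. i \<noteq> j \<longrightarrow> S i \<inter> S j = {}"
    proof (intro ballI impI)
      fix i j assume ij: "i \<in> {0..<\<bar>a\<bar>}" "j \<in> {0..<\<bar>a\<bar>}" "i \<noteq> j"
      show "S i \<inter> S j = {}"
      proof (rule ccontr)
        assume "S i \<inter> S j \<noteq> {}"
        then obtain h where h: "h \<in> cosets L \<Lambda>" "h \<inter> slice i \<noteq> {}" "h \<inter> slice j \<noteq> {}"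
          by (auto simp: S_def)
        obtain k k' where "e (coset_rep h) = of_int (i + a * k)" "e (coset_rep h) = of_int (j + a * k')"
          using h meets_slice_iff[OF h(1) coset_rep_in[OF \<Lambda> h(1)]] by blast
        hence "i + a * k = j + a * k'" by (metis of_int_eq_iff)
        hence "a dvd i - j" by (intro dvdI[of _ _ "k' - k"]) (simp add: algebra_simps)
        hence "\<bar>a\<bar> dvd \<bar>i - j\<bar>" by simp
        moreover have "0 < \<bar>i - j\<bar>" "\<bar>i - j\<bar> < \<bar>a\<bar>" using ij by auto
        ultimately show False using zdvd_not_zless by blast
      qed
    qed
  qed simp
  also have "\<dots> = (\<Sum>p\<in>{0..<\<bar>a\<bar>}. card (cosets (slice 0) \<Lambda>))"
    using bij_betw_same_card[OF slice_inter_bij] card_cosets_slice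
    by (intro sum.cong refl) (simp only: S_def)
  finally show ?thesis by simp
qed

text \<open>This permits representatives inside the slice, where e has an exact value and not only
  one modulo a.\<close>

lemma sum_meets_slice:
  fixes f :: "'a \<Rightarrow> 'b::comm_monoid_add"
  assumes per: "\<And>x y. x \<in> L \<Longrightarrow> y \<in> L \<Longrightarrow> x - y \<in> \<Lambda> \<Longrightarrow> f x = f y"
  shows "(\<Sum>h | h \<in> cosets L \<Lambda> \<and> h \<inter> slice p \<noteq> {}. f (coset_rep h)) = 
         (\<Sum>c\<in>cosets (slice p) \<Lambda>. f (coset_rep c))"
proof -
  have "f (coset_rep (h \<inter> slice p)) = f (coset_rep h)" 
    if "h \<in> {h \<in> cosets L \<Lambda>. h \<inter> slice p \<noteq> {}}" for h
  proof -
    have h: "h \<in> cosets L \<Lambda>" "h \<inter> slice p \<in> cosets (slice p) \<Lambda>"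
      using that bij_betwE[OF slice_inter_bij] by auto
    have "coset_rep (h \<inter> slice p) \<in> h"
      using coset_rep_in[OF \<Lambda> h(2)] by blast
    thus ?thesis
      using coset_rep_diff[OF \<Lambda> h(1)] coset_rep_in_carrier[OF \<Lambda> h(1)] coset_eq_coset_of[OF \<Lambda> h(1)]
      by (intro per) auto
  qed
  thus ?thesis
    using sum.reindex_bij_betw[OF slice_inter_bij[of p], of "\<lambda>c. f (coset_rep c)"]
    by simp
qed

end

section \<open>Vanishing of the weighted sum\<close>

text \<open>If f(a) were nonzero, f would be nonzero on a ball, and a ball is uncountable.\<close>

lemma countable_uncovered_zero:
  fixes f :: "complex \<Rightarrow> complex"
  assumes "isCont f a" "countable C" "\<And>z. z \<notin> C \<Longrightarrow> f z = 0"
  shows "f a = 0"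
proof (rule ccontr)
  assume "f a \<noteq> 0"
  then obtain r where r: "r > 0" "\<And>z. dist a z < r \<Longrightarrow> f z \<noteq> 0"
    using continuous_at_avoid[of a f 0] assms(1) by blast
  hence "ball a r \<subseteq> C" using assms(3) by force
  thus False using assms(2) uncountable_ball[OF r(1)] countable_subset by blast
qed

text \<open>Dual vectors take rational values on L, so the singular values of a factor are period
  lattice points shifted by rational multiples of 1 and \<tau>. This set absorbs all the shifts at
  once and is still countable.\<close>

definition rational_periods :: "complex \<Rightarrow> complex set" where
  "rational_periods \<tau> = {of_real a + of_real b * \<tau> | a b. a \<in> \<rat> \<and> b \<in> \<rat>}"

lemma countable_rational_periods: "countable (rational_periods \<tau>)"
proof -
  have "rational_periods \<tau> = (\<lambda>(a, b). complex_of_real a + of_real b * \<tau>) ` (\<rat> \<times> \<rat>)"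
    by (auto simp: rational_periods_def)
  thus ?thesis using countable_rat by auto
qed

lemma period_lattice_rational: "x \<in> period_lattice \<tau> \<Longrightarrow> x \<in> rational_periods \<tau>"
proof -
  assume "x \<in> period_lattice \<tau>"
  then obtain a b :: int where "x = of_real (of_int a) + of_real (of_int b) * \<tau>"
    by (auto simp: period_lattice_def)
  thus ?thesis unfolding rational_periods_def using Rats_of_int by blast
qed

lemma rational_periods_combination:
  assumes "x \<in> rational_periods \<tau>" "a \<in> \<rat>" "b \<in> \<rat>"
  shows "x + of_real a + of_real b * \<tau> \<in> rational_periods \<tau>"
proof -
  obtain a' b' where "x = of_real a' + of_real b' * \<tau>" "a' \<in> \<rat>" "b' \<in> \<rat>"
    using assms(1) by (auto simp: rational_periods_def)
  hence "x + of_real a + of_real b * \<tau> = of_real (a' + a) + of_real (b' + b) * \<tau>" 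
    by (simp add: algebra_simps)
  thus ?thesis unfolding rational_periods_def using assms \<open>a' \<in> \<rat>\<close> \<open>b' \<in> \<rat>\<close> Rats_add by blast
qed

lemma rational_periods_scale:
  assumes "x \<in> rational_periods \<tau>" "y \<in> rational_periods \<tau>" "r \<in> \<rat>" "s \<in> \<rat>"
  shows "of_real r * x - of_real s * y \<in> rational_periods \<tau>"
proof -
  obtain a b a' b' where *: "x = of_real a + of_real b * \<tau>" "a \<in> \<rat>" "b \<in> \<rat>"
      "y = of_real a' + of_real b' * \<tau>" "a' \<in> \<rat>" "b' \<in> \<rat>"
    using assms(1,2) by (auto simp: rational_periods_def)
  have "of_real r * x - of_real s * y = of_real (r * a - s * a') + of_real (r * b - s * b') * \<tau>"
    using * by (simp add: algebra_simps)
  moreover have "r * a - s * a' \<in> \<rat>" "r * b - s * b' \<in> \<rat>"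
    using * assms by (auto intro!: Rats_diff Rats_mult)
  ultimately show ?thesis unfolding rational_periods_def by blast
qed

text \<open>A pair \<open>(x, y)\<close> stands for the vector \<open>x + \<i> y\<close> of the complexification.\<close>

definition cev :: "('a::real_vector \<Rightarrow> real) \<Rightarrow> 'a \<times> 'a \<Rightarrow> complex" where
  "cev u w = of_real (u (fst w)) + \<i> * of_real (u (snd w))"

definition cscale :: "complex \<Rightarrow> 'a::real_vector \<Rightarrow> 'a \<times> 'a" where
  "cscale z x = (Re z *\<^sub>R x, Im z *\<^sub>R x)"

lemma cev_add: "linear u \<Longrightarrow> cev u (w + w') = cev u w + cev u w'"
  by (simp add: cev_def linear_add algebra_simps)

lemma cev_diff: "linear u \<Longrightarrow> cev u (w - w') = cev u w - cev u w'"
  by (simp add: cev_def linear_diff algebra_simps)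

lemma cev_cscale: "linear u \<Longrightarrow> cev u (cscale z x) = z * of_real (u x)"
  by (simp add: cev_def cscale_def linear_scale complex_eq_iff)

lemma cscale_add: "cscale z (x + y) = cscale z x + cscale z y"
  by (simp add: cscale_def algebra_simps)

lemma cscale_diff: "cscale z (x - y) = cscale z x - cscale z y"
  by (simp add: cscale_def algebra_simps)

lemma cscale_add_left: "cscale (z + z') x = cscale z x + cscale z' x"
  by (simp add: cscale_def algebra_simps)

lemma cscale_0 [simp]: "cscale 0 x = 0"
  by (simp add: cscale_def zero_prod_def)

text \<open>If the y found for F is annihilated by the new form g, it is replaced by m y + b with
  g(b) nonzero. Each form in F excludes at most one m. The lemma serves both to move base points
  into general position and to separate characters.\<close>

lemma linear_avoid:
  fixes F :: "('a::real_vector \<Rightarrow> real) set" and L :: "'a set"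
  assumes "finite F" "\<And>f. f \<in> F \<Longrightarrow> linear f" "\<And>f. f \<in> F \<Longrightarrow> \<exists>x\<in>L. f x \<noteq> 0" "add_subgroup L"
  shows "\<exists>y\<in>L. \<forall>f\<in>F. f y \<noteq> 0"
  using assms(1-3)
proof (induction F rule: finite_induct)
  case empty
  then show ?case using add_subgroup_zero[OF assms(4)] by blast
next
  case (insert g F)
  then obtain y where y: "y \<in> L" "\<forall>f\<in>F. f y \<noteq> 0" by auto
  obtain b where b: "b \<in> L" "g b \<noteq> 0" using insert.prems by blast
  show ?case
  proof (cases "g y = 0")
    case False
    thus ?thesis using y by blast
  next
    case True
    define bad where "bad = (\<lambda>f :: 'a \<Rightarrow> real. {m::nat. f (of_nat m *\<^sub>R y + b) = 0})"
    have "finite (bad f)" if f: "f \<in> F" for f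
    proof -
      have lf: "linear f" and fy: "f y \<noteq> 0" using f insert.prems y by auto
      have "inj_on (\<lambda>m::nat. of_nat m :: real) (bad f)" by (simp add: inj_on_def)
      moreover have "(\<lambda>m::nat. of_nat m :: real) ` bad f \<subseteq> {- f b / f y}"
        using fy by (auto simp: bad_def linear_add[OF lf] linear_scale[OF lf] field_simps eq_neg_iff_add_eq_0)
      ultimately show ?thesis
        by (meson finite.emptyI finite.insertI finite_imageD finite_subset)
    qed
    hence "finite (\<Union>f\<in>F. bad f)" using insert.hyps by blast
    then obtain m where m: "m \<notin> (\<Union>f\<in>F. bad f)"
      using ex_new_if_finite[OF infinite_UNIV_nat] by blast
    have "of_nat m *\<^sub>R y + b \<in> L"
      using y b assms(4) by (intro add_subgroup_add add_subgroup_nat_scale)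
    moreover have "g (of_nat m *\<^sub>R y + b) \<noteq> 0"
      using True b(2) insert.prems(1)[of g] by (simp add: linear_add linear_scale)
    ultimately show ?thesis using m by (auto simp: bad_def)
  qed
qed

text \<open>Division with remainder shows that the least positive value m generates the image; the
  factor is 1/m.\<close>

lemma int_image_cyclic:
  assumes L: "add_subgroup L" and u: "linear (u :: 'a::real_vector \<Rightarrow> real)"
    and int: "u ` L \<subseteq> \<int>" and nz: "\<exists>x\<in>L. u x \<noteq> 0"
  shows "\<exists>d\<noteq>0. (\<lambda>x. d * u x) ` L = \<int>"
proof -
  define A where "A = {m::nat. m > 0 \<and> real m \<in> u ` L}"
  obtain x where x: "x \<in> L" "u x \<noteq> 0" using nz by blast
  obtain k where k: "u x = of_int k" using x int by (meson Ints_cases image_subset_iff)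
  have "A \<noteq> {}"
  proof (cases "k > 0")
    case True
    hence "nat k \<in> A" using x k by (auto simp: A_def image_iff intro!: bexI[of _ x])
    thus ?thesis by blast
  next
    case False
    hence "k < 0" using x k by auto
    hence "nat (- k) \<in> A" using x k add_subgroup_uminus[OF L x(1)] 
      by (auto simp: A_def image_iff linear_neg[OF u] intro!: bexI[of _ "- x"])
    thus ?thesis by blast
  qed
  define m where "m = (LEAST m. m \<in> A)"
  have m: "m \<in> A" and least: "\<And>n. n \<in> A \<Longrightarrow> m \<le> n"
    using \<open>A \<noteq> {}\<close> LeastI_ex[of "\<lambda>m. m \<in> A"] Least_le[of "\<lambda>m. m \<in> A"] by (auto simp: m_def)
  then obtain y where y: "y \<in> L" "u y = real m" and m0: "m > 0" by (auto simp: A_def)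
  have div: "\<exists>j::int. u z = real m * of_int j" if z: "z \<in> L" for z
  proof -
    obtain n where n: "u z = of_int n" using z int by (meson Ints_cases image_subset_iff)
    define z' where "z' = z - of_int (n div int m) *\<^sub>R y"
    have "z' \<in> L" using z y L by (auto simp: z'_def intro!: add_subgroup_diff add_subgroup_int_scale)
    have "u z' = of_int (n - (n div int m) * int m)"
      using n y by (simp add: z'_def linear_diff[OF u] linear_scale[OF u])
    hence "u z' = of_int (n mod int m)" by (simp add: minus_div_mult_eq_mod)
    hence "u z' = real (nat (n mod int m))" using m0 by simp
    hence im: "real (nat (n mod int m)) \<in> u ` L" using \<open>z' \<in> L\<close> by (metis imageI)
    have ge: "n mod int m \<ge> 0" using m0 by simp
    have "nat (n mod int m) \<in> A \<or> n mod int m = 0"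
      using im ge unfolding A_def by auto
    moreover have "nat (n mod int m) < m"
      using ge m0 by (simp add: nat_less_iff)
    ultimately have "n mod int m = 0" using least by (meson leD)
    then obtain j where "n = int m * j" by (auto simp: mod_eq_0_iff_dvd)
    thus ?thesis using n by auto
  qed
  have "(\<lambda>x. (1 / real m) * u x) ` L = \<int>"
  proof (intro equalityI subsetI)
    fix t assume "t \<in> (\<lambda>x. (1 / real m) * u x) ` L"
    then obtain z where "z \<in> L" "t = (1 / real m) * u z" by blast
    thus "t \<in> \<int>" using div[of z] m0 by auto
  next
    fix t :: real assume "t \<in> \<int>"
    then obtain j where "t = of_int j" by (auto elim: Ints_cases)
    hence "t = (1 / real m) * u (of_int j *\<^sub>R y)" using y m0 by (simp add: linear_scale[OF u])
    thus "t \<in> (\<lambda>x. (1 / real m) * u x) ` L"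
      using add_subgroup_int_scale[OF L y(1)] by blast
  qed
  thus ?thesis using m0 by (intro exI[of _ "1 / real m"]) auto
qed

lemma period_basis_unique:
  assumes "Im \<tau> > 0" "of_real x + of_real y * \<tau> = of_real x' + of_real y' * \<tau>"
  shows "x = x'" "y = y'"
  using assms by (auto simp: complex_eq_iff)

text \<open>The linear form \<open>c\<close> encodes the twist: \<open>e\<^bsup>2\<pi>i c(l)\<^esup>\<close> is the product over \<open>i \<in> I\<close> of the
  powers of \<open>\<zeta>\<close> with exponents attached to \<open>\<langle>u\<^sub>i\<^sup>I, l\<rangle>\<close>. It does not depend on \<open>I\<close> because \<open>c\<^sub>1\<close> is
  divisible by \<open>N\<close>. The balancing condition is pre-completeness of the projected multi-fans of rank one.\<close>

locale balanced_fan =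
  fixes L :: "'a::euclidean_space set" and T :: "'i set set" and V :: "'i \<Rightarrow> 'a"
    and wt :: "'i set \<Rightarrow> int" and \<tau> \<sigma> :: complex and c :: "'a \<Rightarrow> real" and v :: 'a
  assumes L: "add_subgroup L" and T: "finite T"
    and basis: "I \<in> T \<Longrightarrow> basis_family V I"
    and edge: "I \<in> T \<Longrightarrow> i \<in> I \<Longrightarrow> V i \<in> L"
    and fin: "I \<in> T \<Longrightarrow> finite (cosets L (edge_lattice V I))"
    and balanced: "linear e \<Longrightarrow> (\<And>j. j \<in> K \<Longrightarrow> e (V j) = 0) \<Longrightarrow>
      (\<Sum>i | i \<notin> K \<and> insert i K \<in> T. sgn (e (V i)) * of_int (wt (insert i K))) = (0::real)"
    and \<tau>: "Im \<tau> > 0" and c: "linear c"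
    and cV: "I \<in> T \<Longrightarrow> i \<in> I \<Longrightarrow> e2pi (of_real (c (V i))) = e2pi \<sigma>"
    and v: "I \<in> T \<Longrightarrow> v \<in> edge_lattice V I"
    and v1: "e2pi (of_real (c v)) \<noteq> 1"
begin

abbreviation U :: "'i set \<Rightarrow> 'i \<Rightarrow> 'a \<Rightarrow> real" where "U \<equiv> dual_vector V"
abbreviation \<theta> :: "complex \<Rightarrow> complex" where "\<theta> \<equiv> theta_quot \<tau> \<sigma>"
abbreviation H :: "'i set \<Rightarrow> 'a set set" where "H I \<equiv> cosets L (edge_lattice V I)"

section \<open>The extended genus and its quasi-periods\<close>

definition shifted :: "'a \<times> 'a \<Rightarrow> 'a \<Rightarrow> 'a \<Rightarrow> 'a \<times> 'a" where
  "shifted w l1 l2 = w - cscale \<tau> l1 + cscale 1 l2"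

definition summand :: "'i set \<Rightarrow> 'a \<Rightarrow> 'a \<Rightarrow> 'a \<times> 'a \<Rightarrow> complex" where
  "summand I l1 l2 w = e2pi (of_real (c l1)) * (\<Prod>i\<in>I. \<theta> (- cev (U I i) (shifted w l1 l2)))"

definition total :: "'a \<times> 'a \<Rightarrow> complex" where
  "total w = (\<Sum>I\<in>T. of_int (wt I) / of_nat (card (H I)) *
     (\<Sum>(h1, h2)\<in>H I \<times> H I. summand I (coset_rep h1) (coset_rep h2) w))"

lemma finI: "I \<in> T \<Longrightarrow> finite I"
  using basis basis_family.fin by blast

lemma linU: "I \<in> T \<Longrightarrow> linear (U I i)"
  by (rule basis_family.linear_dual[OF basis])

lemma edge_subgroup: "I \<in> T \<Longrightarrow> add_subgroup (edge_lattice V I)"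
  by (rule basis_family.edge_lattice_subgroup[OF basis])

lemma edge_sub: "I \<in> T \<Longrightarrow> edge_lattice V I \<subseteq> L"
  unfolding edge_lattice_def using edge by (intro int_span_subset L) auto

lemma rep_in: "I \<in> T \<Longrightarrow> h \<in> H I \<Longrightarrow> coset_rep h \<in> L"
  by (rule coset_rep_in_carrier[OF edge_subgroup])

lemma cev_shifted:
  "I \<in> T \<Longrightarrow> cev (U I i) (shifted w l1 l2) = cev (U I i) w - \<tau> * of_real (U I i l1) + of_real (U I i l2)"
  by (simp add: shifted_def cev_add cev_diff cev_cscale linU)

lemma cev_line:
  "I \<in> T \<Longrightarrow> cev (U I i) (shifted (w + cscale z y) l1 l2) = cev (U I i) (shifted w l1 l2) + z * of_real (U I i y)"
  by (simp add: cev_shifted cev_add cev_cscale linU)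

text \<open>The order of H_I is a common denominator, since it multiplies L into the edge
  lattice.\<close>

lemma U_rational: "I \<in> T \<Longrightarrow> i \<in> I \<Longrightarrow> l \<in> L \<Longrightarrow> U I i l \<in> \<rat>"
proof -
  assume I: "I \<in> T" "i \<in> I" "l \<in> L"
  have "of_nat (card (H I)) *\<^sub>R l \<in> edge_lattice V I"
    by (rule card_cosets_scale_mem[OF edge_subgroup[OF I(1)] L fin[OF I(1)] I(3)])
  hence "of_nat (card (H I)) * U I i l \<in> \<int>"
    using basis_family.edge_lattice_iff[OF basis[OF I(1)]] I by (simp add: linear_scale[OF linU])
  then obtain m where m: "of_nat (card (H I)) * U I i l = of_int m" by (auto elim: Ints_cases)
  have "H I \<noteq> {}" using add_subgroup_zero[OF L] by (auto simp: cosets_eq)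
  hence "card (H I) \<noteq> 0" using fin[OF I(1)] by simp
  hence "U I i l = of_int m / of_nat (card (H I))" using m by (simp add: field_simps)
  thus ?thesis by simp
qed

lemma U_v_int: "I \<in> T \<Longrightarrow> i \<in> I \<Longrightarrow> U I i v \<in> \<int>"
  using basis_family.edge_lattice_iff[OF basis] v by blast

lemma U_v_rational: "I \<in> T \<Longrightarrow> i \<in> I \<Longrightarrow> U I i v \<in> \<rat>"
  using U_v_int Ints_subset_Rats by blast

text \<open>Adding m_i v_i to l1 multiplies the i-th theta factor by \<zeta>^(-m_i) and the twist by
  \<zeta>^(m_i), by \<open>cV\<close>; this compensation is the purpose of the twist. A change of l2
  only involves the period 1.\<close>

lemma summand_periodic:
  assumes I: "I \<in> T" and l: "l1 - l1' \<in> edge_lattice V I" "l2 - l2' \<in> edge_lattice V I"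
  shows "summand I l1 l2 w = summand I l1' l2' w"
proof -
  interpret B: basis_family V I by (rule basis[OF I])
  define m where "m i = \<lfloor>U I i (l1 - l1')\<rfloor>" for i
  define n where "n i = \<lfloor>U I i (l2 - l2')\<rfloor>" for i
  have m: "U I i (l1 - l1') = of_int (m i)" and n: "U I i (l2 - l2') = of_int (n i)" if "i \<in> I" for i
    using l that by (auto simp: B.edge_lattice_iff m_def n_def)
  have "\<theta> (- cev (U I i) (shifted w l1 l2)) = e2pi \<sigma> powi (- m i) * \<theta> (- cev (U I i) (shifted w l1' l2'))"
    if i: "i \<in> I" for i
  proof -
    have "U I i l1 = U I i l1' + of_int (m i)" "U I i l2 = U I i l2' + of_int (n i)"
      using m[OF i] n[OF i] by (auto simp: linear_diff[OF B.linear_dual] algebra_simps)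
    hence "- cev (U I i) (shifted w l1 l2) = - cev (U I i) (shifted w l1' l2') + of_int (- n i) + of_int (m i) * \<tau>"
      by (simp add: cev_shifted[OF I] algebra_simps)
    thus ?thesis by (simp only: theta_quot_shift[OF \<tau>])
  qed
  hence "(\<Prod>i\<in>I. \<theta> (- cev (U I i) (shifted w l1 l2))) =
      (\<Prod>i\<in>I. e2pi \<sigma> powi (- m i)) * (\<Prod>i\<in>I. \<theta> (- cev (U I i) (shifted w l1' l2')))"
    by (simp add: prod.distrib)
  moreover have "e2pi (of_real (c l1)) = e2pi (of_real (c l1')) * (\<Prod>i\<in>I. e2pi \<sigma> powi m i)"
  proof -
    have "c (l1 - l1') = (\<Sum>i\<in>I. of_int (m i) * c (V i))"
      using m by (simp add: B.linear_dual_expansion[OF c, of "l1 - l1'"])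
    hence "e2pi (of_real (c (l1 - l1'))) = (\<Prod>i\<in>I. e2pi (of_int (m i) * of_real (c (V i))))"
      by (simp add: e2pi_sum)
    also have "\<dots> = (\<Prod>i\<in>I. e2pi \<sigma> powi m i)"
      using cV[OF I] by (intro prod.cong) (simp_all flip: e2pi_powi)
    finally show ?thesis
      using e2pi_add[of "of_real (c l1')" "of_real (c (l1 - l1'))"] by (simp add: linear_diff[OF c])
  qed
  moreover have "(\<Prod>i\<in>I. e2pi \<sigma> powi m i) * (\<Prod>i\<in>I. e2pi \<sigma> powi (- m i)) = 1"
    by (simp add: prod.distrib[symmetric] power_int_minus)
  ultimately show ?thesis
    unfolding summand_def by (simp add: mult.assoc)
qed

lemma summand_add_v: "I \<in> T \<Longrightarrow> summand I l1 l2 (w + cscale 1 v) = summand I l1 l2 w"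
proof -
  assume I: "I \<in> T"
  have "summand I l1 l2 (w + cscale 1 v) = summand I l1 (l2 + v) w"
    by (simp add: summand_def shifted_def cscale_add algebra_simps)
  also have "\<dots> = summand I l1 l2 w"
    using v[OF I] add_subgroup_zero[OF edge_subgroup[OF I]] by (intro summand_periodic[OF I]) auto
  finally show ?thesis .
qed

text \<open>Translation by \<tau> v replaces l1 by l1 - v in the theta factors but not in the twist.
  Periodicity undoes the replacement, and the twist leaves a multiplier that is the same for all
  I.\<close>

lemma summand_add_period:
  "I \<in> T \<Longrightarrow> summand I l1 l2 (w + cscale \<tau> v) = e2pi (of_real (c v)) * summand I l1 l2 w"
proof -
  assume I: "I \<in> T"
  have "shifted (w + cscale \<tau> v) l1 l2 = shifted w (l1 - v) l2"
    by (simp add: shifted_def cscale_diff algebra_simps)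
  moreover have "e2pi (of_real (c l1)) = e2pi (of_real (c v)) * e2pi (of_real (c (l1 - v)))"
    by (simp add: linear_diff[OF c] flip: e2pi_add)
  ultimately have "summand I l1 l2 (w + cscale \<tau> v) = e2pi (of_real (c v)) * summand I (l1 - v) l2 w"
    by (simp add: summand_def)
  also have "summand I (l1 - v) l2 w = summand I l1 l2 w"
    using v[OF I] edge_subgroup[OF I]
    by (intro summand_periodic[OF I]) (auto intro: add_subgroup_zero add_subgroup_uminus)
  finally show ?thesis .
qed

lemma total_add_v: "total (w + cscale 1 v) = total w"
  by (simp add: total_def summand_add_v)

lemma total_add_period: "total (w + cscale \<tau> v) = e2pi (of_real (c v)) * total w"
  by (simp add: total_def summand_add_period sum_distrib_left case_prod_unfold mult_ac)

lemma total_meromorphic: "(\<lambda>z. total (w + cscale z y)) meromorphic_on UNIV"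
proof -
  have "(\<lambda>z. \<theta> (- (a + z * b))) meromorphic_on UNIV" for a b
    by (rule meromorphic_on_compose[OF theta_quot_meromorphic[OF \<tau>]]) (auto intro!: analytic_intros)
  hence "(\<lambda>z. summand I l1 l2 (w + cscale z y)) meromorphic_on UNIV" if "I \<in> T" for I l1 l2
    using that unfolding summand_def cev_line[OF that] by (intro meromorphic_intros)
  thus ?thesis
    unfolding total_def case_prod_unfold by (intro meromorphic_intros) auto
qed

section \<open>Poles and residues along a generic line\<close>

definition pole :: "'i set \<Rightarrow> 'i \<Rightarrow> 'a \<Rightarrow> 'a \<Rightarrow> 'a \<times> 'a \<Rightarrow> bool" where
  "pole I i l1 l2 w \<longleftrightarrow> cev (U I i) (shifted w l1 l2) \<in> period_lattice \<tau>"

lemma not_pole_isCont: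
  assumes "I \<in> T" "\<not> pole I i l1 l2 (w + cscale a y)"
  shows "isCont (\<lambda>z. \<theta> (- cev (U I i) (shifted (w + cscale z y) l1 l2))) a"
  unfolding cev_line[OF assms(1)]
proof (rule isCont_o2[where g = \<theta>])
  show "isCont \<theta> (- (cev (U I i) (shifted w l1 l2) + a * of_real (U I i y)))"
    using assms(2) unfolding pole_def cev_line[OF assms(1)]
    by (intro theta_quot_isCont[OF \<tau>]) (simp only: period_lattice_uminus not_False_eq_True)
qed (intro continuous_intros)

lemma summand_isCont:
  assumes "I \<in> T" "\<And>i. i \<in> I \<Longrightarrow> \<not> pole I i l1 l2 (w + cscale a y)"
  shows "isCont (\<lambda>z. summand I l1 l2 (w + cscale z y)) a"
  unfolding summand_def using not_pole_isCont[OF assms(1) assms(2)] by (intro continuous_intros)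

text \<open>Along the line \<open>w + z v\<close> through such a point, no two factors of a summand have a pole at the
  same \<open>z\<close>, so that every pole is simple and belongs to a single ridge.\<close>

definition generic_pt :: "'a \<times> 'a \<Rightarrow> bool" where
  "generic_pt w \<longleftrightarrow> (\<forall>I\<in>T. \<forall>i\<in>I. cev (U I i) w \<notin> rational_periods \<tau> \<and>
     (\<forall>j\<in>I. j \<noteq> i \<longrightarrow> U I i v \<noteq> 0 \<longrightarrow> 
        of_real (U I j v) * cev (U I i) w - of_real (U I i v) * cev (U I j) w \<notin> rational_periods \<tau>))"

lemma pole_rational:
  assumes "I \<in> T" "i \<in> I" "l1 \<in> L" "l2 \<in> L" "pole I i l1 l2 w"
  shows "cev (U I i) w \<in> rational_periods \<tau>"
proof -
  have "cev (U I i) (shifted w l1 l2) \<in> rational_periods \<tau>"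
    using assms(5) unfolding pole_def by (rule period_lattice_rational)
  hence "cev (U I i) (shifted w l1 l2) + of_real (- U I i l2) + of_real (U I i l1) * \<tau> \<in> rational_periods \<tau>"
    using assms U_rational by (intro rational_periods_combination) auto
  thus ?thesis by (simp add: cev_shifted[OF assms(1)] algebra_simps)
qed

lemma generic_pt_no_pole:
  "generic_pt w \<Longrightarrow> I \<in> T \<Longrightarrow> i \<in> I \<Longrightarrow> l1 \<in> L \<Longrightarrow> l2 \<in> L \<Longrightarrow> \<not> pole I i l1 l2 w"
  using pole_rational[of I i l1 l2 w] by (auto simp: generic_pt_def)

text \<open>Otherwise the argument of the factor would be constant along the line, and genericity
  keeps that constant out of the rational periods.\<close>

lemma pole_v_nonzero:
  assumes "generic_pt w" "I \<in> T" "i \<in> I" "l1 \<in> L" "l2 \<in> L" "pole I i l1 l2 (w + cscale a v)"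
  shows "U I i v \<noteq> 0"
proof
  assume "U I i v = 0"
  hence "cev (U I i) (w + cscale a v) = cev (U I i) w"
    by (simp add: cev_add cev_cscale linU[OF assms(2)])
  thus False using pole_rational[OF assms(2-6)] assms(1-3) by (simp add: generic_pt_def)
qed

text \<open>Two poles at the same a would put into \<open>rational_periods\<close> the combination
  of both arguments in which a cancels; this is what the second condition of
  \<open>generic_pt\<close> forbids.\<close>

lemma pole_unique:
  assumes "generic_pt w" "I \<in> T" "i \<in> I" "j \<in> I" "l1 \<in> L" "l2 \<in> L"
    "pole I i l1 l2 (w + cscale a v)" "pole I j l1 l2 (w + cscale a v)"
  shows "i = j"
proof (rule ccontr)
  assume "i \<noteq> j"
  have "of_real (U I j v) * cev (U I i) (w + cscale a v) - of_real (U I i v) * cev (U I j) (w + cscale a v)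
    \<in> rational_periods \<tau>"
    using assms by (intro rational_periods_scale U_v_rational pole_rational[of I])
  also have "of_real (U I j v) * cev (U I i) (w + cscale a v) - of_real (U I i v) * cev (U I j) (w + cscale a v)
      = of_real (U I j v) * cev (U I i) w - of_real (U I i v) * cev (U I j) w"
    by (simp add: cev_add cev_cscale linU[OF assms(2)] algebra_simps)
  finally show False
    using assms pole_v_nonzero[of w I i l1 l2 a] \<open>i \<noteq> j\<close> by (auto simp: generic_pt_def)
qed

definition \<rho> :: complex where
  "\<rho> = (SOME r. ((\<lambda>z. z * \<theta> z) \<longlongrightarrow> r) (at 0))"

lemma \<rho>: "((\<lambda>z. z * \<theta> z) \<longlongrightarrow> \<rho>) (at 0)"
  unfolding \<rho>_def using theta_quot_residue[OF \<tau>] by (rule someI_ex)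

text \<open>The hypothesis \<open>zero\<close> asks for a singular argument equal to 0, not merely
  in the period lattice. Representatives taken inside slices achieve this, and then no power of
  \<zeta> enters the residue.\<close>

lemma summand_residue:
  assumes I: "I \<in> T" "i \<in> I" and zero: "cev (U I i) (shifted (w + cscale a v) l1 l2) = 0"
    and v0: "U I i v \<noteq> 0"
    and np: "\<And>j. j \<in> I - {i} \<Longrightarrow> \<not> pole I j l1 l2 (w + cscale a v)"
  shows "((\<lambda>z. (z - a) * summand I l1 l2 (w + cscale z v)) \<longlongrightarrow>
     (- \<rho> / of_real (U I i v)) * 
       (e2pi (of_real (c l1)) * (\<Prod>j\<in>I - {i}. \<theta> (- cev (U I j) (shifted (w + cscale a v) l1 l2))))) (at a)"
proof -
  define b where "b = complex_of_real (U I i v)"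
  have b: "b \<noteq> 0" using v0 by (simp add: b_def)
  have "cev (U I i) (shifted w l1 l2) = - (a * b)"
    using zero by (simp add: cev_line[OF I(1)] b_def eq_neg_iff_add_eq_0)
  hence arg: "- cev (U I i) (shifted (w + cscale z v) l1 l2) = - (z - a) * b" for z
    by (simp add: cev_line[OF I(1)] b_def algebra_simps)
  have "filterlim (\<lambda>z. - (z - a) * b) (at 0) (at a)"
  proof (rule filterlim_atI)
    have "((\<lambda>z. - (z - a) * b) \<longlongrightarrow> - (a - a) * b) (at a)" by (intro tendsto_intros)
    thus "((\<lambda>z. - (z - a) * b) \<longlongrightarrow> 0) (at a)" by simp
    show "\<forall>\<^sub>F z in at a. - (z - a) * b \<noteq> 0"
      using b by (auto simp: eventually_at_filter)
  qed
  hence "((\<lambda>z. (- (z - a) * b) * \<theta> (- (z - a) * b)) \<longlongrightarrow> \<rho>) (at a)"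
    using filterlim_compose[OF \<rho>] by blast
  moreover have "((\<lambda>z. \<Prod>j\<in>I - {i}. \<theta> (- cev (U I j) (shifted (w + cscale z v) l1 l2))) \<longlongrightarrow>
     (\<Prod>j\<in>I - {i}. \<theta> (- cev (U I j) (shifted (w + cscale a v) l1 l2)))) (at a)"
    using not_pole_isCont[OF I(1) np] by (intro tendsto_prod) (simp add: isCont_def)
  ultimately have "((\<lambda>z. - 1 / b * ((- (z - a) * b) * \<theta> (- (z - a) * b)) * 
      (e2pi (of_real (c l1)) * (\<Prod>j\<in>I - {i}. \<theta> (- cev (U I j) (shifted (w + cscale z v) l1 l2))))) \<longlongrightarrow>
     - 1 / b * \<rho> * (e2pi (of_real (c l1)) * (\<Prod>j\<in>I - {i}. \<theta> (- cev (U I j) (shifted (w + cscale a v) l1 l2))))) (at a)"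
    by (intro tendsto_mult tendsto_const)
  moreover have "- 1 / b * ((- (z - a) * b) * \<theta> (- (z - a) * b)) * 
      (e2pi (of_real (c l1)) * (\<Prod>j\<in>I - {i}. \<theta> (- cev (U I j) (shifted (w + cscale z v) l1 l2)))) =
      (z - a) * summand I l1 l2 (w + cscale z v)" for z
  proof -
    have "- 1 / b * ((- (z - a) * b) * X) * (E * Y) = (z - a) * (E * (X * Y))" for X E Y
      using b by (simp add: field_simps)
    thus ?thesis unfolding summand_def prod.remove[OF finI[OF I(1)] I(2)] arg .
  qed
  ultimately show ?thesis by (simp add: b_def)
qed

definition poles :: "'i set \<Rightarrow> 'i \<Rightarrow> 'a \<times> 'a \<Rightarrow> ('a set \<times> 'a set) set" where
  "poles I i w = {(h1, h2) \<in> H I \<times> H I. pole I i (coset_rep h1) (coset_rep h2) w}"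

definition part :: "'i set \<Rightarrow> ('a set \<times> 'a set) set \<Rightarrow> 'a \<times> 'a \<Rightarrow> complex" where
  "part I A w = of_int (wt I) / of_nat (card (H I)) *
     (\<Sum>(h1, h2)\<in>A. summand I (coset_rep h1) (coset_rep h2) w)"

lemma sum_cosets_slice:
  assumes I: "I \<in> T" and e: "lattice_slices L (edge_lattice V I) e m"
  shows "(\<Sum>(h1, h2)\<in>{h\<in>H I. h \<inter> lattice_slices.slice L e p \<noteq> {}} \<times> 
                     {h\<in>H I. h \<inter> lattice_slices.slice L e r \<noteq> {}}.
            summand I (coset_rep h1) (coset_rep h2) w)
       = (\<Sum>c1\<in>cosets (lattice_slices.slice L e p) (edge_lattice V I).
          \<Sum>c2\<in>cosets (lattice_slices.slice L e r) (edge_lattice V I).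
            summand I (coset_rep c1) (coset_rep c2) w)"
proof -
  interpret S: lattice_slices L "edge_lattice V I" e m by (rule e)
  note zero = add_subgroup_zero[OF edge_subgroup[OF I]]
  show ?thesis
    unfolding sum.cartesian_product[symmetric]
    by (subst S.sum_meets_slice[where f = "\<lambda>l. summand I _ l w"], 
          rule summand_periodic[OF I], simp add: zero, assumption,
        rule S.sum_meets_slice[where f = "\<lambda>l1. \<Sum>c2\<in>cosets (S.slice r) (edge_lattice V I). summand I l1 (coset_rep c2) w"],
        intro sum.cong refl summand_periodic[OF I], assumption, simp add: zero)
qed

text \<open>The dual vector of i0 becomes integral on L after multiplication by the order of its
  local group, and surjective onto Z after division by a generator of its image. Vanishing on K and
  being onto Z determine e up to sign, which is why it serves all simplices through K.\<close>

lemma ridge_functional: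
  assumes I0: "insert i0 K \<in> T" "i0 \<notin> K"
  obtains e where "linear e" "\<And>j. j \<in> K \<Longrightarrow> e (V j) = 0" "e ` L = \<int>"
    "\<And>i. insert i K \<in> T \<Longrightarrow> i \<notin> K \<Longrightarrow> \<exists>m. m \<noteq> 0 \<and> e (V i) = of_int m \<and>
        (\<forall>x. e x = of_int m * U (insert i K) i x) \<and> lattice_slices L (edge_lattice V (insert i K)) e m"
proof -
  define I0 where "I0 = insert i0 K"
  have I0T: "I0 \<in> T" and i0: "i0 \<in> I0" using assms by (auto simp: I0_def)
  interpret B: basis_family V I0 by (rule basis[OF I0T])
  define u where "u = (\<lambda>x. of_nat (card (H I0)) * U I0 i0 x)"
  have lin_mult: "linear (\<lambda>x. d * f x)" if "linear f" for d and f :: "'a \<Rightarrow> real"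
    using that by (auto intro!: linearI simp: linear_add linear_scale algebra_simps)
  have "H I0 \<noteq> {}" using add_subgroup_zero[OF L] by (auto simp: cosets_eq)
  hence "card (H I0) \<noteq> 0" using fin[OF I0T] by simp
  hence "u (V i0) \<noteq> 0" using B.dual_basis[OF i0, of i0] by (simp add: u_def)
  hence "\<exists>x\<in>L. u x \<noteq> 0" using edge[OF I0T i0] by blast
  moreover have "u ` L \<subseteq> \<int>"
  proof
    fix y assume "y \<in> u ` L"
    then obtain l where l: "l \<in> L" "y = u l" by blast
    have "of_nat (card (H I0)) *\<^sub>R l \<in> edge_lattice V I0"
      by (rule card_cosets_scale_mem[OF edge_subgroup[OF I0T] L fin[OF I0T] l(1)])
    thus "y \<in> \<int>"
      using B.edge_lattice_iff i0 l by (auto simp: u_def linear_scale[OF B.linear_dual])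
  qed
  moreover have lu: "linear u" unfolding u_def by (intro lin_mult B.linear_dual)
  ultimately obtain d where d: "(\<lambda>x. d * u x) ` L = \<int>"
    using int_image_cyclic[OF L] by metis
  define e where "e = (\<lambda>x. d * u x)"
  have le: "linear e" unfolding e_def by (intro lin_mult lu)
  have eK: "e (V j) = 0" if "j \<in> K" for j
    using that B.dual_basis[of j i0] assms by (auto simp: e_def u_def I0_def)
  have eL: "e ` L = \<int>" using d by (simp add: e_def)
  have "\<exists>m. m \<noteq> 0 \<and> e (V i) = of_int m \<and> (\<forall>x. e x = of_int m * U (insert i K) i x) \<and> 
     lattice_slices L (edge_lattice V (insert i K)) e m" if i: "insert i K \<in> T" "i \<notin> K" for i
  proof -
    define I where "I = insert i K"
    have IT: "I \<in> T" using i by (simp add: I_def)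
    interpret BI: basis_family V I by (rule basis[OF IT])
    have iI: "i \<in> I" by (simp add: I_def)
    have "e (V i) \<in> \<int>" using edge[OF IT iI] eL by blast
    then obtain m where m: "e (V i) = of_int m" by (auto elim: Ints_cases)
    have ex: "e x = of_int m * U I i x" for x
      using BI.dual_remove_unique[OF le _ iI, of x] eK i(2) m by (simp add: I_def)
    have m0: "m \<noteq> 0"
    proof
      assume "m = 0"
      hence "e ` L \<subseteq> {0}" using ex by auto
      moreover have "(1::real) \<in> e ` L" unfolding eL by simp
      ultimately show False by auto
    qed
    have "e ` edge_lattice V I = {of_int (m * k) | k. True}"
    proof (intro equalityI subsetI)
      fix y assume "y \<in> e ` edge_lattice V I"
      then obtain x where "x \<in> edge_lattice V I" "y = e x" by blast
      moreover from this obtain k where "U I i x = of_int k" 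
        using BI.edge_lattice_iff iI by (metis Ints_cases)
      ultimately have "y = of_int (m * k)" using ex by simp
      thus "y \<in> {of_int (m * k) | k. True}" by blast
    next
      fix y :: real assume "y \<in> {of_int (m * k) | k. True}"
      then obtain k where "y = of_int (m * k)" by blast
      hence "y = e (of_int k *\<^sub>R V i)" by (simp add: linear_scale[OF le] m)
      thus "y \<in> e ` edge_lattice V I"
        using add_subgroup_int_scale[OF edge_subgroup[OF IT] BI.edge_in_edge_lattice[OF iI], of k] by blast
    qed
    hence "lattice_slices L (edge_lattice V I) e m"
      using L edge_subgroup[OF IT] edge_sub[OF IT] le eL m0 fin[OF IT] by (intro lattice_slices.intro)
    thus ?thesis using m m0 ex by (auto simp: I_def)
  qed
  thus thesis using that le eK eL by blast
qed

text \<open>Let \<open>e\<close> be the functional attached to a ridge \<open>K\<close>. The summands of \<open>I = K \<union> {i}\<close> have poles where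
  \<open>e = p \<tau> - r\<close> with integers \<open>p\<close>, \<open>r\<close>, and the pairs \<open>(h\<^sub>1, h\<^sub>2)\<close> contributing to it are those meeting
  \<open>e = p\<close> and \<open>e = r\<close>. Their residues only involve the restrictions of \<open>u\<^sub>j\<^sup>I\<close>, \<open>j \<in> K\<close>, to the kernel of
  \<open>e\<close>, which do not depend on \<open>I\<close>. As \<open>|H\<^sub>I|\<close> is \<open>|e(v\<^sub>i)|\<close> times a number depending on \<open>K\<close> only, the residue
  for \<open>I\<close> is \<open>sgn(e(v\<^sub>i)) w(I)\<close> times a common factor.\<close>

lemma ridge_cancellation:
  assumes gen: "generic_pt w"
  shows "((\<lambda>z. (z - a) * (\<Sum>i | i \<notin> K \<and> insert i K \<in> T. 
            part (insert i K) (poles (insert i K) i (w + cscale a v)) (w + cscale z v))) \<longlongrightarrow> 0) (at a)"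
proof (cases "{i. i \<notin> K \<and> insert i K \<in> T} = {}")
  case True
  show ?thesis unfolding True by simp
next
  case False
  define S where "S = {i. i \<notin> K \<and> insert i K \<in> T}"
  define W where "W = w + cscale a v"
  obtain i0 where i0: "i0 \<in> S" using False by (auto simp: S_def)
  obtain e where le: "linear e" and eK: "\<And>j. j \<in> K \<Longrightarrow> e (V j) = 0" and eL: "e ` L = \<int>"
    and em: "\<And>i. insert i K \<in> T \<Longrightarrow> i \<notin> K \<Longrightarrow> \<exists>m. m \<noteq> 0 \<and> e (V i) = of_int m \<and>
        (\<forall>x. e x = of_int m * U (insert i K) i x) \<and> lattice_slices L (edge_lattice V (insert i K)) e m"
    by (rule ridge_functional[of i0 K]) (use i0 in \<open>auto simp: S_def\<close>)
  define m where "m i = \<lfloor>e (V i)\<rfloor>" for i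
  have m0: "m i \<noteq> 0" and mV: "e (V i) = of_int (m i)" 
    and ex: "\<And>x. e x = of_int (m i) * U (insert i K) i x"
    and sl: "lattice_slices L (edge_lattice V (insert i K)) e (m i)" if "i \<in> S" for i
    using em[of i] that by (auto simp: S_def m_def)
  have cev_e: "cev e y = of_int (m i) * cev (U (insert i K) i) y" if "i \<in> S" for i y
    by (simp add: cev_def ex[OF that] algebra_simps)
  have cev_e_shifted: "cev e (shifted W l1 l2) = cev e W - \<tau> * of_real (e l1) + of_real (e l2)" for l1 l2
    by (simp add: shifted_def cev_add cev_diff cev_cscale le)
  \<comment> \<open>Multiplication by \<open>m i\<close> turns a condition on a dual vector
    depending on i into one on the common functional e.\<close>
  have pole_iff: "pole (insert i K) i l1 l2 W \<longleftrightarrow>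
     (\<exists>\<alpha> \<beta>. cev e W = \<tau> * of_real (e l1 + of_int (m i * \<beta>)) - of_real (e l2 - of_int (m i * \<alpha>)))"
    if i: "i \<in> S" for i l1 l2
  proof -
    have "pole (insert i K) i l1 l2 W \<longleftrightarrow> (\<exists>\<alpha> \<beta>. cev (U (insert i K) i) (shifted W l1 l2) = of_int \<alpha> + of_int \<beta> * \<tau>)"
      by (auto simp: pole_def period_lattice_def)
    also have "\<dots> \<longleftrightarrow> (\<exists>\<alpha> \<beta>. cev e (shifted W l1 l2) = of_int (m i) * (of_int \<alpha> + of_int \<beta> * \<tau>))"
      using m0[OF i] by (simp add: cev_e[OF i])
    also have "\<dots> \<longleftrightarrow> (\<exists>\<alpha> \<beta>. cev e W = \<tau> * of_real (e l1 + of_int (m i * \<beta>)) - of_real (e l2 - of_int (m i * \<alpha>)))"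
      unfolding cev_e_shifted by (simp add: algebra_simps)
    finally show ?thesis .
  qed
  have eint: "\<exists>k. e l = of_int k" if "l \<in> L" for l
    using that eL by (metis Ints_cases imageI)
  \<comment> \<open>As e is integral on L, a value e(W) outside Z + Z \<tau> admits no pole at a
    belonging to this ridge.\<close>
  show ?thesis
  proof (cases "\<exists>p r :: int. cev e W = \<tau> * of_int p - of_int r")
    case False
    have "poles (insert i K) i W = {}" if i: "i \<in> S" for i
    proof -
      have IT: "insert i K \<in> T" using i by (simp add: S_def)
      have "\<not> pole (insert i K) i l1 l2 W" if l: "l1 \<in> L" "l2 \<in> L" for l1 l2
      proof
        assume "pole (insert i K) i l1 l2 W"
        then obtain \<alpha> \<beta> where ab: 
          "cev e W = \<tau> * of_real (e l1 + of_int (m i * \<beta>)) - of_real (e l2 - of_int (m i * \<alpha>))"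
          using pole_iff[OF i] by blast
        obtain k1 k2 where "e l1 = of_int k1" "e l2 = of_int k2" using eint l by metis
        hence "cev e W = \<tau> * of_int (k1 + m i * \<beta>) - of_int (k2 - m i * \<alpha>)" using ab by simp
        thus False using False by blast
      qed
      thus ?thesis using rep_in[OF IT] by (auto simp: poles_def)
    qed
    hence "(\<Sum>i\<in>S. part (insert i K) (poles (insert i K) i W) (w + cscale z v)) = 0" for z
      by (simp add: part_def)
    thus ?thesis by (simp add: S_def W_def)
  next
    case True
    then obtain p r :: int where pr: "cev e W = \<tau> * of_int p - of_int r" by blast
    define sli where "sli n = {x \<in> L. e x = of_int n}" for n :: int
    have sli: "lattice_slices.slice L e n = sli n" for n
      using lattice_slices.slice_def[OF sl[OF i0]] by (simp add: sli_def)
    define C where "C n = cosets (sli n) (edge_lattice V (insert i0 K))" for n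
    have i0T: "insert i0 K \<in> T" "i0 \<notin> K" using i0 by (auto simp: S_def)
    \<comment> \<open>What remains of the residues once \<rho>, the value of the dual vector at v,
      the order of H_I and the weight are taken out, computed in the reference simplex
      \<open>insert i0 K\<close>.\<close>
    define R where "R = (\<Sum>c1\<in>C p. \<Sum>c2\<in>C r. e2pi (of_real (c (coset_rep c1))) * 
      (\<Prod>j\<in>K. \<theta> (- cev (U (insert i0 K) j) (shifted W (coset_rep c1) (coset_rep c2)))))"
    have lim: "((\<lambda>z. (z - a) * part (insert i K) (poles (insert i K) i W) (w + cscale z v)) \<longlongrightarrow>
        (- \<rho> * R / (of_nat (card (C 0)) * of_real (e v))) * of_real (sgn (e (V i)) * of_int (wt (insert i K)))) (at a)"
      if i: "i \<in> S" for i
    proof -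
      define I where "I = insert i K"
      have IT: "I \<in> T" and iI: "i \<in> I" and IK: "I - {i} = K" using i by (auto simp: I_def S_def)
      interpret S: lattice_slices L "edge_lattice V I" e "m i"
        unfolding I_def by (rule sl[OF i])
      have UU: "U I j x = U (insert i0 K) j x" if "e x = 0" "j \<in> K" for x j
      proof (rule dual_vector_eq_on_kernel[OF basis[OF i0T(1)] basis[OF IT] _ iI])
        show "U (insert i0 K) i0 x = 0" using that ex[OF i0, of x] m0[OF i0] by simp
        show "insert i0 K - {i0} = I - {i}" "j \<in> insert i0 K - {i0}"
          using that i0T IK by auto
      qed simp
      have "x \<in> edge_lattice V I \<longleftrightarrow> x \<in> edge_lattice V (insert i0 K)" if x: "e x = 0" for x
      proof -
        have "U I i x = 0" "U (insert i0 K) i0 x = 0"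
          using x ex[OF i, of x] ex[OF i0, of x] m0[OF i] m0[OF i0] by (auto simp: I_def)
        thus ?thesis
          unfolding basis_family.edge_lattice_iff[OF basis[OF IT]] 
            basis_family.edge_lattice_iff[OF basis[OF i0T(1)]]
          using UU[OF x] by (auto simp: I_def)
      qed
      \<comment> \<open>These cosets depend only on differences within a slice. Such differences lie
        in the kernel of e, where membership in the two edge lattices agrees.\<close>
      hence "cosets (sli n) (edge_lattice V I) = C n" for n
        unfolding C_def cosets_def by (intro arg_cong2[where f = quotient] refl)
          (auto simp: sli_def linear_diff[OF le])
      note C = this
      have slice: "S.slice = sli" using sli by blast
      have sum: "(\<Sum>(h1, h2)\<in>poles I i W. summand I (coset_rep h1) (coset_rep h2) y) =
        (\<Sum>c1\<in>C p. \<Sum>c2\<in>C r. summand I (coset_rep c1) (coset_rep c2) y)" for y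
      proof -
        have "pole I i (coset_rep h1) (coset_rep h2) W \<longleftrightarrow> h1 \<inter> S.slice p \<noteq> {} \<and> h2 \<inter> S.slice r \<noteq> {}"
          if h: "h1 \<in> H I" "h2 \<in> H I" for h1 h2
        proof -
          define l1 l2 where "l1 = coset_rep h1" and "l2 = coset_rep h2"
          have "pole I i l1 l2 W \<longleftrightarrow> (\<exists>\<alpha> \<beta>. complex_of_real (of_int (- r)) + of_real (of_int p) * \<tau> = 
              of_real (- (e l2 - of_int (m i * \<alpha>))) + of_real (e l1 + of_int (m i * \<beta>)) * \<tau>)"
            unfolding I_def pole_iff[OF i] pr by (simp add: algebra_simps)
          also have "\<dots> \<longleftrightarrow> (\<exists>\<alpha> \<beta>. of_int (- r) = - (e l2 - of_int (m i * \<alpha>)) \<and> of_int p = e l1 + of_int (m i * \<beta>))"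
            using period_basis_unique[OF \<tau>] by (metis (no_types, lifting))
          also have "\<dots> \<longleftrightarrow> (\<exists>\<beta>. e l1 = of_int (p + m i * (- \<beta>))) \<and> (\<exists>\<alpha>. e l2 = of_int (r + m i * \<alpha>))"
          proof -
            have "of_int p = e l1 + of_int (m i * \<beta>) \<longleftrightarrow> e l1 = of_int (p + m i * (- \<beta>))" for \<beta>
              by auto
            moreover have "of_int (- r) = - (e l2 - of_int (m i * \<alpha>)) \<longleftrightarrow> e l2 = of_int (r + m i * \<alpha>)" for \<alpha>
              by auto
            ultimately show ?thesis by blast
          qed
          also have "(\<exists>\<beta>. e l1 = of_int (p + m i * (- \<beta>))) \<longleftrightarrow> (\<exists>\<beta>. e l1 = of_int (p + m i * \<beta>))"
            by (metis minus_minus)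
          finally show ?thesis
            using S.meets_slice_iff[OF h(1) coset_rep_in[OF S.\<Lambda> h(1)]] 
              S.meets_slice_iff[OF h(2) coset_rep_in[OF S.\<Lambda> h(2)]] by (simp add: l1_def l2_def)
        qed
        hence "poles I i W = {h\<in>H I. h \<inter> S.slice p \<noteq> {}} \<times> {h\<in>H I. h \<inter> S.slice r \<noteq> {}}"
          unfolding poles_def by auto
        thus ?thesis using sum_cosets_slice[OF IT S.lattice_slices_axioms, where p = p and r = r and w = y] by (simp add: slice C)
      qed
      have "((\<lambda>z. (z - a) * summand I (coset_rep c1) (coset_rep c2) (w + cscale z v)) \<longlongrightarrow>
         (- \<rho> * of_int (m i) / of_real (e v)) * (e2pi (of_real (c (coset_rep c1))) * 
      (\<Prod>j\<in>K. \<theta> (- cev (U (insert i0 K) j) (shifted W (coset_rep c1) (coset_rep c2)))))) (at a)"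
        if c12: "c1 \<in> C p" "c2 \<in> C r" for c1 c2
      proof -
        define l1 l2 where "l1 = coset_rep c1" and "l2 = coset_rep c2"
        have "l1 \<in> sli p" "l2 \<in> sli r"
          using coset_rep_in_carrier[OF edge_subgroup[OF i0T(1)]] c12 unfolding C_def l1_def l2_def by auto
        hence l: "l1 \<in> L" "l2 \<in> L" "e l1 = of_int p" "e l2 = of_int r" by (auto simp: sli_def)
        have e0: "cev e (shifted W l1 l2) = 0" using l pr by (simp add: cev_e_shifted)
        hence u0: "cev (U I i) (shifted W l1 l2) = 0"
          using cev_e[OF i] m0[OF i] by (simp add: I_def)
        have "0 \<in> period_lattice \<tau>" unfolding period_lattice_def by (auto intro!: exI[of _ 0])
        hence pl: "pole I i l1 l2 W" by (simp add: pole_def u0)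
        have "U I i v \<noteq> 0"
          using pole_v_nonzero[OF gen IT iI l(1,2)] pl by (simp add: W_def)
        moreover have "\<not> pole I j l1 l2 W" if "j \<in> I - {i}" for j
          using pole_unique[OF gen IT iI _ l(1,2), of j a] that pl by (auto simp: W_def)
        ultimately have "((\<lambda>z. (z - a) * summand I l1 l2 (w + cscale z v)) \<longlongrightarrow>
     (- \<rho> / of_real (U I i v)) * 
       (e2pi (of_real (c l1)) * (\<Prod>j\<in>I - {i}. \<theta> (- cev (U I j) (shifted W l1 l2))))) (at a)"
          using summand_residue[OF IT iI] u0 unfolding W_def by blast
        \<comment> \<open>Here the sign of \<open>m i\<close> enters: its absolute value will cancel
          against the order of H_I, and the sign is left for the balancing condition.\<close>
        moreover have "- \<rho> / of_real (U I i v) = - \<rho> * of_int (m i) / of_real (e v)"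
          using ex[OF i, of v] m0[OF i] by (simp add: I_def)
        moreover have "(\<Prod>j\<in>I - {i}. \<theta> (- cev (U I j) (shifted W l1 l2))) = 
            (\<Prod>j\<in>K. \<theta> (- cev (U (insert i0 K) j) (shifted W l1 l2)))"
        proof (intro prod.cong IK)
          fix j assume j: "j \<in> K"
          \<comment> \<open>As e is a real form, its vanishing on a complexified vector puts both
            components into the kernel, so \<open>UU\<close> applies to each.\<close>
          have "e (fst (shifted W l1 l2)) = 0" "e (snd (shifted W l1 l2)) = 0"
            using e0 by (auto simp: cev_def complex_eq_iff)
          thus "\<theta> (- cev (U I j) (shifted W l1 l2)) = \<theta> (- cev (U (insert i0 K) j) (shifted W l1 l2))"
            using UU j by (simp add: cev_def)
        qed
        ultimately show ?thesis by (simp only: l1_def l2_def)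
      qed
      hence "((\<lambda>z. \<Sum>c1\<in>C p. \<Sum>c2\<in>C r. (z - a) * summand I (coset_rep c1) (coset_rep c2) (w + cscale z v)) \<longlongrightarrow>
        (\<Sum>c1\<in>C p. \<Sum>c2\<in>C r. (- \<rho> * of_int (m i) / of_real (e v)) * (e2pi (of_real (c (coset_rep c1))) * 
      (\<Prod>j\<in>K. \<theta> (- cev (U (insert i0 K) j) (shifted W (coset_rep c1) (coset_rep c2))))))) (at a)"
        by (intro tendsto_sum)
      hence "((\<lambda>z. (z - a) * (\<Sum>(h1, h2)\<in>poles I i W. summand I (coset_rep h1) (coset_rep h2) (w + cscale z v))) \<longlongrightarrow>
        (- \<rho> * of_int (m i) / of_real (e v)) * R) (at a)"
        unfolding sum R_def sum_distrib_left .
      hence "((\<lambda>z. of_int (wt I) / of_nat (card (H I)) * 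
           ((z - a) * (\<Sum>(h1, h2)\<in>poles I i W. summand I (coset_rep h1) (coset_rep h2) (w + cscale z v)))) \<longlongrightarrow>
        of_int (wt I) / of_nat (card (H I)) * ((- \<rho> * of_int (m i) / of_real (e v)) * R)) (at a)"
        by (rule tendsto_mult_left)
      moreover have "of_int (wt I) / of_nat (card (H I)) * ((- \<rho> * of_int (m i) / of_real (e v)) * R) =
        (- \<rho> * R / (of_nat (card (C 0)) * of_real (e v))) * of_real (sgn (e (V i)) * of_int (wt I))"
      proof -
        have "real (card (H I)) = \<bar>of_int (m i)\<bar> * real (card (C 0))"
          using S.card_cosets by (simp add: slice C)
        hence "complex_of_nat (card (H I)) = of_real \<bar>of_int (m i)\<bar> * of_nat (card (C 0))"
          by (metis of_real_mult of_real_of_nat_eq)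
        moreover have "complex_of_int (m i) = of_real (sgn (e (V i))) * of_real \<bar>of_int (m i)\<bar>"
          unfolding mV[OF i] of_real_mult[symmetric] by (simp add: sgn_mult_abs)
        moreover have "complex_of_real \<bar>of_int (m i)\<bar> \<noteq> 0" using m0[OF i] by simp
        ultimately show ?thesis by simp
      qed
      ultimately show ?thesis by (simp add: part_def I_def[symmetric] mult_ac)
    qed
    have "((\<lambda>z. \<Sum>i\<in>S. (z - a) * part (insert i K) (poles (insert i K) i W) (w + cscale z v)) \<longlongrightarrow>
        (\<Sum>i\<in>S. (- \<rho> * R / (of_nat (card (C 0)) * of_real (e v))) * of_real (sgn (e (V i)) * of_int (wt (insert i K))))) (at a)"
      by (intro tendsto_sum lim)
    also have "(\<Sum>i\<in>S. (- \<rho> * R / (of_nat (card (C 0)) * of_real (e v))) * of_real (sgn (e (V i)) * of_int (wt (insert i K)))) = 0"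
      unfolding sum_distrib_left[symmetric] of_real_sum[symmetric]
      using balanced[OF le eK] by (simp add: S_def)
    finally show ?thesis by (simp add: S_def W_def sum_distrib_left)
  qed
qed

lemma total_isCont:
  assumes "\<And>I h1 h2 i. I \<in> T \<Longrightarrow> h1 \<in> H I \<Longrightarrow> h2 \<in> H I \<Longrightarrow> i \<in> I \<Longrightarrow> 
     \<not> pole I i (coset_rep h1) (coset_rep h2) w"
  shows "isCont (\<lambda>z. total (w + cscale z y)) 0"
proof -
  have sums: "isCont (\<lambda>z. \<Sum>h\<in>H I \<times> H I. summand I (coset_rep (fst h)) (coset_rep (snd h)) (w + cscale z y)) 0"
    if I: "I \<in> T" for I
    using assms[OF I] by (intro continuous_sum summand_isCont[OF I]) auto
  show ?thesis
    unfolding total_def case_prod_unfold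
    by (rule continuous_sum, rule continuous_mult[OF continuous_const sums])
qed

text \<open>Pairs of a simplex and one of its vertices are regrouped by the opposite ridge K = I -
  {i}; residues cancel within such a group.\<close>

lemma ridge_sum:
  fixes g :: "'i set \<Rightarrow> 'i \<Rightarrow> complex"
  shows "(\<Sum>I\<in>T. \<Sum>i\<in>I. g I i) = 
    (\<Sum>K\<in>(\<Union>I\<in>T. (\<lambda>i. I - {i}) ` I). \<Sum>i | i \<notin> K \<and> insert i K \<in> T. g (insert i K) i)"
proof -
  define \<K> where "\<K> = (\<Union>I\<in>T. (\<lambda>i. I - {i}) ` I)"
  define S where "S K = {i. i \<notin> K \<and> insert i K \<in> T}" for K
  have "finite \<K>" unfolding \<K>_def using T finI by blast
  moreover have "finite (S K)" for K
    by (rule finite_subset[of _ "\<Union>T"]) (use T finI in \<open>auto simp: S_def\<close>)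
  ultimately have "(\<Sum>K\<in>\<K>. \<Sum>i\<in>S K. g (insert i K) i) = (\<Sum>(K, i)\<in>Sigma \<K> S. g (insert i K) i)"
    by (intro sum.Sigma) auto
  also have "\<dots> = (\<Sum>(I, i)\<in>Sigma T (\<lambda>I. I). g I i)"
    by (rule sum.reindex_bij_witness[where i = "\<lambda>(I, i). (I - {i}, i)" and j = "\<lambda>(K, i). (insert i K, i)"])
      (auto simp: \<K>_def S_def insert_absorb)
  also have "\<dots> = (\<Sum>I\<in>T. \<Sum>i\<in>I. g I i)"
    using T finI by (intro sum.Sigma[symmetric]) auto
  finally show ?thesis unfolding \<K>_def S_def by simp
qed

text \<open>By \<open>pole_unique\<close> each pair of cosets has at most one singular factor at a.
  So the pairs split disjointly into those without a pole, which contribute continuous terms, and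
  those belonging to one vertex, which \<open>ridge_sum\<close> collects along ridges.\<close>

lemma total_limit:
  assumes gen: "generic_pt w"
  shows "((\<lambda>z. (z - a) * total (w + cscale z v)) \<longlongrightarrow> 0) (at a)"
proof -
  define W where "W = w + cscale a v"
  define N where "N I = H I \<times> H I - (\<Union>i\<in>I. poles I i W)" for I
  have fins: "finite (H I \<times> H I)" if "I \<in> T" for I using fin[OF that] by simp
  have split: "of_int (wt I) / of_nat (card (H I)) *
     (\<Sum>(h1, h2)\<in>H I \<times> H I. summand I (coset_rep h1) (coset_rep h2) y)
     = part I (N I) y + (\<Sum>i\<in>I. part I (poles I i W) y)" if I: "I \<in> T" for I y
  proof -
    define f where "f = (\<lambda>(h1, h2). summand I (coset_rep h1) (coset_rep h2) y)"
    have sub: "(\<Union>i\<in>I. poles I i W) \<subseteq> H I \<times> H I" by (auto simp: poles_def)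
    have "sum f (H I \<times> H I) = sum f (N I) + sum f (\<Union>i\<in>I. poles I i W)"
      unfolding N_def by (rule sum.subset_diff[OF sub fins[OF I]])
    also have "sum f (\<Union>i\<in>I. poles I i W) = (\<Sum>i\<in>I. sum f (poles I i W))"
    proof (rule sum.UNION_disjoint[OF finI[OF I]])
      show "\<forall>i\<in>I. finite (poles I i W)"
        using finite_subset[OF _ fins[OF I]] sub by (meson UN_subset_iff)
      show "\<forall>i\<in>I. \<forall>j\<in>I. i \<noteq> j \<longrightarrow> poles I i W \<inter> poles I j W = {}"
        using pole_unique[OF gen I] rep_in[OF I] unfolding poles_def W_def by blast
    qed
    finally show ?thesis
      by (simp add: part_def f_def algebra_simps sum_distrib_left)
  qed
  have tot: "total y = (\<Sum>I\<in>T. part I (N I) y) + 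
     (\<Sum>K\<in>(\<Union>I\<in>T. (\<lambda>i. I - {i}) ` I). \<Sum>i | i \<notin> K \<and> insert i K \<in> T. part (insert i K) (poles (insert i K) i W) y)" for y
    unfolding total_def using split by (simp add: sum.distrib ridge_sum)
  have "((\<lambda>z. (z - a) * (\<Sum>I\<in>T. part I (N I) (w + cscale z v))) \<longlongrightarrow> (a - a) * (\<Sum>I\<in>T. part I (N I) W)) (at a)"
  proof (intro tendsto_intros)
    fix I assume I: "I \<in> T"
    have "isCont (\<lambda>z. \<Sum>h\<in>N I. summand I (coset_rep (fst h)) (coset_rep (snd h)) (w + cscale z v)) a"
      by (intro continuous_sum summand_isCont[OF I]) (auto simp: N_def poles_def W_def)
    hence "isCont (\<lambda>z. part I (N I) (w + cscale z v)) a"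
      unfolding part_def case_prod_unfold by (intro continuous_mult continuous_const)
    thus "((\<lambda>z. part I (N I) (w + cscale z v)) \<longlongrightarrow> part I (N I) W) (at a)"
      by (simp add: isCont_def W_def)
  qed
  moreover have "((\<lambda>z. \<Sum>K\<in>(\<Union>I\<in>T. (\<lambda>i. I - {i}) ` I). (z - a) * 
      (\<Sum>i | i \<notin> K \<and> insert i K \<in> T. part (insert i K) (poles (insert i K) i W) (w + cscale z v))) \<longlongrightarrow>
      (\<Sum>K\<in>(\<Union>I\<in>T. (\<lambda>i. I - {i}) ` I). 0)) (at a)"
    unfolding W_def by (intro tendsto_sum ridge_cancellation[OF gen])
  ultimately have "((\<lambda>z. (z - a) * (\<Sum>I\<in>T. part I (N I) (w + cscale z v)) + 
      (\<Sum>K\<in>(\<Union>I\<in>T. (\<lambda>i. I - {i}) ` I). (z - a) * 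
      (\<Sum>i | i \<notin> K \<and> insert i K \<in> T. part (insert i K) (poles (insert i K) i W) (w + cscale z v)))) \<longlongrightarrow> 0) (at a)"
    using tendsto_add by fastforce
  thus ?thesis
    unfolding tot distrib_left by (simp only: sum_distrib_left)
qed

lemma total_generic_zero:
  assumes gen: "generic_pt w"
  shows "total w = 0"
proof -
  have "isCont (\<lambda>z. total (w + cscale z v)) 0"
    by (intro total_isCont generic_pt_no_pole[OF gen] rep_in)
  hence "total (w + cscale 0 v) = 0"
  proof (rule meromorphic_quasi_periodic_zero[OF \<tau> total_meromorphic total_limit[OF gen], rotated -1])
    show "total (w + cscale (z + 1) v) = total (w + cscale z v)" for z
      using total_add_v[of "w + cscale z v"] by (simp add: cscale_add_left add.assoc)
    show "total (w + cscale (z + \<tau>) v) = e2pi (of_real (c v)) * total (w + cscale z v)" for z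
      using total_add_period[of "w + cscale z v"] by (simp add: cscale_add_left add.assoc)
    show "e2pi (of_real (c v)) \<noteq> 1" by (rule v1)
    show "norm (e2pi (of_real (c v))) = 1" by (simp add: norm_e2pi)
  qed
  thus ?thesis by simp
qed

text \<open>Generic points are dense: move \<open>w\<close> in a direction \<open>y\<close> that no relevant functional annihilates.\<close>

theorem total_eq_0:
  assumes reg: "\<And>I h1 h2 i. I \<in> T \<Longrightarrow> h1 \<in> H I \<Longrightarrow> h2 \<in> H I \<Longrightarrow> i \<in> I \<Longrightarrow> 
     \<not> pole I i (coset_rep h1) (coset_rep h2) w"
  shows "total w = 0"
proof -
  \<comment> \<open>The diagonal case expresses the first condition of \<open>generic_pt\<close>,
    the other case its condition on pairs.\<close>
  define G where "G = (\<lambda>(I, i, j) x. if i = j then U I i x else U I j v * U I i x - U I i v * U I j x)"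
  define F where "F = G ` {(I, i, j). I \<in> T \<and> i \<in> I \<and> j \<in> I \<and> (i = j \<or> U I i v \<noteq> 0)}"
  have "finite (Sigma T (\<lambda>I. I \<times> I))" using T finI by blast
  hence "finite {(I, i, j). I \<in> T \<and> i \<in> I \<and> j \<in> I \<and> (i = j \<or> U I i v \<noteq> 0)}"
    by (rule finite_subset[rotated]) auto
  hence finF: "finite F" by (simp add: F_def)
  have linF: "linear f" if "f \<in> F" for f
  proof -
    obtain I i j where f: "I \<in> T" "f = G (I, i, j)" using \<open>f \<in> F\<close> by (auto simp: F_def)
    have "linear (U I i)" "linear (U I j)" using linU[OF f(1)] by auto
    thus ?thesis
      unfolding f(2) G_def by (auto intro!: linearI simp: linear_add linear_scale algebra_simps)
  qed
  have "\<exists>x\<in>L. f x \<noteq> 0" if "f \<in> F" for f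
  proof -
    obtain I i j where f: "I \<in> T" "i \<in> I" "j \<in> I" "i = j \<or> U I i v \<noteq> 0" "f = G (I, i, j)" 
      using \<open>f \<in> F\<close> by (auto simp: F_def)
    interpret B: basis_family V I by (rule basis[OF f(1)])
    \<comment> \<open>The value is 1 on the diagonal and minus the value of the i-th dual vector at
      v otherwise.\<close>
    have "f (V j) \<noteq> 0" using f B.dual_basis[OF f(3)] by (auto simp: G_def)
    thus ?thesis using edge f by blast
  qed
  then obtain y where y: "\<And>f. f \<in> F \<Longrightarrow> f y \<noteq> 0"
    using linear_avoid[OF finF linF _ L] by blast
  define C where "C = (\<Union>f\<in>F. (\<lambda>d. (d - cev f w) / of_real (f y)) ` rational_periods \<tau>)"
  have "countable C"
    unfolding C_def using finF countable_rational_periods by (intro countable_UN countable_image) (simp_all add: countable_finite)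
  have avoid: "cev f (w + cscale s y) \<notin> rational_periods \<tau>" if "s \<notin> C" "f \<in> F" for s f
  proof
    assume "cev f (w + cscale s y) \<in> rational_periods \<tau>"
    moreover have "s = (cev f (w + cscale s y) - cev f w) / of_real (f y)"
      using y[OF that(2)] by (simp add: cev_add cev_cscale linF[OF that(2)])
    ultimately show False using that unfolding C_def by blast
  qed
  have "generic_pt (w + cscale s y)" if s: "s \<notin> C" for s
    unfolding generic_pt_def
  proof (intro ballI impI conjI)
    fix I i assume I: "I \<in> T" "i \<in> I"
    have "G (I, i, i) \<in> F" unfolding F_def using I by blast
    from avoid[OF s this] show "cev (U I i) (w + cscale s y) \<notin> rational_periods \<tau>" 
      by (simp add: G_def)
    fix j assume j: "j \<in> I" "j \<noteq> i" "U I i v \<noteq> 0"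
    have "G (I, i, j) \<in> F" unfolding F_def using I j by blast
    moreover have "cev (G (I, i, j)) x = of_real (U I j v) * cev (U I i) x - of_real (U I i v) * cev (U I j) x" for x
      using j by (simp add: G_def cev_def algebra_simps)
    ultimately show "of_real (U I j v) * cev (U I i) (w + cscale s y) - of_real (U I i v) * cev (U I j) (w + cscale s y)
        \<notin> rational_periods \<tau>"
      using avoid[OF s] by metis
  qed
  hence "total (w + cscale 0 y) = 0"
    using countable_uncovered_zero[OF total_isCont[OF reg] \<open>countable C\<close>] total_generic_zero by blast
  thus ?thesis by simp
qed

end

section \<open>Simplicial multi-fans\<close>

locale edged_multifan =
  fixes \<Delta> :: "('i, 'a::euclidean_space) multifan" and V :: "'i \<Rightarrow> 'a"
  assumes multifan: "is_multifan \<Delta>" and full: "span (lattice_of \<Delta>) = UNIV"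
    and edges: "edge_vectors \<Delta> V"
begin

lemma rank_eq: "rank_of \<Delta> = DIM('a)"
  unfolding rank_of_def using full by (metis dim_UNIV dim_span)

lemma lattice_subgroup: "add_subgroup (lattice_of \<Delta>)"
  by (rule is_lattice_add_subgroup[OF multifan[unfolded is_multifan_def, THEN conjunct1]])

lemma simplexD:
  assumes "I \<in> simplices \<Delta>"
  shows "finite I" "card I \<le> rank_of \<Delta>" "dim (cone_of \<Delta> I) = card I"
    "cone_of \<Delta> I = convex_cone hull (\<Union>i\<in>I. cone_of \<Delta> {i})"
    "\<And>J. J \<subseteq> I \<Longrightarrow> J \<in> simplices \<Delta>"
proof -
  note m = multifan[unfolded is_multifan_def]
  note faces = bspec[OF m[THEN conjunct2, THEN conjunct2, THEN conjunct2, THEN conjunct1] assms]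
  note cones = bspec[OF m[THEN conjunct2, THEN conjunct2, THEN conjunct2, THEN conjunct2, 
        THEN conjunct2, THEN conjunct2] assms]
  show "finite I" "card I \<le> rank_of \<Delta>" "\<And>J. J \<subseteq> I \<Longrightarrow> J \<in> simplices \<Delta>"
    using faces by blast+
  show "dim (cone_of \<Delta> I) = card I"
    by (rule cones[THEN conjunct2, THEN conjunct1])
  show "cone_of \<Delta> I = convex_cone hull (\<Union>i\<in>I. cone_of \<Delta> {i})"
    by (rule cones[THEN conjunct2, THEN conjunct2, THEN conjunct1])
qed

lemma finite_simplices: "finite (simplices \<Delta>)"
  by (rule multifan[unfolded is_multifan_def, THEN conjunct2, THEN conjunct1])

lemma top_nonempty: "top_simplices \<Delta> \<noteq> {}"
  by (rule multifan[unfolded is_multifan_def, THEN conjunct2, THEN conjunct2, THEN conjunct2, 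
      THEN conjunct2, THEN conjunct1])

lemma topD: "I \<in> top_simplices \<Delta> \<Longrightarrow> I \<in> simplices \<Delta> \<and> card I = rank_of \<Delta>"
  by (simp add: top_simplices_def simplices_card_def)

lemma finite_top: "finite (top_simplices \<Delta>)"
  using finite_simplices by (simp add: top_simplices_def simplices_card_def)

lemma simplex_vertex: "I \<in> simplices \<Delta> \<Longrightarrow> i \<in> I \<Longrightarrow> i \<in> vertices \<Delta>"
  using simplexD(5)[of I "{i}"] by (simp add: vertices_def simplices_card_def)

lemma finite_vertices: "finite (vertices \<Delta>)"
proof -
  have "vertices \<Delta> \<subseteq> \<Union> (simplices \<Delta>)" by (auto simp: vertices_def simplices_card_def)
  moreover have "finite (\<Union> (simplices \<Delta>))" using finite_simplices simplexD(1) by blast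
  ultimately show ?thesis by (rule finite_subset)
qed

lemma vertexD:
  assumes "i \<in> vertices \<Delta>"
  shows "V i \<in> lattice_of \<Delta>" "cone_of \<Delta> {i} = convex_cone hull {V i}"
  using edges assms by (auto simp: edge_vectors_def)

lemma cone_subset:
  assumes I: "I \<in> simplices \<Delta>" and S: "convex_cone S" "V ` I \<subseteq> S"
  shows "cone_of \<Delta> I \<subseteq> S"
proof -
  have "cone_of \<Delta> {i} \<subseteq> S" if "i \<in> I" for i
    unfolding vertexD(2)[OF simplex_vertex[OF I that]]
    using that S by (intro hull_minimal) auto
  thus ?thesis
    unfolding simplexD(4)[OF I] using S(1) by (intro hull_minimal) auto
qed

lemma edge_in_cone:
  assumes "I \<in> simplices \<Delta>" "i \<in> I" "r \<ge> 0"
  shows "r *\<^sub>R V i \<in> cone_of \<Delta> I"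
proof -
  have "V i \<in> cone_of \<Delta> {i}"
    unfolding vertexD(2)[OF simplex_vertex[OF assms(1,2)]] by (simp add: hull_inc)
  hence "V i \<in> (\<Union>i\<in>I. cone_of \<Delta> {i})" using assms(2) by blast
  hence "V i \<in> cone_of \<Delta> I"
    unfolding simplexD(4)[OF assms(1)] by (rule hull_inc)
  moreover have "convex_cone (cone_of \<Delta> I)"
    by (subst simplexD(4)[OF assms(1)]) (rule convex_cone_convex_cone_hull)
  ultimately show ?thesis using assms(3) convex_cone_scaleR by blast
qed

lemma span_cone: "I \<in> simplices \<Delta> \<Longrightarrow> span (cone_of \<Delta> I) = span (V ` I)"
proof
  assume I: "I \<in> simplices \<Delta>"
  show "span (cone_of \<Delta> I) \<subseteq> span (V ` I)"
    using cone_subset[OF I convex_cone_span] by (intro span_minimal) (auto simp: span_superset)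
  have "V ` I \<subseteq> cone_of \<Delta> I"
    using edge_in_cone[OF I _ zero_le_one] by auto
  thus "span (V ` I) \<subseteq> span (cone_of \<Delta> I)" by (rule span_mono)
qed

text \<open>The cone has dimension n and is contained in the span of n edge vectors, which are
  therefore distinct and independent.\<close>

lemma top_basis_family:
  assumes I: "I \<in> top_simplices \<Delta>"
  shows "basis_family V I"
proof -
  have s: "I \<in> simplices \<Delta>" and cardI: "card I = DIM('a)"
    using topD[OF I] rank_eq by auto
  have finI: "finite I" by (rule simplexD[OF s])
  have d: "dim (V ` I) = DIM('a)"
    using simplexD(3)[OF s] span_cone[OF s] cardI by (metis dim_span)
  hence sp: "span (V ` I) = UNIV" using dim_eq_full by blast
  have "DIM('a) \<le> card (V ` I)"
    using dim_le_card[of "V ` I" "V ` I"] finI d span_superset by (metis finite_imageI)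
  hence "card (V ` I) = card I"
    using card_image_le[OF finI, of V] cardI by simp
  hence inj: "inj_on V I" by (rule eq_card_imp_inj_on[OF finI])
  have "independent (V ` I)"
    by (rule card_le_dim_spanning[of _ UNIV]) (use sp finI \<open>card (V ` I) = card I\<close> cardI in auto)
  thus ?thesis using finI inj sp by (intro basis_family.intro)
qed

text \<open>A common multiple of the orders of all local groups; as a product it inherits
  coprimality with N from its factors.\<close>

definition exponent :: nat where
  "exponent = (\<Prod>I\<in>top_simplices \<Delta>. card (local_group \<Delta> V I))"

lemma exponent_scale_mem:
  assumes I: "I \<in> top_simplices \<Delta>" and fin: "finite (local_group \<Delta> V I)" and l: "l \<in> lattice_of \<Delta>"
  shows "real exponent *\<^sub>R l \<in> edge_lattice V I"
proof -
  define h where "h = card (local_group \<Delta> V I)"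
  have sub: "add_subgroup (edge_lattice V I)"
    by (rule basis_family.edge_lattice_subgroup[OF top_basis_family[OF I]])
  have "real h *\<^sub>R l \<in> edge_lattice V I"
    using card_cosets_scale_mem[OF sub lattice_subgroup _ l] fin by (simp add: h_def local_group_eq)
  moreover have "h dvd exponent"
    unfolding exponent_def h_def using finite_top I by (intro dvd_prodI)
  hence "exponent = (exponent div h) * h" by simp
  ultimately show ?thesis
    using add_subgroup_nat_scale[OF sub, of "real h *\<^sub>R l" "exponent div h"]
    by (metis of_nat_mult scaleR_scaleR)
qed

text \<open>An infinite set has \<open>card\<close> equal to 0, which is not coprime to N > 1;
  finiteness is thus contained in the coprimality hypothesis.\<close>

lemma finite_local_group:
  assumes "N > 1" "\<forall>I\<in>top_simplices \<Delta>. coprime N (card (local_group \<Delta> V I))" "I \<in> top_simplices \<Delta>"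
  shows "finite (local_group \<Delta> V I)"
proof (rule card_ge_0_finite)
  show "card (local_group \<Delta> V I) > 0"
    using assms by (cases "card (local_group \<Delta> V I) = 0") auto
qed

text \<open>If \<open>e\<close> is the inner product with \<open>y\<close>, the quotient by the span of \<open>C(K)\<close> is the line \<open>\<real>y\<close>, and the
  claim compares the degrees of the projected multi-fan at \<open>y\<close> and \<open>-y\<close>.\<close>

lemma wall_crossing:
  assumes complete: "complete_multifan \<Delta>" and e: "linear e" and eK: "\<And>j. j \<in> K \<Longrightarrow> e (V j) = 0"
  shows "(\<Sum>i | i \<notin> K \<and> insert i K \<in> top_simplices \<Delta>.
     sgn (e (V i)) * of_int (weight \<Delta> (insert i K))) = (0::real)"
proof (cases "{i. i \<notin> K \<and> insert i K \<in> top_simplices \<Delta>} = {} \<or> (\<forall>x. e x = 0)")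
  case True
  thus ?thesis
  proof
    assume *: "{i. i \<notin> K \<and> insert i K \<in> top_simplices \<Delta>} = {}"
    show ?thesis unfolding * by simp
  qed simp
next
  case False
  define S where "S = {i. i \<notin> K \<and> insert i K \<in> top_simplices \<Delta>}"
  obtain i0 where i0: "i0 \<in> S" using False by (auto simp: S_def)
  have Ssimp: "insert i K \<in> simplices \<Delta>" if "i \<in> S" for i
    using that topD by (auto simp: S_def)
  have K: "K \<in> simplices \<Delta>"
    using simplexD(5)[OF Ssimp[OF i0]] by blast
  have finK: "finite K" by (rule simplexD(1)[OF K])
  have cardK: "Suc (card K) = rank_of \<Delta>"
    using i0 topD[of "insert i0 K"] finK by (auto simp: S_def)
  have finS: "finite S"
    by (rule finite_subset[OF _ finite_vertices]) (use simplex_vertex[OF Ssimp] in blast)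
  define y where "y = adjoint e 1"
  have ey: "e x = x \<bullet> y" for x
    using adjoint_works[OF e, of x 1] by (simp add: y_def)
  have y0: "y \<noteq> 0" using False ey by auto
  have dual_e: "e x = e (V i) * dual_vector V (insert i K) i x" if i: "i \<in> S" for i x
    using basis_family.dual_remove_unique[OF top_basis_family e, of "insert i K" i x] i eK
    by (auto simp: S_def)
  have eV: "e (V i) \<noteq> 0" if i: "i \<in> S" for i
  proof
    assume *: "e (V i) = 0"
    have "e x = 0" for x by (subst dual_e[OF i]) (simp add: *)
    thus False using False by blast
  qed
  define W where "W = span (cone_of \<Delta> K)"
  have W: "W = span (V ` K)" by (simp add: W_def span_cone[OF K])
  have eW: "e x = 0 \<longleftrightarrow> x \<in> W" for x
  proof
    assume "x \<in> W"
    thus "e x = 0" unfolding W by (rule linear_eq_0_on_span[OF e, rotated]) (use eK in auto)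
  next
    assume "e x = 0"
    interpret B: basis_family V "insert i0 K" using i0 top_basis_family by (simp add: S_def)
    have "B.dual i0 x = 0" using dual_e[OF i0, of x] eV[OF i0] \<open>e x = 0\<close> by simp
    hence "(\<Sum>i\<in>K. B.dual i x *\<^sub>R V i) = x"
      using B.dual_expansion[of x] finK i0 by (simp add: S_def)
    moreover have "(\<Sum>i\<in>K. B.dual i x *\<^sub>R V i) \<in> span (V ` K)"
      by (intro span_sum span_scale span_base) auto
    ultimately show "x \<in> W" by (simp add: W)
  qed
  define \<pi> where "\<pi> = quot_map W"
  have \<pi>: "\<pi> x = (e x / (y \<bullet> y)) *\<^sub>R y" for x
    unfolding \<pi>_def quot_map_def
  proof (rule the_equality)
    have "e (x - (e x / (y \<bullet> y)) *\<^sub>R y) = 0"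
      using y0 by (simp add: linear_diff[OF e] linear_scale[OF e] ey[of y])
    moreover have "(e x / (y \<bullet> y)) *\<^sub>R y \<in> orthogonal_comp W"
      using eW ey by (auto simp: orthogonal_comp_def orthogonal_def)
    ultimately show "(e x / (y \<bullet> y)) *\<^sub>R y \<in> orthogonal_comp W \<and> x - (e x / (y \<bullet> y)) *\<^sub>R y \<in> W"
      using eW by blast
    fix z assume z: "z \<in> orthogonal_comp W \<and> x - z \<in> W"
    define z' where "z' = z - (e x / (y \<bullet> y)) *\<^sub>R y"
    have "e z = e x" using z eW[of "x - z"] by (simp add: linear_diff[OF e])
    hence "e z' = 0" using y0 by (simp add: z'_def linear_diff[OF e] linear_scale[OF e] ey[of y])
    hence z'W: "z' \<in> W" using eW by blast
    hence "z' \<bullet> z = 0" using z by (auto simp: orthogonal_comp_def orthogonal_def)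
    moreover have "z' \<bullet> y = 0" using \<open>e z' = 0\<close> ey by simp
    ultimately have "z' \<bullet> z' = 0" by (subst (2) z'_def) (simp add: inner_diff_right)
    thus "z = (e x / (y \<bullet> y)) *\<^sub>R y" by (simp add: z'_def)
  qed
  define P where "P = projected \<Delta> K"
  have P: "lattice_of P = \<pi> ` lattice_of \<Delta>" "simplices P = {J - K | J. J \<in> simplices \<Delta> \<and> K \<subseteq> J}"
    "cone_of P J = \<pi> ` cone_of \<Delta> (J \<union> K)" "weight P J = weight \<Delta> (J \<union> K)" for J
    by (simp_all add: P_def projected_def Let_def \<pi>_def W_def weight_def)
  have spanP: "span (lattice_of P) = span {y}"
  proof
    show "span (lattice_of P) \<subseteq> span {y}"
      by (intro span_minimal) (auto simp: P \<pi> intro: span_scale span_base)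
    have "\<exists>l\<in>lattice_of \<Delta>. e l \<noteq> 0"
    proof (rule ccontr)
      assume *: "\<not> (\<exists>l\<in>lattice_of \<Delta>. e l \<noteq> 0)"
      hence "e x = 0" if "x \<in> span (lattice_of \<Delta>)" for x
        using * by (intro linear_eq_0_on_span[OF e _ that]) blast
      thus False using False full by auto
    qed
    then obtain l where l: "l \<in> lattice_of \<Delta>" "e l \<noteq> 0" by blast
    have "y = ((y \<bullet> y) / e l) *\<^sub>R \<pi> l" using l y0 by (simp add: \<pi>)
    moreover have "\<pi> l \<in> lattice_of P" using l by (simp add: P)
    ultimately have "y \<in> span (lattice_of P)" by (metis span_base span_scale)
    thus "span {y} \<subseteq> span (lattice_of P)" by (intro span_minimal) auto
  qed
  have rankP: "rank_of P = 1"
    unfolding rank_of_def using spanP y0 by (metis dim_span dim_singleton One_nat_def)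
  have topP: "top_simplices P = (\<lambda>i. {i}) ` S"
  proof (intro equalityI subsetI)
    fix J' assume "J' \<in> top_simplices P"
    then obtain J where J: "J \<in> simplices \<Delta>" "K \<subseteq> J" "J' = J - K" "card (J - K) = 1"
      by (auto simp: top_simplices_def simplices_card_def rankP P)
    then obtain i where i: "J - K = {i}" by (auto simp: card_1_singleton_iff)
    hence "J = insert i K" "i \<notin> K" using J(2) by auto
    moreover have "card (insert i K) = rank_of \<Delta>" using \<open>i \<notin> K\<close> finK cardK by simp
    ultimately have "i \<in> S" using J(1) by (simp add: S_def top_simplices_def simplices_card_def)
    thus "J' \<in> (\<lambda>i. {i}) ` S" using J i by blast
  next
    fix J' assume "J' \<in> (\<lambda>i. {i}) ` S"
    then obtain i where i: "i \<in> S" "J' = {i}" by blast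
    have "J' = insert i K - K" "card J' = 1" using i by (auto simp: S_def)
    thus "J' \<in> top_simplices P"
      using Ssimp[OF i(1)] unfolding top_simplices_def simplices_card_def rankP P by blast
  qed
  \<comment> \<open>In the rank one quotient the cone of {i} is a ray, and the sign of e(v_i)
    decides on which side of 0 it lies.\<close>
  have cone_iff: "x \<in> cone_of P {i} \<longleftrightarrow> 0 < e (V i) * s" if i: "i \<in> S" and x: "x = s *\<^sub>R y" "s \<noteq> 0" for i x s
  proof
    assume "x \<in> cone_of P {i}"
    then obtain p where p: "p \<in> cone_of \<Delta> (insert i K)" "x = \<pi> p" by (auto simp: P)
    have "cone_of \<Delta> (insert i K) \<subseteq> {x. (- e (V i) *\<^sub>R y) \<bullet> x \<le> 0}"
    proof (rule cone_subset[OF Ssimp[OF i] convex_cone_halfspace_le])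
      show "V ` insert i K \<subseteq> {x. (- e (V i) *\<^sub>R y) \<bullet> x \<le> 0}"
        using eK by (auto simp: inner_commute[of y] simp flip: ey)
    qed
    hence "0 \<le> e (V i) * e p" using p(1) by (auto simp: ey inner_commute[of y])
    moreover have "s = e p / (y \<bullet> y)" using p(2) x y0 by (simp add: \<pi>)
    hence "e p = s * (y \<bullet> y)" using y0 by simp
    ultimately have "0 \<le> (e (V i) * s) * (y \<bullet> y)" by (simp add: mult_ac)
    moreover have "0 < y \<bullet> y" using y0 by simp
    ultimately have "0 \<le> e (V i) * s" by (meson mult_neg_pos not_le)
    moreover have "e (V i) * s \<noteq> 0" using eV[OF i] x(2) by simp
    ultimately show "0 < e (V i) * s" by linarith
  next
    assume *: "0 < e (V i) * s"
    \<comment> \<open>Solved from the condition that the projection of r v_i be s y.\<close>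
    define r where "r = s * (y \<bullet> y) / e (V i)"
    have "r = (e (V i) * s) * (y \<bullet> y) / (e (V i))\<^sup>2"
      using eV[OF i] by (simp add: r_def power2_eq_square)
    hence "r \<ge> 0" using * by simp
    hence "r *\<^sub>R V i \<in> cone_of \<Delta> (insert i K)" using edge_in_cone[OF Ssimp[OF i]] by blast
    moreover have "x = \<pi> (r *\<^sub>R V i)"
      using eV[OF i] y0 x(1) by (simp add: \<pi> r_def linear_scale[OF e])
    ultimately show "x \<in> cone_of P {i}" by (simp add: P)
  qed
  have generic: "generic P (s *\<^sub>R y)" if s: "s \<noteq> 0" for s
    unfolding generic_def
  proof (intro conjI ballI impI notI)
    show "s *\<^sub>R y \<in> span (lattice_of P)" by (simp add: spanP span_scale span_base)
    fix J assume J: "dim (cone_of P J) < rank_of P" "s *\<^sub>R y \<in> span (cone_of P J)"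
    hence "dim (span (cone_of P J)) = 0" by (simp add: rankP)
    hence "span (cone_of P J) \<subseteq> {0}" using dim_eq_0 by blast
    thus False using J(2) s y0 by auto
  qed
  have degree: "degree_at P (s *\<^sub>R y) = (\<Sum>i | i \<in> S \<and> 0 < e (V i) * s. weight \<Delta> (insert i K))" if s: "s \<noteq> 0" for s
  proof -
    have "{J \<in> top_simplices P. s *\<^sub>R y \<in> cone_of P J} = (\<lambda>i. {i}) ` {i \<in> S. 0 < e (V i) * s}"
      using cone_iff[OF _ refl s] by (auto simp: topP)
    thus ?thesis
      unfolding degree_at_def by (simp add: sum.reindex inj_on_def P)
  qed
  have "pre_complete P" using complete K by (simp add: complete_multifan_def P_def)
  hence "degree_at P (1 *\<^sub>R y) = degree_at P ((- 1) *\<^sub>R y)"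
    using generic[of 1] generic[of "- 1"] unfolding pre_complete_def by (metis one_neq_neg_one zero_neq_neg_one zero_neq_one)
  hence eq: "(\<Sum>i | i \<in> S \<and> 0 < e (V i). weight \<Delta> (insert i K)) = (\<Sum>i | i \<in> S \<and> e (V i) < 0. weight \<Delta> (insert i K))"
    using degree[of 1] degree[of "- 1"] by simp
  have "(\<Sum>i\<in>S. sgn (e (V i)) * real_of_int (weight \<Delta> (insert i K))) =
     (\<Sum>i\<in>S. (if 0 < e (V i) then of_int (weight \<Delta> (insert i K)) else 0) 
       - (if e (V i) < 0 then of_int (weight \<Delta> (insert i K)) else 0))"
    by (intro sum.cong) (auto simp: sgn_real_def)
  also have "\<dots> = of_int (\<Sum>i | i \<in> S \<and> 0 < e (V i). weight \<Delta> (insert i K)) - 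
       of_int (\<Sum>i | i \<in> S \<and> e (V i) < 0. weight \<Delta> (insert i K))"
    using finS by (simp add: sum_subtractf sum.inter_filter if_distrib[of real_of_int] cong: if_cong)
  also have "\<dots> = 0" unfolding eq by simp
  finally show ?thesis by (simp only: S_def mem_Collect_eq)
qed

end

section \<open>The character of the first Chern class\<close>

text \<open>\<open>breve\<close> chooses some fraction s/r for f. Comparison with g/M gives M s = r
  g, and multiplication by the inverses of r and M modulo N identifies d' s with d g.\<close>

lemma breve_cong:
  fixes N M :: nat and d g :: int
  assumes N: "N > 1" and M: "coprime M N" and d: "[d * int M = 1] (mod int N)"
    and g: "real M * f = of_int g"
  shows "[breve N f = d * g] (mod int N)"
proof -
  define Q where "Q m \<longleftrightarrow> (\<exists>s r d :: int. r \<noteq> 0 \<and> coprime r (int N) \<and> f = of_int s / of_int r \<and>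
                [d * r = 1] (mod int N) \<and> m = d * s)" for m
  have "M \<noteq> 0" using M N by (cases "M = 0") auto
  hence "f = of_int g / of_int (int M)" using g by (simp add: field_simps)
  hence "Q (d * g)"
    unfolding Q_def using d M \<open>M \<noteq> 0\<close> by (intro exI[of _ g] exI[of _ "int M"] exI[of _ d]) simp
  hence "Q (breve N f)" unfolding breve_def Q_def[symmetric] by (rule someI)
  then obtain s r d' where r: "r \<noteq> 0" "f = of_int s / of_int r" "[d' * r = 1] (mod int N)" "breve N f = d' * s"
    by (auto simp: Q_def)
  have "of_int s = f * of_int r" using r(1,2) by simp
  hence "of_int (int M * s) = (of_int (r * g) :: real)"
    by (simp add: g[symmetric])
  hence Ms: "int M * s = r * g" by (metis of_int_eq_iff)
  have "[breve N f * (d * int M) = breve N f * 1] (mod int N)"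
    by (intro cong_mult cong_refl d)
  moreover have "breve N f * (d * int M) = (d' * r) * (d * g)"
    using Ms by (simp add: r(4)) (metis mult.assoc mult.commute)
  moreover have "[(d' * r) * (d * g) = 1 * (d * g)] (mod int N)"
    by (intro cong_mult cong_refl r(3))
  ultimately show ?thesis by (metis cong_sym cong_trans mult.right_neutral mult_1)
qed

lemma e2pi_level_cong:
  assumes "N > 0" "[a = b] (mod int N)"
  shows "e2pi (of_int a * (of_nat k / of_nat N)) = e2pi (of_int b * (of_nat k / of_nat N))"
proof -
  obtain j where "b = a + int N * j" using assms(2) unfolding cong_iff_lin by blast
  hence j: "a = b - int N * j" by simp
  have "of_int a * (of_nat k / of_nat N) - of_int b * (of_nat k / of_nat N) = (of_int (- j * int k) :: complex)"
    using assms(1) by (simp add: j field_simps)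
  thus ?thesis by (metis e2pi_eq_iff Ints_of_int)
qed

context edged_multifan
begin

text \<open>Comparison of the coefficients of x_i; integrality of u on the lattice removes the floor
  in \<open>dual_embedding\<close>.\<close>

lemma c1_divisible_congruence:
  assumes "c1_divisible \<Delta> V N"
  obtains u x where "linear u" "u ` lattice_of \<Delta> \<subseteq> \<int>"
    "\<And>i. i \<in> vertices \<Delta> \<Longrightarrow> u (V i) + real N * of_int (x i) = 1"
proof -
  obtain y u where y: "u \<in> dual_lattice (lattice_of \<Delta>)"
    "equivariant_c1 \<Delta> = frag_cmul (int N) y + dual_embedding \<Delta> V u"
    using assms unfolding c1_divisible_def by blast
  have u: "linear u" "u ` lattice_of \<Delta> \<subseteq> \<int>" using y(1) by (auto simp: dual_lattice_def)
  have lk: "Poly_Mapping.lookup (\<Sum>j\<in>vertices \<Delta>. frag_cmul (a j) (frag_of j)) i = a i" 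
    if "i \<in> vertices \<Delta>" for a i
    using that finite_vertices by (simp add: lookup_sum if_distrib[of "(*) _"] cong: if_cong)
  have "u (V i) + real N * of_int (Poly_Mapping.lookup y i) = 1" if i: "i \<in> vertices \<Delta>" for i
  proof -
    have "u (V i) \<in> \<int>" using u(2) vertexD(1)[OF i] by blast
    hence f: "of_int \<lfloor>u (V i)\<rfloor> = u (V i)" by (auto elim: Ints_cases)
    have "Poly_Mapping.lookup (equivariant_c1 \<Delta>) i = 1"
      using lk[OF i, of "\<lambda>_. 1"] by (simp add: equivariant_c1_def)
    moreover have "Poly_Mapping.lookup (frag_cmul (int N) y + dual_embedding \<Delta> V u) i
       = int N * Poly_Mapping.lookup y i + \<lfloor>u (V i)\<rfloor>"
      using lk[OF i] by (simp add: dual_embedding_def lookup_add)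
    ultimately have "int N * Poly_Mapping.lookup y i + \<lfloor>u (V i)\<rfloor> = 1" using y(2) by simp
    hence "real N * of_int (Poly_Mapping.lookup y i) + of_int \<lfloor>u (V i)\<rfloor> = 1"
      by (metis of_int_1 of_int_add of_int_mult of_int_of_nat_eq)
    thus ?thesis using f by simp
  qed
  thus thesis using that u by blast
qed

text \<open>With \<open>M = \<Prod>|H\<^sub>I|\<close> and \<open>d M \<equiv> 1\<close> modulo \<open>N\<close>, the integer attached to \<open>f \<in> (1/M) \<int>\<close> is \<open>d M f\<close>
  modulo \<open>N\<close>, so its use as an exponent of \<open>\<zeta>\<close> amounts to replacing \<open>k/N\<close> by \<open>s = k d M / N\<close>. One takes
  \<open>c = s u\<close> where \<open>u(v\<^sub>i) \<equiv> 1\<close> modulo \<open>N\<close> for all \<open>i\<close>.\<close>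

lemma level_character:
  assumes N: "N > 1" and cop: "\<forall>I\<in>top_simplices \<Delta>. coprime N (card (local_group \<Delta> V I))"
    and div: "c1_divisible \<Delta> V N" and k: "0 < k" "k < N"
  obtains c v where "linear c"
    "\<And>I i. I \<in> top_simplices \<Delta> \<Longrightarrow> i \<in> I \<Longrightarrow> e2pi (of_real (c (V i))) = e2pi (of_nat k / of_nat N)"
    "\<And>I. I \<in> top_simplices \<Delta> \<Longrightarrow> v \<in> edge_lattice V I" "e2pi (of_real (c v)) \<noteq> 1"
    "\<And>I l. I \<in> top_simplices \<Delta> \<Longrightarrow> l \<in> lattice_of \<Delta> \<Longrightarrow>
       (\<Prod>i\<in>I. e2pi (of_nat k / of_nat N) powi breve N (dual_vector V I i l)) = e2pi (of_real (c l))"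
proof -
  define L where "L = lattice_of \<Delta>"
  define M where "M = exponent"
  have M: "coprime M N"
    unfolding M_def exponent_def using cop by (intro prod_coprime_left) (simp add: coprime_commute)
  have scaleM: "real M *\<^sub>R l \<in> edge_lattice V I" if "I \<in> top_simplices \<Delta>" "l \<in> L" for I l
    using exponent_scale_mem[OF that(1) finite_local_group[OF N cop that(1)]] that(2) by (simp add: M_def L_def)
  obtain u x where u: "linear u" "u ` L \<subseteq> \<int>"
    and ux: "\<And>i. i \<in> vertices \<Delta> \<Longrightarrow> u (V i) + real N * of_int (x i) = 1"
    using c1_divisible_congruence[OF div] unfolding L_def by blast
  have "coprime (int M) (int N)" using M by simp
  then obtain d where d: "[int M * d = 1] (mod int N)" using cong_solve_coprime_int by blast
  then obtain b' where "1 = int M * d + int N * b'" unfolding cong_iff_lin by blast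
  hence "d * int M = 1 + int N * (- b')"
    by (simp add: algebra_simps)
  then obtain b where b: "d * int M = 1 + int N * b" by blast
  have N0: "real N \<noteq> 0" using N by simp
  define s where "s = real k * of_int d * real M / real N"
  have sN: "s * real N = of_int (int k * d * int M)" using N0 by (simp add: s_def)
  \<comment> \<open>Both forms of s are used: modulo integers it is k/N, so s gives \<zeta>, while s
    N = k d M clears the denominators of the dual vectors.\<close>
  have s: "s = real k / real N + of_int (int k * b)"
  proof -
    have "of_int d * real M = 1 + real N * of_int b"
      using b by (metis of_int_1 of_int_add of_int_mult of_int_of_nat_eq)
    hence "s = real k * (1 + real N * of_int b) / real N" by (simp add: s_def mult.assoc)
    thus ?thesis using N0 by (simp add: field_simps)
  qed
  define c where "c = (\<lambda>l. s * u l)"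
  have linc: "linear c"
    unfolding c_def using u(1) by (auto intro!: linearI simp: linear_add linear_scale algebra_simps)
  have cV: "e2pi (of_real (c (V i))) = e2pi (of_nat k / of_nat N)" if i: "i \<in> vertices \<Delta>" for i
  proof -
    have "c (V i) = s - (s * real N) * of_int (x i)"
      using ux[OF i] by (simp add: c_def) (metis add_diff_cancel_right' mult.assoc mult.right_neutral right_diff_distrib)
    also have "\<dots> = real k / real N + of_int (int k * b - int k * d * int M * x i)"
      unfolding sN by (subst s) simp
    finally have "complex_of_real (c (V i)) - of_nat k / of_nat N = of_int (int k * b - int k * d * int M * x i)"
      by simp
    thus ?thesis by (metis e2pi_eq_iff Ints_of_int)
  qed
  obtain I0 where I0: "I0 \<in> top_simplices \<Delta>"
    using top_nonempty by blast
  have "card I0 \<noteq> 0" using topD[OF I0] rank_eq by simp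
  then obtain i0 where "i0 \<in> I0" by fastforce
  hence i0: "i0 \<in> vertices \<Delta>" using simplex_vertex topD[OF I0] by blast
  \<comment> \<open>The factor M puts v into every edge lattice. Modulo integers c(v) is M k/N, and
    N divides M k only if it divides k.\<close>
  define v where "v = real M *\<^sub>R V i0"
  have "e2pi (of_real (c v)) \<noteq> 1"
  proof
    assume "e2pi (of_real (c v)) = 1"
    moreover have "e2pi (of_real (c v)) = e2pi (of_real (c (V i0))) ^ M"
      by (simp add: v_def linear_scale[OF linc] e2pi_power)
    ultimately have "e2pi (of_nat M * (of_nat k / of_nat N)) = 1"
      by (simp add: cV[OF i0] e2pi_power)
    then obtain j where "of_nat M * (of_nat k / of_nat N) = (of_int j :: complex)"
      by (auto simp: e2pi_eq_1_iff elim: Ints_cases)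
    hence "(of_int (int (M * k)) :: complex) = of_int (j * int N)" using N0 by (simp add: field_simps)
    hence "int (M * k) = j * int N" by (simp only: of_int_eq_iff)
    hence "int N dvd int (M * k)" by simp
    hence "N dvd M * k" by (simp only: int_dvd_int_iff)
    hence "N dvd k" using M by (simp add: coprime_commute coprime_dvd_mult_right_iff)
    thus False using k by (simp add: nat_dvd_not_less)
  qed
  moreover have "v \<in> edge_lattice V I" if "I \<in> top_simplices \<Delta>" for I
    unfolding v_def using scaleM[OF that] vertexD(1)[OF i0] by (simp add: L_def)
  moreover have "(\<Prod>i\<in>I. e2pi (of_nat k / of_nat N) powi breve N (dual_vector V I i l)) = e2pi (of_real (c l))"
    if I: "I \<in> top_simplices \<Delta>" and l: "l \<in> lattice_of \<Delta>" for I l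
  proof -
    interpret B: basis_family V I by (rule top_basis_family[OF I])
    define g where "g i = \<lfloor>real M * B.dual i l\<rfloor>" for i
    have g: "real M * B.dual i l = of_int (g i)" if i: "i \<in> I" for i
    proof -
      have "real M * B.dual i l \<in> \<int>"
        using scaleM[OF I] l i B.edge_lattice_iff by (simp add: L_def linear_scale[OF B.linear_dual])
      thus ?thesis by (auto simp: g_def elim: Ints_cases)
    qed
    have "e2pi (of_nat k / of_nat N) powi breve N (B.dual i l) = e2pi (of_real (s * B.dual i l))" 
      if i: "i \<in> I" for i
    proof -
      have "[breve N (B.dual i l) = d * g i] (mod int N)"
        using breve_cong[OF N M _ g[OF i]] d by (simp add: mult.commute)
      hence "e2pi (of_nat k / of_nat N) powi breve N (B.dual i l) = e2pi (of_int (d * g i) * (of_nat k / of_nat N))"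
        unfolding e2pi_powi using N by (intro e2pi_level_cong) auto
      also have "of_int (d * g i) * (of_nat k / of_nat N) = complex_of_real (of_int d * of_int (g i) * (real k / real N))"
        by simp
      also have "of_int d * of_int (g i) * (real k / real N) = s * B.dual i l"
        unfolding g[OF i, symmetric] by (simp add: s_def)
      finally show ?thesis .
    qed
    hence "(\<Prod>i\<in>I. e2pi (of_nat k / of_nat N) powi breve N (B.dual i l)) = e2pi (of_real (\<Sum>i\<in>I. s * B.dual i l))"
      by (simp add: e2pi_sum)
    \<comment> \<open>The i-th term of the difference contains 1 - u(v_i) = N x_i, and s N times the
      dual vector of i at l is the integer k d g_i.\<close>
    moreover have "(\<Sum>i\<in>I. s * B.dual i l) - c l = of_int (\<Sum>i\<in>I. int k * d * g i * x i)"
    proof -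
      have vert: "i \<in> vertices \<Delta>" if "i \<in> I" for i using simplex_vertex topD[OF I] that by blast
      have "(\<Sum>i\<in>I. s * B.dual i l) - c l = (\<Sum>i\<in>I. s * B.dual i l * (1 - u (V i)))"
        unfolding c_def B.linear_dual_expansion[OF u(1), of l]
        by (simp add: sum_distrib_left sum_subtractf algebra_simps)
      also have "\<dots> = (\<Sum>i\<in>I. of_int (int k * d * g i * x i))"
      proof (intro sum.cong refl)
        fix i assume i: "i \<in> I"
        have "1 - u (V i) = real N * of_int (x i)" using ux[OF vert[OF i]] by simp
        hence "s * B.dual i l * (1 - u (V i)) = (s * real N) * B.dual i l * of_int (x i)" by simp
        also have "\<dots> = of_int (int k * d) * (real M * B.dual i l) * of_int (x i)" by (simp add: sN)
        finally show "s * B.dual i l * (1 - u (V i)) = of_int (int k * d * g i * x i)" by (simp add: g[OF i])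
      qed
      finally show ?thesis by simp
    qed
    hence "complex_of_real (\<Sum>i\<in>I. s * B.dual i l) - of_real (c l) = of_int (\<Sum>i\<in>I. int k * d * g i * x i)"
      by (simp only: of_real_diff[symmetric] of_real_of_int_eq)
    hence "e2pi (of_real (\<Sum>i\<in>I. s * B.dual i l)) = e2pi (of_real (c l))"
      by (metis e2pi_eq_iff Ints_of_int)
    ultimately show ?thesis by simp
  qed
  moreover have "e2pi (of_real (c (V i))) = e2pi (of_nat k / of_nat N)" 
    if "I \<in> top_simplices \<Delta>" "i \<in> I" for I i
    using cV simplex_vertex topD that by blast
  ultimately show thesis by (intro that[OF linc])
qed

end

section \<open>Formal power series of characters\<close>

lemma uncountable_upper_half_plane:
  assumes "countable C"
  obtains \<tau> where "Im \<tau> > B" "\<tau> \<notin> C"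
proof -
  have "ball (\<i> * of_real (B + 1)) 1 \<subseteq> {\<tau>. Im \<tau> > B}"
  proof
    fix \<tau> assume "\<tau> \<in> ball (\<i> * of_real (B + 1)) 1"
    hence "\<bar>Im (\<i> * of_real (B + 1) - \<tau>)\<bar> < 1"
      using abs_Im_le_cmod[of "\<i> * of_real (B + 1) - \<tau>"] by (simp add: dist_norm)
    thus "\<tau> \<in> {\<tau>. Im \<tau> > B}" by auto
  qed
  hence "\<not> {\<tau>. Im \<tau> > B} \<subseteq> C"
    using assms uncountable_ball[of 1 "\<i> * of_real (B + 1)"] countable_subset by (metis subset_trans zero_less_one)
  thus thesis using that by blast
qed

text \<open>The zeros of a nonzero power series are isolated, and a large imaginary part of \<tau>
  brings q as close to 0 as desired. C makes room for the values of \<tau> at which the genus is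
  singular.\<close>

lemma nome_series_zero:
  fixes a :: "nat \<Rightarrow> complex"
  assumes C: "countable C" 
    and sums: "\<And>\<tau>. Im \<tau> > B \<Longrightarrow> \<tau> \<notin> C \<Longrightarrow> (\<lambda>m. a m * e2pi \<tau> ^ m) sums 0"
  shows "a m = 0"
proof (rule ccontr)
  assume am: "a m \<noteq> 0"
  obtain \<tau>0 where \<tau>0: "Im \<tau>0 > B" "\<tau>0 \<notin> C" by (rule uncountable_upper_half_plane[OF C])
  define r where "r = norm (e2pi \<tau>0)"
  have r: "r > 0" by (simp add: r_def)
  \<comment> \<open>The extra factor q makes the function vanish at the origin, as
    \<open>powser_0_nonzero\<close> demands, even if the constant coefficient of the series is
    nonzero.\<close>
  define b where "b n = (case n of 0 \<Rightarrow> 0 | Suc n \<Rightarrow> a n)" for n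
  define f where "f q = q * suminf (\<lambda>n. a n * q ^ n)" for q
  have f: "(\<lambda>n. b n * (q - 0) ^ n) sums f q" if "norm (q - 0) < r" for q
  proof -
    have "summable (\<lambda>n. a n * q ^ n)"
      using powser_inside[OF sums_summable[OF sums[OF \<tau>0]], of q] that by (simp add: r_def)
    hence "(\<lambda>n. q * (a n * q ^ n)) sums f q"
      unfolding f_def by (intro sums_mult summable_sums)
    hence "(\<lambda>n. b (Suc n) * q ^ Suc n) sums f q"
      by (simp add: b_def mult_ac)
    thus ?thesis using sums_Suc[of "\<lambda>n. b n * q ^ n" "f q"] by (simp add: b_def)
  qed
  obtain s where s: "s > 0" "\<And>q. q \<in> cball 0 s - {0} \<Longrightarrow> f q \<noteq> 0"
    by (rule powser_0_nonzero[OF r f, of "Suc m"]) (use am in \<open>auto simp: f_def b_def\<close>)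
  \<comment> \<open>The second bound ensures |q| = exp (-2 pi Im \<tau>) < s.\<close>
  define B' where "B' = max B (- ln s / (2 * pi))"
  obtain \<tau> where \<tau>: "Im \<tau> > B'" "\<tau> \<notin> C" by (rule uncountable_upper_half_plane[OF C])
  have "- 2 * pi * Im \<tau> < ln s" using \<tau>(1) by (simp add: B'_def field_simps)
  hence "norm (e2pi \<tau>) < s" using s(1) by (metis norm_e2pi exp_less_cancel_iff exp_ln)
  hence "f (e2pi \<tau>) \<noteq> 0" by (intro s) auto
  moreover have "suminf (\<lambda>n. a n * e2pi \<tau> ^ n) = 0"
    using sums[of \<tau>] \<tau> by (auto simp: B'_def intro: sums_unique[symmetric])
  ultimately show False by (simp add: f_def)
qed

text \<open>After division by the dominant exponential, the one with the least r, all other terms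
  tend to 0. One zero coefficient suffices later, since the keys of a finitely supported map carry
  nonzero coefficients.\<close>

lemma exponential_sum_coeff_zero:
  fixes a :: "'b \<Rightarrow> complex" and r :: "'b \<Rightarrow> real"
  assumes A: "finite A" "A \<noteq> {}" and inj: "inj_on r A"
    and zero: "\<And>t::real. t > 0 \<Longrightarrow> (\<Sum>u\<in>A. a u * of_real (exp (- r u * t))) = 0"
  shows "\<exists>u\<in>A. a u = 0"
proof -
  obtain u0 where u0: "u0 \<in> A" "\<And>u. u \<in> A \<Longrightarrow> r u0 \<le> r u"
    using A ex_min_if_finite[of "r ` A"] by (metis (no_types, lifting) finite_imageI image_is_empty imageE imageI linorder_not_less)
  have lim: "((\<lambda>t. a u * of_real (exp (- (r u - r u0) * t))) \<longlongrightarrow> (if u = u0 then a u else 0)) at_top" 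
    if u: "u \<in> A" for u
  proof (cases "u = u0")
    case False
    hence "r u - r u0 > 0" using u0 u inj by (metis diff_gt_0_iff_gt inj_onD order_le_less)
    hence "((\<lambda>t. exp (- (r u - r u0) * t)) \<longlongrightarrow> 0) at_top"
      by real_asymp
    hence "((\<lambda>t. a u * of_real (exp (- (r u - r u0) * t))) \<longlongrightarrow> a u * of_real 0) at_top"
      by (intro tendsto_intros)
    thus ?thesis using False by simp
  qed simp
  have "((\<lambda>t. \<Sum>u\<in>A. a u * of_real (exp (- (r u - r u0) * t))) \<longlongrightarrow> (\<Sum>u\<in>A. if u = u0 then a u else 0)) at_top"
    by (intro tendsto_sum lim)
  moreover have "eventually (\<lambda>t. (\<Sum>u\<in>A. a u * of_real (exp (- (r u - r u0) * t))) = 0) at_top"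
    using eventually_gt_at_top[of 0]
  proof eventually_elim
    case (elim t)
    have "(\<Sum>u\<in>A. a u * of_real (exp (- (r u - r u0) * t))) = 
        of_real (exp (r u0 * t)) * (\<Sum>u\<in>A. a u * of_real (exp (- r u * t)))"
      unfolding sum_distrib_left by (intro sum.cong refl) (simp add: algebra_simps flip: exp_add of_real_mult)
    thus ?case using zero[OF elim] by simp
  qed
  ultimately have "(\<Sum>u\<in>A. if u = u0 then a u else 0) = 0"
    using tendsto_unique[OF trivial_limit_at_top_linorder] tendsto_eventually by fast
  thus ?thesis using A(1) u0(1) by auto
qed

section \<open>The genus of a multi-fan with divisible first Chern class\<close>

locale divisible_multifan = edged_multifan \<Delta> V
  for \<Delta> :: "('i, 'a::euclidean_space) multifan" and V :: "'i \<Rightarrow> 'a" +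
  fixes N k :: nat
  assumes complete: "complete_multifan \<Delta>" and N: "N > 1"
    and cop: "\<forall>I\<in>top_simplices \<Delta>. coprime N (card (local_group \<Delta> V I))"
    and div: "c1_divisible \<Delta> V N" and k: "0 < k" "k < N"
begin

lemma balanced_fan_exists:
  obtains c v where
    "\<And>\<tau>. Im \<tau> > 0 \<Longrightarrow> balanced_fan (lattice_of \<Delta>) (top_simplices \<Delta>) V (weight \<Delta>) \<tau> (of_nat k / of_nat N) c v"
    "\<And>I l. I \<in> top_simplices \<Delta> \<Longrightarrow> l \<in> lattice_of \<Delta> \<Longrightarrow>
       (\<Prod>i\<in>I. e2pi (of_nat k / of_nat N) powi breve N (dual_vector V I i l)) = e2pi (of_real (c l))"
proof -
  obtain c v where c: "linear c"
    "\<And>I i. I \<in> top_simplices \<Delta> \<Longrightarrow> i \<in> I \<Longrightarrow> e2pi (of_real (c (V i))) = e2pi (of_nat k / of_nat N)"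
    "\<And>I. I \<in> top_simplices \<Delta> \<Longrightarrow> v \<in> edge_lattice V I" "e2pi (of_real (c v)) \<noteq> 1"
    and prod: "\<And>I l. I \<in> top_simplices \<Delta> \<Longrightarrow> l \<in> lattice_of \<Delta> \<Longrightarrow>
       (\<Prod>i\<in>I. e2pi (of_nat k / of_nat N) powi breve N (dual_vector V I i l)) = e2pi (of_real (c l))"
    by (rule level_character[OF N cop div k]) (rule that; assumption | blast)
  have "balanced_fan (lattice_of \<Delta>) (top_simplices \<Delta>) V (weight \<Delta>) \<tau> (of_nat k / of_nat N) c v"
    if \<tau>: "Im \<tau> > 0" for \<tau>
  proof (rule balanced_fan.intro)
    show "finite (cosets (lattice_of \<Delta>) (edge_lattice V I))" if "I \<in> top_simplices \<Delta>" for I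
      using finite_local_group[OF N cop that] by (simp add: local_group_eq)
    show "V i \<in> lattice_of \<Delta>" if "I \<in> top_simplices \<Delta>" "i \<in> I" for I i
      using that topD simplex_vertex vertexD(1) by blast
  qed (fact c \<tau> lattice_subgroup finite_top top_basis_family wall_crossing[OF complete])+
  thus thesis using that prod by blast
qed

lemma dual_vector_rational:
  assumes "I \<in> top_simplices \<Delta>" "i \<in> I" "l \<in> lattice_of \<Delta>"
  shows "dual_vector V I i l \<in> \<rat>"
proof -
  \<comment> \<open>Any \<tau> in the upper half plane would do here, as the dual vectors do not
    involve it.\<close>
  obtain c v where "balanced_fan (lattice_of \<Delta>) (top_simplices \<Delta>) V (weight \<Delta>) \<i> (of_nat k / of_nat N) c v"
    using balanced_fan_exists by (metis imaginary_unit.simps(2) zero_less_one)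
  thus ?thesis using assms by (rule balanced_fan.U_rational)
qed

lemma local_rep: "I \<in> top_simplices \<Delta> \<Longrightarrow> h \<in> local_group \<Delta> V I \<Longrightarrow> coset_rep h \<in> lattice_of \<Delta>"
  unfolding local_group_eq
  by (rule coset_rep_in_carrier[OF basis_family.edge_lattice_subgroup[OF top_basis_family]])

text \<open>At a regular point \<open>phi\<close> is the theta quotient and the powers of \<zeta>
  merge into one twist, so the genus is \<open>total\<close> at the vector z w. The quasi-periods
  belong to the direction v of \<open>balanced_fan\<close>, not to w.\<close>

lemma genus_at_zero:
  assumes \<tau>: "Im \<tau> > 0" and reg: "regular_point \<Delta> V w z \<tau>"
  shows "genus_at \<Delta> V N k w z \<tau> = 0"
proof -
  define L where "L = lattice_of \<Delta>"
  define \<sigma> :: complex where "\<sigma> = of_nat k / of_nat N"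
  obtain c v where bal: "balanced_fan L (top_simplices \<Delta>) V (weight \<Delta>) \<tau> \<sigma> c v"
    and prod: "\<And>I l. I \<in> top_simplices \<Delta> \<Longrightarrow> l \<in> L \<Longrightarrow>
       (\<Prod>i\<in>I. e2pi \<sigma> powi breve N (dual_vector V I i l)) = e2pi (of_real (c l))"
    using balanced_fan_exists \<tau> unfolding L_def \<sigma>_def by metis
  interpret B: balanced_fan L "top_simplices \<Delta>" V "weight \<Delta>" \<tau> \<sigma> c v by (rule bal)
  have H: "B.H I = local_group \<Delta> V I" for I by (simp add: local_group_eq L_def)
  have arg: "phi_arg V w z \<tau> I h1 h2 i = - cev (dual_vector V I i) (B.shifted (cscale z w) (coset_rep h1) (coset_rep h2))"
    if "I \<in> top_simplices \<Delta>" for I h1 h2 i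
    by (simp add: phi_arg_def Let_def B.cev_shifted[OF that] cev_cscale B.linU[OF that])
  have np: "phi_arg V w z \<tau> I h1 h2 i \<notin> period_lattice \<tau>"
    if "I \<in> top_simplices \<Delta>" "h1 \<in> B.H I" "h2 \<in> B.H I" "i \<in> I" for I h1 h2 i
    using reg that unfolding regular_point_def period_lattice_def H by blast
  have "genus_at \<Delta> V N k w z \<tau> = B.total (cscale z w)"
    unfolding genus_at_def B.total_def Let_def H[symmetric] \<sigma>_def[symmetric]
  proof (intro sum.cong arg_cong2[where f = "(*)"] refl)
    fix I h assume I: "I \<in> top_simplices \<Delta>" and h: "h \<in> B.H I \<times> B.H I"
    obtain h1 h2 where h12: "h = (h1, h2)" "h1 \<in> B.H I" "h2 \<in> B.H I" using h by auto
    have "(\<Prod>i\<in>I. e2pi \<sigma> powi breve N (dual_vector V I i (coset_rep h1)) * phi (phi_arg V w z \<tau> I h1 h2 i) \<tau> \<sigma>) =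
      (\<Prod>i\<in>I. e2pi \<sigma> powi breve N (dual_vector V I i (coset_rep h1))) * 
      (\<Prod>i\<in>I. theta_quot \<tau> \<sigma> (phi_arg V w z \<tau> I h1 h2 i))"
      unfolding prod.distrib[symmetric]
      using np[OF I h12(2,3)] by (intro prod.cong refl) (simp add: phi_eq_theta_quot[OF \<tau>])
    also have "\<dots> = B.summand I (coset_rep h1) (coset_rep h2) (cscale z w)"
      using prod[OF I B.rep_in[OF I h12(2)]] by (simp add: B.summand_def arg[OF I])
    finally show "(case h of (h1, h2) \<Rightarrow> \<Prod>i\<in>I. e2pi \<sigma> powi breve N (dual_vector V I i (coset_rep h1)) * phi (phi_arg V w z \<tau> I h1 h2 i) \<tau> \<sigma>) =
      (case h of (h1, h2) \<Rightarrow> B.summand I (coset_rep h1) (coset_rep h2) (cscale z w))"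
      by (simp add: h12(1))
  qed
  also have "\<dots> = 0"
  proof (rule B.total_eq_0)
    fix I h1 h2 i assume I: "I \<in> top_simplices \<Delta>" "h1 \<in> B.H I" "h2 \<in> B.H I" "i \<in> I"
    show "\<not> B.pole I i (coset_rep h1) (coset_rep h2) (cscale z w)"
      using np[OF I] unfolding arg[OF I(1)] B.pole_def period_lattice_uminus .
  qed
  finally show ?thesis .
qed

lemma modified_genus_zero: "is_modified_genus \<Delta> V N k 0"
  unfolding is_modified_genus_def Let_def
proof (intro conjI allI ballI impI)
  fix m u
  show "Poly_Mapping.keys ((0 :: (('a \<Rightarrow> real) \<Rightarrow>\<^sub>0 complex) fps) $ m) \<subseteq> dual_lattice (lattice_of \<Delta>)"
    by simp
  show "\<exists>p :: int poly. Poly_Mapping.lookup ((0 :: (('a \<Rightarrow> real) \<Rightarrow>\<^sub>0 complex) fps) $ m) u =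
      e2pi (- of_nat (rank_of \<Delta>) * (of_nat k / of_nat N) / 2) * poly (map_poly of_int p) (e2pi (of_nat k / of_nat N))"
    by (intro exI[of _ 0]) simp
next
  fix v z
  show "\<exists>B>0. \<forall>\<tau>. Im \<tau> > B \<longrightarrow> regular_point \<Delta> V v z \<tau> \<longrightarrow>
      (\<lambda>m. char_pullback v ((0 :: (('a \<Rightarrow> real) \<Rightarrow>\<^sub>0 complex) fps) $ m) z * e2pi \<tau> ^ m) sums genus_at \<Delta> V N k v z \<tau>"
    by (intro exI[of _ 1]) (auto simp: genus_at_zero char_pullback_def)
qed

lemma common_edge_lattice_subgroup: "add_subgroup (common_edge_lattice \<Delta> V)"
  using basis_family.edge_lattice_subgroup[OF top_basis_family]
  unfolding common_edge_lattice_def add_subgroup_def by blast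

text \<open>The common edge lattice contains \<open>exponent\<close> times the lattice and hence
  spans the space.\<close>

lemma common_edge_lattice_detects:
  assumes f: "linear f" "f x \<noteq> (0::real)"
  shows "\<exists>y\<in>common_edge_lattice \<Delta> V. f y \<noteq> 0"
proof -
  define L where "L = lattice_of \<Delta>"
  have "\<exists>l\<in>L. f l \<noteq> 0"
  proof (rule ccontr)
    assume *: "\<not> (\<exists>l\<in>L. f l \<noteq> 0)"
    have "x \<in> span L" using full by (simp add: L_def)
    hence "f x = 0" by (rule linear_eq_0_on_span[OF f(1), rotated]) (use * in blast)
    thus False using f(2) by simp
  qed
  then obtain l where l: "l \<in> L" "f l \<noteq> 0" by blast
  have "real exponent *\<^sub>R l \<in> edge_lattice V I" if "I \<in> top_simplices \<Delta>" for I
    using exponent_scale_mem[OF that finite_local_group[OF N cop that]] l(1) by (simp add: L_def)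
  moreover have "exponent \<noteq> 0"
  proof -
    have "card (local_group \<Delta> V I) \<noteq> 0" if "I \<in> top_simplices \<Delta>" for I
      using cop N that by (metis coprime_0_right_iff is_unit_gcd_iff nat_dvd_1_iff_1 less_irrefl)
    thus ?thesis unfolding exponent_def using finite_top by simp
  qed
  ultimately show ?thesis
    using l(2) by (intro bexI[of _ "real exponent *\<^sub>R l"]) (auto simp: linear_scale[OF f(1)] common_edge_lattice_def)
qed

text \<open>A cone of lower dimension lacks a vertex i of some top simplex I containing it, so its
  span lies in the kernel of the dual vector of i.\<close>

lemma generic_if_dual_nonzero:
  assumes "\<And>I i. I \<in> top_simplices \<Delta> \<Longrightarrow> i \<in> I \<Longrightarrow> dual_vector V I i v \<noteq> 0"
  shows "generic \<Delta> v"
  unfolding generic_def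
proof (intro conjI ballI impI)
  show "v \<in> span (lattice_of \<Delta>)" using full by simp
  fix J assume J: "J \<in> simplices \<Delta>" "dim (cone_of \<Delta> J) < rank_of \<Delta>"
  obtain I where I: "I \<in> top_simplices \<Delta>" "J \<subseteq> I"
    using multifan[unfolded is_multifan_def, THEN conjunct2, THEN conjunct2, THEN conjunct2, 
      THEN conjunct2, THEN conjunct2, THEN conjunct1] J(1) by blast
  have "J \<noteq> I" using topD[OF I(1)] simplexD(3)[OF J(1)] J(2) by auto
  then obtain i where i: "i \<in> I" "i \<notin> J" using I(2) by blast
  interpret B: basis_family V I by (rule top_basis_family[OF I(1)])
  have "B.dual i x = 0" if "x \<in> span (cone_of \<Delta> J)" for x
    using that unfolding span_cone[OF J(1)]
    by (rule linear_eq_0_on_span[OF B.linear_dual, rotated]) (use i I(2) B.dual_basis in auto)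
  thus "v \<notin> span (cone_of \<Delta> J)" using assms[OF I(1) i(1)] by blast
qed

lemma dual_generic_nonzero:
  assumes "generic \<Delta> v" "I \<in> top_simplices \<Delta>" "i \<in> I"
  shows "dual_vector V I i v \<noteq> 0"
proof
  assume 0: "dual_vector V I i v = 0"
  interpret B: basis_family V I by (rule top_basis_family[OF assms(2)])
  define J where "J = I - {i}"
  have J: "J \<in> simplices \<Delta>" using topD[OF assms(2)] simplexD(5)[of I J] by (auto simp: J_def)
  have "card J < card I" unfolding J_def using B.fin assms(3) by (rule card_Diff1_less)
  hence "dim (cone_of \<Delta> J) < rank_of \<Delta>"
    using simplexD(3)[OF J] topD[OF assms(2)] by simp
  hence "v \<notin> span (V ` J)" using assms(1) J span_cone[OF J] by (auto simp: generic_def)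
  moreover have "(\<Sum>j\<in>J. B.dual j v *\<^sub>R V j) = v"
    using B.dual_expansion[of v] sum.remove[OF B.fin assms(3), of "\<lambda>j. B.dual j v *\<^sub>R V j"] 0 by (simp add: J_def)
  moreover have "(\<Sum>j\<in>J. B.dual j v *\<^sub>R V j) \<in> span (V ` J)"
    by (intro span_sum span_scale span_base) auto
  ultimately show False by simp
qed

text \<open>The equation of a pole, solved for \<tau>, gives (z \<alpha> + \<beta>)/\<gamma> with
  rational \<alpha>, \<beta>, \<gamma>. If \<gamma> were 0, z \<alpha> would be real, contrary to
  \<alpha> being nonzero (genericity) and z not real.\<close>

lemma irregular_countable:
  assumes v: "v \<in> common_edge_lattice \<Delta> V" "generic \<Delta> v" and z: "Im z \<noteq> 0"
  shows "countable {\<tau>. Im \<tau> > 0 \<and> \<not> regular_point \<Delta> V v z \<tau>}"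
proof -
  define C where "C = (\<lambda>(a, b, c). (z * of_real a + of_real b) / of_real c) ` (\<rat> \<times> \<rat> \<times> \<rat>)"
  have "countable C" unfolding C_def using countable_rat by auto
  moreover have "\<tau> \<in> C" if nr: "\<not> regular_point \<Delta> V v z \<tau>" for \<tau>
  proof -
    obtain I h1 h2 i a b where I: "I \<in> top_simplices \<Delta>" "h1 \<in> local_group \<Delta> V I" "h2 \<in> local_group \<Delta> V I" "i \<in> I"
      and eq: "phi_arg V v z \<tau> I h1 h2 i = of_int a + of_int b * \<tau>"
      using nr unfolding regular_point_def by blast
    define \<alpha> where "\<alpha> = dual_vector V I i v"
    define \<beta> where "\<beta> = dual_vector V I i (coset_rep h2) + of_int a"
    define \<gamma> where "\<gamma> = dual_vector V I i (coset_rep h1) - of_int b"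
    have "v \<in> edge_lattice V I" using v(1) I(1) by (simp add: common_edge_lattice_def)
    hence "\<alpha> \<in> \<int>"
      using basis_family.edge_lattice_iff[OF top_basis_family[OF I(1)]] I(4) by (simp add: \<alpha>_def)
    hence \<alpha>: "\<alpha> \<in> \<rat>" using Ints_subset_Rats by blast
    have \<beta>: "\<beta> \<in> \<rat>" and \<gamma>: "\<gamma> \<in> \<rat>"
      using dual_vector_rational[OF I(1,4)] local_rep[OF I(1)] I(2,3) by (auto simp: \<beta>_def \<gamma>_def)
    have \<alpha>0: "\<alpha> \<noteq> 0" unfolding \<alpha>_def by (rule dual_generic_nonzero[OF v(2) I(1,4)])
    have e: "z * of_real \<alpha> + of_real \<beta> = of_real \<gamma> * \<tau>"
      using eq by (simp add: phi_arg_def Let_def \<alpha>_def \<beta>_def \<gamma>_def algebra_simps)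
    have "\<gamma> \<noteq> 0"
    proof
      assume "\<gamma> = 0"
      hence "Im (z * of_real \<alpha> + of_real \<beta>) = 0" using e by simp
      thus False using z \<alpha>0 by simp
    qed
    hence "\<tau> = (z * of_real \<alpha> + of_real \<beta>) / of_real \<gamma>" using e by simp
    thus ?thesis unfolding C_def using \<alpha> \<beta> \<gamma> by (auto intro!: image_eqI[of _ _ "(\<alpha>, \<beta>, \<gamma>)"])
  qed
  ultimately show ?thesis by (auto intro: countable_subset)
qed

text \<open>Vanishing of the functions kills the pullback of each q-coefficient. One v that is
  generic and separates the finitely many characters of a coefficient then reduces the claim to real
  exponentials with distinct rates.\<close>

lemma modified_genus_unique:
  assumes P: "is_modified_genus \<Delta> V N k P"
  shows "P = 0"
proof (rule fps_ext)
  fix m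
  have pull: "char_pullback v (P $ m) z = 0"
    if v: "v \<in> common_edge_lattice \<Delta> V" "generic \<Delta> v" and z: "Im z \<noteq> 0" for v z
  proof -
    obtain B where B: "B > 0" "\<And>\<tau>. Im \<tau> > B \<Longrightarrow> regular_point \<Delta> V v z \<tau> \<Longrightarrow>
       (\<lambda>m. char_pullback v (P $ m) z * e2pi \<tau> ^ m) sums genus_at \<Delta> V N k v z \<tau>"
      using P v unfolding is_modified_genus_def Let_def by blast
    show ?thesis
    proof (rule nome_series_zero[OF irregular_countable[OF v z]])
      fix \<tau> assume \<tau>: "Im \<tau> > B" "\<tau> \<notin> {\<tau>. Im \<tau> > 0 \<and> \<not> regular_point \<Delta> V v z \<tau>}"
      hence "Im \<tau> > 0" "regular_point \<Delta> V v z \<tau>" using B(1) by auto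
      thus "(\<lambda>m. char_pullback v (P $ m) z * e2pi \<tau> ^ m) sums 0"
        using B(2)[OF \<tau>(1)] genus_at_zero by metis
    qed
  qed
  show "P $ m = 0 $ m"
  proof (rule ccontr)
    assume "P $ m \<noteq> 0 $ m"
    define A where "A = Poly_Mapping.keys (P $ m)"
    have A: "finite A" "A \<noteq> {}" using \<open>P $ m \<noteq> 0 $ m\<close> by (auto simp: A_def)
    have linA: "linear u" if "u \<in> A" for u
      using P that unfolding is_modified_genus_def Let_def A_def dual_lattice_def by blast
    \<comment> \<open>Nonvanishing on the first family makes v generic, on the second it separates
      the characters.\<close>
    define F where "F = (\<lambda>(I, i). dual_vector V I i) ` Sigma (top_simplices \<Delta>) (\<lambda>I. I) \<union> 
       (\<lambda>(u, u') x. u x - u' x) ` {(u, u') \<in> A \<times> A. u \<noteq> u'}"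
    have "finite (Sigma (top_simplices \<Delta>) (\<lambda>I. I))"
      using finite_top simplexD(1) topD by (intro finite_SigmaI) auto
    moreover have "finite {(u, u') \<in> A \<times> A. u \<noteq> u'}"
      by (rule finite_subset[of _ "A \<times> A"]) (use A in auto)
    ultimately have finF: "finite F" by (simp add: F_def)
    have F: "linear f \<and> (\<exists>x. f x \<noteq> 0)" if f: "f \<in> F" for f
    proof -
      consider I i where "I \<in> top_simplices \<Delta>" "i \<in> I" "f = dual_vector V I i" 
        | u u' where "u \<in> A" "u' \<in> A" "u \<noteq> u'" "f = (\<lambda>x. u x - u' x)"
        using f unfolding F_def by auto
      thus ?thesis
      proof cases
        case 1
        interpret B: basis_family V I by (rule top_basis_family[OF 1(1)])
        have "f (V i) \<noteq> 0" using 1 B.dual_basis[of i i] by simp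
        thus ?thesis using 1 B.linear_dual by blast
      next
        case 2
        then obtain x where "u x \<noteq> u' x" by blast
        thus ?thesis using 2 linA linear_compose_sub[of u u'] by auto
      qed
    qed
    obtain v where v: "v \<in> common_edge_lattice \<Delta> V" "\<And>f. f \<in> F \<Longrightarrow> f v \<noteq> 0"
      using linear_avoid[OF finF _ _ common_edge_lattice_subgroup] F common_edge_lattice_detects by metis
    have gen: "generic \<Delta> v"
      by (rule generic_if_dual_nonzero) (use v(2) in \<open>auto simp: F_def\<close>)
    have inj: "inj_on (\<lambda>u. 2 * pi * u v) A"
    proof
      fix u u' assume u: "u \<in> A" "u' \<in> A" "2 * pi * u v = 2 * pi * u' v"
      show "u = u'"
      proof (rule ccontr)
        assume "u \<noteq> u'"
        hence "(\<lambda>x. u x - u' x) \<in> F" using u unfolding F_def by force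
        thus False using v(2)[of "\<lambda>x. u x - u' x"] u(3) by simp
      qed
    qed
    have "\<exists>u\<in>A. Poly_Mapping.lookup (P $ m) u = 0"
    proof (rule exponential_sum_coeff_zero[OF A inj])
      fix t :: real assume t: "t > 0"
      \<comment> \<open>On the positive imaginary axis characters become real exponentials, and z is
        off the real axis as \<open>pull\<close> requires.\<close>
      have "e2pi (of_real (u v) * (\<i> * of_real t)) = of_real (exp (- (2 * pi * u v) * t))" for u :: "'a \<Rightarrow> real"
        by (simp add: e2pi_def exp_of_real[symmetric] algebra_simps flip: power2_eq_square)
      thus "(\<Sum>u\<in>A. Poly_Mapping.lookup (P $ m) u * of_real (exp (- (2 * pi * u v) * t))) = 0"
        using pull[OF v(1) gen, of "\<i> * of_real t"] t by (simp add: char_pullback_def A_def)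
    qed
    thus False by (auto simp: A_def in_keys_iff)
  qed
qed

end

theorem theorem3p2:
  fixes \<Delta> :: "('i, 'a::euclidean_space) multifan"
    and V :: "'i \<Rightarrow> 'a"
    and N k :: nat
  assumes "is_multifan \<Delta>"
    and "span (lattice_of \<Delta>) = UNIV"
    and "complete_multifan \<Delta>"
    and "edge_vectors \<Delta> V"
    and "N > 1"
    and "\<forall>I\<in>top_simplices \<Delta>. coprime N (card (local_group \<Delta> V I))"
    and "c1_divisible \<Delta> V N"
    and "0 < k" and "k < N"
  shows "(\<forall>P. is_modified_genus \<Delta> V N k P \<longleftrightarrow> P = 0) \<and>
         (\<forall>v \<in> common_edge_lattice \<Delta> V. generic \<Delta> v \<longrightarrow>
            (\<forall>z \<tau>. Im \<tau> > 0 \<longrightarrow> regular_point \<Delta> V v z \<tau> \<longrightarrow> genus_at \<Delta> V N k v z \<tau> = 0))"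
proof -
  interpret divisible_multifan \<Delta> V N k
    by unfold_locales (use assms in blast)+
  show ?thesis
    using modified_genus_zero modified_genus_unique genus_at_zero by blast
qed

end
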